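(* Let $N\ge 3$, $p,q>0$, $pq>1$ and $a,b>-2$. Assume that $(p,q,a,b)$ is subcritical, i.e. $\frac{N+a}{p+1}+\frac{N+b}{q+1}>N-2$, and that $(u,v)$ is a nonnegative solution of the system (HLE). If there exist $R_4>R_1>0$ and $C_0>0$ such that $$\int_{B_{R_4}\setminus B_{R_1}}\left(u_R^{q+1}+v_R^{p+1}\right)\,dx\le C_0\quad\text{for all sufficiently large }R>0,$$ then $u\equiv v\equiv0$ in $\mathbb{R}^N$.
   Context: (HLE) is the system $-\Delta u=|x|^a|v|^{p-1}v$, $-\Delta v=|x|^b|u|^{q-1}u$ in $\mathbb{R}^N\setminus\{0\}$. A solution is a pair $(u,v)\in\left(C^2(\mathbb{R}^N\setminus\{0\})\cap C(\mathbb{R}^N)\right)^2$ satisfying the system pointwise in $\mathbb{R}^N\setminus\{0\}$; it is nonnegative if $u\ge0$ and $v\ge0$. Put $\tilde\alpha=\frac{2(p+1)+a+pb}{pq-1}$, $\tilde\beta=\frac{2(q+1)+b+qa}{pq-1}$, and for $R>0$ let $u_R(x)=R^{\tilde\alpha}u(Rx)$, $v_R(x)=R^{\tilde\beta}v(Rx)$. $B_R=\{x\in\mathbb{R}^N:|x|<R\}$. *)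

theory Defs
  imports "HOL-Analysis.Analysis"
begin

definition partial_deriv :: "'n \<Rightarrow> (real ^ 'n::finite \<Rightarrow> real) \<Rightarrow> real ^ 'n \<Rightarrow> real" where
  "partial_deriv i f x = frechet_derivative f (at x) (axis i 1)"

(* Intended for open S only: differentiability is required at x, not merely within S. *)
definition C1_on :: "(real ^ 'n::finite) set \<Rightarrow> (real ^ 'n \<Rightarrow> real) \<Rightarrow> bool" where
  "C1_on S f \<longleftrightarrow>
     (\<forall>x\<in>S. f differentiable (at x)) \<and> (\<forall>i. continuous_on S (partial_deriv i f))"

definition C2_on :: "(real ^ 'n::finite) set \<Rightarrow> (real ^ 'n \<Rightarrow> real) \<Rightarrow> bool" where
  "C2_on S f \<longleftrightarrow> C1_on S f \<and> (\<forall>i. C1_on S (partial_deriv i f))"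

definition laplacian :: "(real ^ 'n::finite \<Rightarrow> real) \<Rightarrow> real ^ 'n \<Rightarrow> real" where
  "laplacian f x = (\<Sum>i\<in>UNIV. partial_deriv i (partial_deriv i f) x)"

(* Where v x = 0 the term |v|^(p-1) v is 0 for every p > 0, also for p < 1,
   because 0 powr (p - 1) = 0. *)
definition HLE_solution ::
    "real \<Rightarrow> real \<Rightarrow> real \<Rightarrow> real \<Rightarrow> (real ^ 'n::finite \<Rightarrow> real) \<Rightarrow> (real ^ 'n \<Rightarrow> real) \<Rightarrow> bool" where
  "HLE_solution p q a b u v \<longleftrightarrow>
     C2_on (UNIV - {0}) u \<and> continuous_on UNIV u \<and>
     C2_on (UNIV - {0}) v \<and> continuous_on UNIV v \<and>
     (\<forall>x. x \<noteq> 0 \<longrightarrow>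
        - laplacian u x = norm x powr a * \<bar>v x\<bar> powr (p - 1) * v x \<and>
        - laplacian v x = norm x powr b * \<bar>u x\<bar> powr (q - 1) * u x)"

definition nonneg_HLE_solution ::
    "real \<Rightarrow> real \<Rightarrow> real \<Rightarrow> real \<Rightarrow> (real ^ 'n::finite \<Rightarrow> real) \<Rightarrow> (real ^ 'n \<Rightarrow> real) \<Rightarrow> bool" where
  "nonneg_HLE_solution p q a b u v \<longleftrightarrow>
     HLE_solution p q a b u v \<and> (\<forall>x. u x \<ge> 0) \<and> (\<forall>x. v x \<ge> 0)"

definition alpha_tilde :: "real \<Rightarrow> real \<Rightarrow> real \<Rightarrow> real \<Rightarrow> real" where
  "alpha_tilde p q a b = (2 * (p + 1) + a + p * b) / (p * q - 1)"

definition beta_tilde :: "real \<Rightarrow> real \<Rightarrow> real \<Rightarrow> real \<Rightarrow> real" where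
  "beta_tilde p q a b = (2 * (q + 1) + b + q * a) / (p * q - 1)"

definition rescale :: "real \<Rightarrow> real \<Rightarrow> (real ^ 'n::finite \<Rightarrow> real) \<Rightarrow> real ^ 'n \<Rightarrow> real" where
  "rescale \<gamma> R w x = R powr \<gamma> * w (R *\<^sub>R x)"

definition subcritical :: "nat \<Rightarrow> real \<Rightarrow> real \<Rightarrow> real \<Rightarrow> real \<Rightarrow> bool" where
  "subcritical N p q a b \<longleftrightarrow>
     (real N + a) / (p + 1) + (real N + b) / (q + 1) > real N - 2"

end

theory Submission
  imports Defs
begin

text \<open>
  Write f = - Laplacian u and g = - Laplacian v; both are nonnegative. Let N be the dimension, let
  alpha, beta be the scaling exponents alpha_tilde, beta_tilde, and put c = ((N+a)/(p+1) +
  (N+b)/(q+1) - (N-2))/2, which is positive by subcriticality. There is a vector field Z, built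
  from u, v and their gradients, with div Z = - c (u g + v f) away from the origin. Testing this with
  a cut-off at a large radius R and a small radius eps bounds the integral of u g + v f by two
  boundary terms, which scale like R to the power N-2-alpha-beta and like eps to the power N-2. The
  first exponent is negative by subcriticality and the second is positive, so both terms vanish in
  the limit, provided that the rescaled boundary terms stay bounded.

  The only delicate boundary term is the integral of |Du||Dv| over an annulus. Calderon-Zygmund
  estimates are avoided by using the signs: |Du| is bounded by the truncated Riesz potential
  I1 f of order one, plus an average of u, and likewise for v. The composition of two potentials
  of order one is bounded by a potential of order two, I2, and I2 g is at most a multiple of v
  because v is nonnegative and superharmonic. So the integral of I1 f I1 g is bounded by those of
  f v and g u, which the hypothesis controls.
\<close>

text \<open>The hypothesis controls products only: f v, g u and, by a crude Young inequality, u(x)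
  g(y) and v(x) f(y). So the gradients are never estimated separately in a power norm; I1 f and I1 g
  occur multiplied by each other, by u or v, or by a constant. Averages are taken against polynomial
  weights supported in a ball, so that only volume integrals occur and no good sphere has to be
  selected. The origin acts as a second boundary: u and v are merely continuous there and their
  gradients may blow up. The functions u(eps y), v(eps y) solve the same system with coefficients
  eps^(2+a) and eps^(2+b), which are at most 1 because a, b > -2, so the estimate on a fixed annulus
  applies to them as well. One constant has to serve all scales; this is why the annulus estimates
  fix their constants before the functions. The constant c is the subcritical excess split evenly,
  so that u g and v f receive the same coefficient in the divergence.\<close>

abbreviation pd :: "'n \<Rightarrow> (real ^ 'n::finite \<Rightarrow> real) \<Rightarrow> real ^ 'n \<Rightarrow> real" where
  "pd \<equiv> partial_deriv"

abbreviation nn_integral_lborel :: "('a::euclidean_space \<Rightarrow> ennreal) \<Rightarrow> ennreal" (binder "\<integral>\<^sup>*" 10) where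
  "nn_integral_lborel \<equiv> nn_integral lborel"

subsection \<open>Partial derivatives and integration by parts\<close>

lemma has_derivative_imp_partial_deriv:
  assumes "(f has_derivative f') (at x)"
  shows "pd i f x = f' (axis i 1)"
  unfolding partial_deriv_def using frechet_derivative_at[OF assms] by simp

lemma has_derivative_partial_deriv:
  assumes "f differentiable (at x)"
  shows "(f has_derivative (\<lambda>h. \<Sum>i\<in>UNIV. h $ i * pd i f x)) (at x)"
proof -
  let ?D = "frechet_derivative f (at x)"
  have D: "(f has_derivative ?D) (at x)"
    using assms frechet_derivative_works by blast
  interpret bounded_linear ?D using D has_derivative_bounded_linear by blast
  have "?D h = (\<Sum>i\<in>UNIV. h $ i * pd i f x)" for h
  proof -
    have "?D h = ?D (\<Sum>i\<in>UNIV. h $ i *\<^sub>R axis i 1)"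
      using basis_expansion[of h] by (simp add: scalar_mult_eq_scaleR)
    also have "\<dots> = (\<Sum>i\<in>UNIV. h $ i * pd i f x)"
      by (simp add: sum scaleR partial_deriv_def)
    finally show ?thesis .
  qed
  then have "?D = (\<lambda>h. \<Sum>i\<in>UNIV. h $ i * pd i f x)" by blast
  then show ?thesis using D by simp
qed

lemma partial_deriv_along_axis:
  assumes "f differentiable (at (x + t *\<^sub>R axis i 1))"
  shows "((\<lambda>s. f (x + s *\<^sub>R axis i 1)) has_real_derivative pd i f (x + t *\<^sub>R axis i 1)) (at t)"
proof -
  have d: "((\<lambda>s. x + s *\<^sub>R axis i 1) has_derivative (\<lambda>h. h *\<^sub>R axis i 1)) (at t)"
    by (auto intro!: derivative_eq_intros)
  have "((\<lambda>s. f (x + s *\<^sub>R axis i 1)) has_derivative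
     (\<lambda>h. \<Sum>j\<in>UNIV. (h *\<^sub>R axis i 1) $ j * pd j f (x + t *\<^sub>R axis i 1))) (at t)"
    using has_derivative_compose[OF d has_derivative_partial_deriv[OF assms]] by simp
  moreover have "(\<Sum>j\<in>UNIV. (h *\<^sub>R axis i 1) $ j * pd j f y)
      = pd i f y * h" for h y
  proof -
    have "(\<Sum>j\<in>UNIV. (h *\<^sub>R axis i 1) $ j * pd j f y)
      = (\<Sum>j\<in>UNIV. if j = i then h * pd j f y else 0)"
      by (rule sum.cong) (auto simp: axis_def)
    then show ?thesis by simp
  qed
  ultimately show ?thesis unfolding has_field_derivative_def by simp
qed

lemma partial_deriv_along_ray:
  assumes "f differentiable (at (x + t *\<^sub>R z))"
  shows "((\<lambda>s. f (x + s *\<^sub>R z)) has_real_derivative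
           (\<Sum>j\<in>UNIV. z $ j * pd j f (x + t *\<^sub>R z))) (at t)"
proof -
  have d: "((\<lambda>s. x + s *\<^sub>R z) has_derivative (\<lambda>h. h *\<^sub>R z)) (at t)"
    by (auto intro!: derivative_eq_intros)
  have "((\<lambda>s. f (x + s *\<^sub>R z)) has_derivative
     (\<lambda>h. \<Sum>j\<in>UNIV. (h *\<^sub>R z) $ j * pd j f (x + t *\<^sub>R z))) (at t)"
    using has_derivative_compose[OF d has_derivative_partial_deriv[OF assms]] by simp
  then show ?thesis unfolding has_field_derivative_def
    by (rule has_derivative_eq_rhs) (simp add: fun_eq_iff sum_distrib_left mult_ac)
qed

text \<open>\<open>frechet_derivative\<close> is a choice among the admissible derivatives.
  Functions that agree near x admit the same ones, so the choices coincide even where no derivative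
  exists.\<close>

lemma partial_deriv_transform_open:
  assumes "open S" "x \<in> S" "\<And>y. y \<in> S \<Longrightarrow> f y = g y"
  shows "pd i f x = pd i g x"
proof -
  have "(f has_derivative D) (at x) \<longleftrightarrow> (g has_derivative D) (at x)" for D
    using has_derivative_transform_within_open[of f D x UNIV S g]
      has_derivative_transform_within_open[of g D x UNIV S f] assms by auto
  then show ?thesis unfolding partial_deriv_def frechet_derivative_def by simp
qed

lemma differentiable_transform_open:
  assumes "open S" "x \<in> S" "\<And>y. y \<in> S \<Longrightarrow> f y = g y" "f differentiable (at x)"
  shows "g differentiable (at x)"
  using assms has_derivative_transform_within_open unfolding differentiable_def by blast

lemma C1_on_cong_open:
  assumes "open S" "\<And>y. y \<in> S \<Longrightarrow> f y = g y" "C1_on S f"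
  shows "C1_on S g"
proof -
  have "pd i f x = pd i g x" if "x \<in> S" for i x
    using partial_deriv_transform_open[OF assms(1) that assms(2)] .
  then have "continuous_on S (pd i g)" for i
    using assms(3) continuous_on_cong[of S S "pd i f" "pd i g"]
    unfolding C1_on_def by auto
  then show ?thesis using assms differentiable_transform_open unfolding C1_on_def by metis
qed

lemma C1_on_continuous: "C1_on S f \<Longrightarrow> continuous_on S f"
  unfolding C1_on_def
  by (meson continuous_at_imp_continuous_on differentiable_imp_continuous_within)

lemma C1_on_subset: "C1_on S f \<Longrightarrow> T \<subseteq> S \<Longrightarrow> C1_on T f"
  unfolding C1_on_def by (meson continuous_on_subset subsetD)

lemma C1_on_UnionI:
  assumes "open S" "open T" "C1_on S f" "C1_on T f"
  shows "C1_on (S \<union> T) f"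
  using assms unfolding C1_on_def by (auto intro: continuous_on_open_Un)

lemma partial_deriv_mult:
  assumes "f differentiable (at x)" "g differentiable (at x)"
  shows "pd i (\<lambda>x. f x * g x) x = f x * pd i g x + pd i f x * g x"
proof -
  from assms obtain f' g' where *: "(f has_derivative f') (at x)" "(g has_derivative g') (at x)"
    unfolding differentiable_def by blast
  show ?thesis
    using has_derivative_imp_partial_deriv[OF has_derivative_mult[OF *]]
     has_derivative_imp_partial_deriv[OF *(1)] has_derivative_imp_partial_deriv[OF *(2)] by simp
qed

lemma partial_deriv_add:
  assumes "f differentiable (at x)" "g differentiable (at x)"
  shows "pd i (\<lambda>x. f x + g x) x = pd i f x + pd i g x"
proof -
  from assms obtain f' g' where *: "(f has_derivative f') (at x)" "(g has_derivative g') (at x)"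
    unfolding differentiable_def by blast
  show ?thesis
    using has_derivative_imp_partial_deriv[OF has_derivative_add[OF *]]
     has_derivative_imp_partial_deriv[OF *(1)] has_derivative_imp_partial_deriv[OF *(2)] by simp
qed

lemma partial_deriv_diff:
  assumes "f differentiable (at x)" "g differentiable (at x)"
  shows "pd i (\<lambda>x. f x - g x) x = pd i f x - pd i g x"
proof -
  from assms obtain f' g' where *: "(f has_derivative f') (at x)" "(g has_derivative g') (at x)"
    unfolding differentiable_def by blast
  show ?thesis
    using has_derivative_imp_partial_deriv[OF has_derivative_diff[OF *]]
     has_derivative_imp_partial_deriv[OF *(1)] has_derivative_imp_partial_deriv[OF *(2)] by simp
qed

lemma partial_deriv_sum:
  assumes "finite J" "\<And>j. j \<in> J \<Longrightarrow> f j differentiable (at x)"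
  shows "pd i (\<lambda>x. \<Sum>j\<in>J. f j x) x = (\<Sum>j\<in>J. pd i (f j) x)"
proof -
  have "((\<lambda>x. \<Sum>j\<in>J. f j x) has_derivative (\<lambda>h. \<Sum>j\<in>J. frechet_derivative (f j) (at x) h)) (at x)"
    by (rule has_derivative_sum) (use assms frechet_derivative_works in blast)
  from has_derivative_imp_partial_deriv[OF this] show ?thesis by (simp add: partial_deriv_def)
qed

lemma partial_deriv_const [simp]: "pd i (\<lambda>x. c) x = 0"
  using has_derivative_imp_partial_deriv[OF has_derivative_const] by blast

lemma partial_deriv_cmult:
  assumes "g differentiable (at x)"
  shows "pd i (\<lambda>x. c * g x) x = c * pd i g x"
  using partial_deriv_mult[OF _ assms, of "\<lambda>_. c"] by simp

lemma differentiable_component [simp]: "(\<lambda>x. x $ j) differentiable (at x)"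
  using bounded_linear_imp_differentiable[OF bounded_linear_vec_nth] .

lemma partial_deriv_component: "pd i (\<lambda>x. x $ j) x = (if i = j then 1 else 0)"
proof -
  have "((\<lambda>x. x $ j) has_derivative (\<lambda>x. x $ j)) (at x)"
    by (rule bounded_linear_imp_has_derivative) (rule bounded_linear_vec_nth)
  from has_derivative_imp_partial_deriv[OF this] show ?thesis by (auto simp: axis_def)
qed

lemma differentiable_chain_real:
  fixes f :: "real^'n::finite \<Rightarrow> real"
  assumes "f differentiable (at x)" "(h has_real_derivative d) (at (f x))"
  shows "(\<lambda>x. h (f x)) differentiable (at x)"
    and "pd i (\<lambda>x. h (f x)) x = d * pd i f x"
proof -
  from assms(1) obtain f' where *: "(f has_derivative f') (at x)"
    unfolding differentiable_def by blast
  have **: "((\<lambda>x. h (f x)) has_derivative (\<lambda>y. d * f' y)) (at x)"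
    by (rule has_derivative_compose[OF * assms(2)[unfolded has_field_derivative_def]])
  show "(\<lambda>x. h (f x)) differentiable (at x)" using ** unfolding differentiable_def by blast
  show "pd i (\<lambda>x. h (f x)) x = d * pd i f x"
    using has_derivative_imp_partial_deriv[OF **]
     has_derivative_imp_partial_deriv[OF *(1)] by simp
qed

lemma C1_on_mult:
  assumes "C1_on S f" "C1_on S g"
  shows "C1_on S (\<lambda>x. f x * g x)"
  unfolding C1_on_def
proof (intro conjI ballI allI)
  show "(\<lambda>x. f x * g x) differentiable at x" if "x \<in> S" for x
    using assms that unfolding C1_on_def by simp
  fix i
  have "continuous_on S (\<lambda>x. f x * pd i g x + pd i f x * g x)"
    using assms C1_on_continuous[OF assms(1)] C1_on_continuous[OF assms(2)]
    unfolding C1_on_def by (auto intro!: continuous_intros)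
  then show "continuous_on S (pd i (\<lambda>x. f x * g x))"
    by (rule continuous_on_eq) (use assms in \<open>simp add: C1_on_def partial_deriv_mult\<close>)
qed

lemma C1_on_add:
  assumes "C1_on S f" "C1_on S g"
  shows "C1_on S (\<lambda>x. f x + g x)"
  unfolding C1_on_def
proof (intro conjI ballI allI)
  show "(\<lambda>x. f x + g x) differentiable at x" if "x \<in> S" for x
    using assms that unfolding C1_on_def by simp
  fix i
  have "continuous_on S (\<lambda>x. pd i f x + pd i g x)"
    using assms unfolding C1_on_def by (auto intro!: continuous_intros)
  then show "continuous_on S (pd i (\<lambda>x. f x + g x))"
    by (rule continuous_on_eq) (use assms in \<open>simp add: C1_on_def partial_deriv_add\<close>)
qed

lemma C1_on_const: "C1_on S (\<lambda>x. c)"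
  unfolding C1_on_def by (simp add: partial_deriv_const[abs_def])

lemma C1_on_component: "C1_on S (\<lambda>x. x $ j)"
  unfolding C1_on_def by (simp add: partial_deriv_component[abs_def])

lemma C1_on_cmult: "C1_on S g \<Longrightarrow> C1_on S (\<lambda>x. c * g x)"
  by (rule C1_on_mult[OF C1_on_const])

lemma C1_on_diff:
  assumes "C1_on S f" "C1_on S g"
  shows "C1_on S (\<lambda>x. f x - g x)"
  using C1_on_add[OF assms(1) C1_on_cmult[OF assms(2), of "-1"]] by simp

lemma C1_on_sum:
  assumes "finite J" "\<And>j. j \<in> J \<Longrightarrow> C1_on S (f j)"
  shows "C1_on S (\<lambda>x. \<Sum>j\<in>J. f j x)"
  using assms by (induction rule: finite_induct) (auto intro: C1_on_add C1_on_const)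

lemma C1_on_chain_real:
  assumes "C1_on S f" "\<And>x. x \<in> S \<Longrightarrow> f x \<in> T"
    "\<And>y. y \<in> T \<Longrightarrow> (h has_real_derivative h' y) (at y)" "continuous_on T h'"
  shows "C1_on S (\<lambda>x. h (f x))"
  unfolding C1_on_def
proof (intro conjI ballI allI)
  show "(\<lambda>x. h (f x)) differentiable at x" if "x \<in> S" for x
    using differentiable_chain_real(1) assms that unfolding C1_on_def by blast
  fix i
  have "continuous_on S (\<lambda>x. h' (f x))"
    by (rule continuous_on_compose2[OF assms(4) C1_on_continuous[OF assms(1)]]) (use assms(2) in auto)
  then have "continuous_on S (\<lambda>x. h' (f x) * pd i f x)"
    using assms(1) unfolding C1_on_def by (auto intro!: continuous_intros)
  moreover have "h' (f x) * pd i f x = pd i (\<lambda>x. h (f x)) x" if "x \<in> S" for x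
    using differentiable_chain_real(2)[where f=f and h=h and x=x, OF _ assms(3)[OF assms(2)[OF that]]] assms(1) that
    unfolding C1_on_def by metis
  ultimately show "continuous_on S (pd i (\<lambda>x. h (f x)))"
    by (rule continuous_on_eq)
qed

text \<open>The mean value theorem is applied twice: along axis i to the increment of f over a step
  in direction j, then along axis j to \<open>pd i f\<close>.\<close>

lemma second_difference_mean_value:
  fixes f :: "real^'n::finite \<Rightarrow> real"
  assumes h: "h > 0"
    and df: "\<And>s t. 0 \<le> s \<Longrightarrow> s \<le> h \<Longrightarrow> 0 \<le> t \<Longrightarrow> t \<le> h \<Longrightarrow>
        f differentiable (at (x + s *\<^sub>R axis i 1 + t *\<^sub>R axis j 1))
      \<and> pd i f differentiable (at (x + s *\<^sub>R axis i 1 + t *\<^sub>R axis j 1))"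
  obtains s t where "0 \<le> s" "s \<le> h" "0 \<le> t" "t \<le> h"
    "f (x + h *\<^sub>R axis i 1 + h *\<^sub>R axis j 1) - f (x + h *\<^sub>R axis i 1) - f (x + h *\<^sub>R axis j 1) + f x
      = h * h * pd j (pd i f) (x + s *\<^sub>R axis i 1 + t *\<^sub>R axis j 1)"
proof -
  let ?a = "axis i 1 :: real^'n" let ?b = "axis j 1 :: real^'n"
  define g where "g s = f (x + h *\<^sub>R ?b + s *\<^sub>R ?a) - f (x + s *\<^sub>R ?a)" for s
  have "\<exists>s>0. s < h \<and> g h - g 0 = (h - 0) * (pd i f (x + h *\<^sub>R ?b + s *\<^sub>R ?a) - pd i f (x + s *\<^sub>R ?a))"
  proof (rule MVT2[OF h])
    fix s assume s: "0 \<le> s" "s \<le> h"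
    have "f differentiable (at (x + h *\<^sub>R ?b + s *\<^sub>R ?a))" "f differentiable (at (x + s *\<^sub>R ?a))"
      using df[OF s, of h] df[OF s, of 0] h by (auto simp: algebra_simps)
    then show "(g has_real_derivative (pd i f (x + h *\<^sub>R ?b + s *\<^sub>R ?a) - pd i f (x + s *\<^sub>R ?a))) (at s)"
      unfolding g_def by (intro derivative_intros partial_deriv_along_axis)
  qed
  then obtain s where s: "0 < s" "s < h" and eq1: "g h - g 0 = h * (pd i f (x + h *\<^sub>R ?b + s *\<^sub>R ?a) - pd i f (x + s *\<^sub>R ?a))"
    by auto
  have "\<exists>t>0. t < h \<and> pd i f (x + s *\<^sub>R ?a + h *\<^sub>R ?b) - pd i f (x + s *\<^sub>R ?a + 0 *\<^sub>R ?b)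
     = (h - 0) * pd j (pd i f) (x + s *\<^sub>R ?a + t *\<^sub>R ?b)"
  proof (rule MVT2[OF h])
    fix t assume t: "0 \<le> t" "t \<le> h"
    show "((\<lambda>t. pd i f (x + s *\<^sub>R ?a + t *\<^sub>R ?b)) has_real_derivative
       pd j (pd i f) (x + s *\<^sub>R ?a + t *\<^sub>R ?b)) (at t)"
      by (rule partial_deriv_along_axis) (use df[of s t] s t in auto)
  qed
  then obtain t where t: "0 < t" "t < h" and eq2: "pd i f (x + s *\<^sub>R ?a + h *\<^sub>R ?b) - pd i f (x + s *\<^sub>R ?a)
     = h * pd j (pd i f) (x + s *\<^sub>R ?a + t *\<^sub>R ?b)" by auto
  have "x + h *\<^sub>R ?b + s *\<^sub>R ?a = x + s *\<^sub>R ?a + h *\<^sub>R ?b" by simp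
  with eq1 eq2 have "g h - g 0 = h * (h * pd j (pd i f) (x + s *\<^sub>R ?a + t *\<^sub>R ?b))"
    by simp
  then show ?thesis using s t
    by (intro that[of s t]) (auto simp: g_def algebra_simps)
qed

text \<open>The second difference over a small square is unchanged when i and j trade places, so the
  two mixed derivatives take a common value at two points arbitrarily close to x; continuity carries
  this to x.\<close>

lemma partial_deriv_commute:
  fixes f :: "real^'n::finite \<Rightarrow> real"
  assumes "C2_on S f" "open S" "x \<in> S"
  shows "pd i (pd j f) x = pd j (pd i f) x"
proof (rule ccontr)
  let ?a = "axis i 1 :: real^'n" let ?b = "axis j 1 :: real^'n"
  let ?A = "pd i (pd j f)" let ?B = "pd j (pd i f)"
  assume ne: "?A x \<noteq> ?B x"
  \<comment> \<open>Each mixed derivative moves by less than e between x and its intermediate point,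
    so their values at x differ by less than 2 e; a third of the supposed gap is therefore small
    enough.\<close>
  define e where "e = \<bar>?A x - ?B x\<bar> / 3"
  have e: "e > 0" using ne by (simp add: e_def)
  have "isCont ?A x" "isCont ?B x"
    using assms unfolding C2_on_def C1_on_def by (auto simp: continuous_on_eq_continuous_at)
  then obtain d1 d2 where d1: "d1 > 0" "\<And>y. dist y x < d1 \<Longrightarrow> dist (?A y) (?A x) < e"
    and d2: "d2 > 0" "\<And>y. dist y x < d2 \<Longrightarrow> dist (?B y) (?B x) < e"
    using e unfolding continuous_at_eps_delta by metis
  obtain d3 where d3: "d3 > 0" "ball x d3 \<subseteq> S" using assms(2,3) open_contains_ball by blast
  \<comment> \<open>Intermediate points lie within s + t < 3 h of x, whence the division by
    3.\<close>
  define h where "h = min d1 (min d2 d3) / 3"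
  have h: "h > 0" using d1 d2 d3 by (simp add: h_def)
  have near: "dist (x + s *\<^sub>R ?a + t *\<^sub>R ?b) x < min d1 (min d2 d3)"
    if "0 \<le> s" "s \<le> h" "0 \<le> t" "t \<le> h" for s t
  proof -
    have "dist (x + s *\<^sub>R ?a + t *\<^sub>R ?b) x = norm (s *\<^sub>R ?a + t *\<^sub>R ?b)"
      by (simp add: dist_norm add.assoc)
    also have "\<dots> \<le> s + t" using norm_triangle_ineq[of "s *\<^sub>R ?a" "t *\<^sub>R ?b"] that
      by (simp add: norm_axis_1)
    also have "\<dots> < 3 * h" using that h by linarith
    finally show ?thesis by (simp add: h_def)
  qed
  have dif: "f differentiable (at y)" "pd k f differentiable (at y)" if "dist y x < d3" for y k
    using d3 that assms(1) unfolding C2_on_def C1_on_def by (auto simp: dist_commute subset_iff)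
  obtain s t where 1: "0 \<le> s" "s \<le> h" "0 \<le> t" "t \<le> h"
    "f (x + h *\<^sub>R ?a + h *\<^sub>R ?b) - f (x + h *\<^sub>R ?a) - f (x + h *\<^sub>R ?b) + f x = h * h * ?B (x + s *\<^sub>R ?a + t *\<^sub>R ?b)"
    using second_difference_mean_value[OF h, of f x i j] dif near by (metis min_less_iff_conj)
  have near': "dist (x + t *\<^sub>R ?b + s *\<^sub>R ?a) x < min d1 (min d2 d3)"
    if "0 \<le> s" "s \<le> h" "0 \<le> t" "t \<le> h" for s t
    using near[OF that] by (simp add: algebra_simps)
  obtain t' s' where 2: "0 \<le> t'" "t' \<le> h" "0 \<le> s'" "s' \<le> h"
    "f (x + h *\<^sub>R ?b + h *\<^sub>R ?a) - f (x + h *\<^sub>R ?b) - f (x + h *\<^sub>R ?a) + f x = h * h * ?A (x + t' *\<^sub>R ?b + s' *\<^sub>R ?a)"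
    using second_difference_mean_value[OF h, of f x j i] dif near' by (metis min_less_iff_conj)
  have "x + h *\<^sub>R ?b + h *\<^sub>R ?a = x + h *\<^sub>R ?a + h *\<^sub>R ?b" by simp
  then have "f (x + h *\<^sub>R ?a + h *\<^sub>R ?b) - f (x + h *\<^sub>R ?a) - f (x + h *\<^sub>R ?b) + f x
      = f (x + h *\<^sub>R ?b + h *\<^sub>R ?a) - f (x + h *\<^sub>R ?b) - f (x + h *\<^sub>R ?a) + f x"
    by (simp add: algebra_simps)
  with 1(5) 2(5) have "h * h * ?B (x + s *\<^sub>R ?a + t *\<^sub>R ?b) = h * h * ?A (x + t' *\<^sub>R ?b + s' *\<^sub>R ?a)"
    by (simp only:)
  with h have eq: "?B (x + s *\<^sub>R ?a + t *\<^sub>R ?b) = ?A (x + t' *\<^sub>R ?b + s' *\<^sub>R ?a)"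
    by (metis mult_cancel_left mult_eq_0_iff less_irrefl)
  have "dist (?B (x + s *\<^sub>R ?a + t *\<^sub>R ?b)) (?B x) < e" using d2(2) near[OF 1(1-4)] by simp
  moreover have "dist (?A (x + t' *\<^sub>R ?b + s' *\<^sub>R ?a)) (?A x) < e" using d1(2) near'[OF 2(3,4) 2(1,2)] by simp
  ultimately have "\<bar>?A x - ?B x\<bar> < 2 * e" using eq unfolding dist_real_def by linarith
  then show False using e unfolding e_def by simp
qed

section \<open>Integrals of compactly supported functions\<close>

lemma compact_support_bounded:
  fixes F :: "real^'n::finite \<Rightarrow> real"
  assumes "continuous_on UNIV F" "\<And>x. norm x > r \<Longrightarrow> F x = 0"
  shows "\<exists>M. \<forall>x. \<bar>F x\<bar> \<le> M"
proof -
  have "compact (F ` cball 0 r)" using assms(1)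
    by (intro compact_continuous_image continuous_on_subset[OF assms(1)]) auto
  then obtain M where M: "\<And>x. x \<in> cball 0 r \<Longrightarrow> \<bar>F x\<bar> \<le> M"
    using compact_imp_bounded bounded_iff by (metis image_eqI real_norm_def)
  have "\<bar>F x\<bar> \<le> max M 0" for x
    using M[of x] assms(2)[of x] by (cases "norm x > r") auto
  then show ?thesis by blast
qed

lemma compact_support_integrable:
  fixes F :: "real^'n::finite \<Rightarrow> real"
  assumes "continuous_on UNIV F" "\<And>x. norm x > r \<Longrightarrow> F x = 0"
  shows "integrable lborel F"
proof -
  have "integrable lborel (\<lambda>x. indicator (cball 0 r) x *\<^sub>R F x)"
    by (rule borel_integrable_compact) (auto intro: continuous_on_subset[OF assms(1)])
  moreover have "(\<lambda>x. indicator (cball 0 r) x *\<^sub>R F x) = F"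
    using assms(2) by (auto simp: indicator_def fun_eq_iff)
  ultimately show ?thesis by simp
qed

text \<open>Functions such as \<open>pd i u\<close> carry an unspecified value at the origin; a
  single point does not affect Borel measurability.\<close>

lemma borel_measurable_continuous_punctured:
  fixes k :: "real^'n::finite \<Rightarrow> real"
  assumes "continuous_on (UNIV - {0}) k"
  shows "k \<in> borel_measurable borel"
proof -
  have "(\<lambda>y. indicator (UNIV - {0}) y *\<^sub>R k y) \<in> borel_measurable borel"
    using assms by (intro borel_measurable_continuous_on_indicator) auto
  then have "(\<lambda>y. indicator (UNIV - {0}) y *\<^sub>R k y + indicator {0} y *\<^sub>R k 0) \<in> borel_measurable borel" by measurable
  also have "(\<lambda>y. indicator (UNIV - {0}) y *\<^sub>R k y + indicator {0} y *\<^sub>R k 0) = k"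
    by (auto simp: fun_eq_iff indicator_def)
  finally show ?thesis .
qed

lemma cball_borel [measurable]: "cball (x :: real^'n::finite) r \<in> sets borel" by simp

lemma partial_deriv_zero_outside:
  assumes "\<And>x. norm x > r \<Longrightarrow> F x = 0" "norm x > r"
  shows "pd i F x = 0"
proof -
  have "open {x :: real^'a. norm x > r}" by (intro open_Collect_less continuous_intros)
  then have "pd i F x = pd i (\<lambda>_. 0) x"
    by (rule partial_deriv_transform_open) (use assms in auto)
  then show ?thesis by simp
qed

lemma integral_translation:
  fixes F :: "real^'n::finite \<Rightarrow> real"
  assumes "F \<in> borel_measurable borel"
  shows "(LINT x|lborel. F (c + x)) = (LINT x|lborel. F x)"
proof -
  have "(LINT x|lborel. F x) = (LINT x|distr lborel borel ((+) c). F x)"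
    by (simp add: lborel_distr_plus)
  also have "\<dots> = (LINT x|lborel. F (c + x))"
    by (rule integral_distr) (use assms in auto)
  finally show ?thesis by simp
qed

text \<open>The difference quotients of F along axis i have integral 0 by translation invariance. By
  the mean value theorem they are bounded by the supremum of the derivative on a fixed ball, so
  dominated convergence passes to the limit.\<close>

lemma integral_partial_deriv_eq_0:
  fixes F :: "real^'n::finite \<Rightarrow> real"
  assumes C1: "C1_on UNIV F" and supp: "\<And>x. norm x > r \<Longrightarrow> F x = 0"
  shows "(LINT x|lborel. pd i F x) = 0"
proof -
  let ?a = "axis i 1 :: real^'n"
  define D where "D n x = (F (inverse (real (Suc n)) *\<^sub>R ?a + x) - F x) * real (Suc n)" for n x
  have cF: "continuous_on UNIV F" by (rule C1_on_continuous[OF C1])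
  have cD: "continuous_on UNIV (pd i F)" using C1 unfolding C1_on_def by blast
  have dF: "F differentiable (at x)" for x using C1 unfolding C1_on_def by blast
  have mF: "F \<in> borel_measurable borel" using cF by (rule borel_measurable_continuous_onI)
  have mF': "pd i F \<in> borel_measurable borel" using cD by (rule borel_measurable_continuous_onI)
  obtain M where M: "\<And>x. \<bar>pd i F x\<bar> \<le> M"
    using compact_support_bounded[OF cD, of r] partial_deriv_zero_outside[of r F, OF supp] by blast
  have intF: "integrable lborel F" by (rule compact_support_integrable[OF cF supp])
  have intF': "integrable lborel (\<lambda>x. F (c + x))" for c
  proof (rule compact_support_integrable)
    show "continuous_on UNIV (\<lambda>x. F (c + x))"
      by (rule continuous_on_compose2[OF cF]) (auto intro!: continuous_intros)
    show "F (c + x) = 0" if "norm x > r + norm c" for x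
      by (rule supp) (use that norm_triangle_ineq2[of x "- c"] in \<open>simp add: add.commute\<close>)
  qed
  have D0: "(LINT x|lborel. D n x) = 0" for n
    unfolding D_def by (simp add: intF intF' integral_translation[OF mF])
  have lim: "(\<lambda>n. D n x) \<longlonglongrightarrow> pd i F x" for x
  proof -
    have "((\<lambda>s. F (x + s *\<^sub>R ?a)) has_real_derivative pd i F (x + 0 *\<^sub>R ?a)) (at 0)"
      by (rule partial_deriv_along_axis) (use dF in auto)
    then have "((\<lambda>h. (F (x + h *\<^sub>R ?a) - F x) / h) \<longlongrightarrow> pd i F x) (at 0)"
      unfolding DERIV_def by simp
    then have "(\<lambda>n. (F (x + inverse (real (Suc n)) *\<^sub>R ?a) - F x) / inverse (real (Suc n))) \<longlonglongrightarrow> pd i F x"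
      by (rule filterlim_compose)
         (auto simp: filterlim_at simp del: of_nat_Suc intro: LIMSEQ_inverse_real_of_nat)
    then show ?thesis unfolding D_def by (simp add: add.commute field_simps del: of_nat_Suc)
  qed
  \<comment> \<open>The step is at most 1, so enlarging the radius of the support by 1 captures all
    quotients.\<close>
  have bd: "\<bar>D n x\<bar> \<le> M * indicator (cball 0 (\<bar>r\<bar> + 1)) x" for n x
  proof -
    let ?h = "inverse (real (Suc n))"
    have h: "?h > 0" "?h \<le> 1" by (auto simp: field_simps)
    have "\<exists>s>0. s < ?h \<and> F (x + ?h *\<^sub>R ?a) - F (x + 0 *\<^sub>R ?a) = (?h - 0) * pd i F (x + s *\<^sub>R ?a)"
      by (rule MVT2[OF h(1)]) (intro partial_deriv_along_axis dF)
    then obtain s where s: "s > 0" "s < ?h" and "F (x + ?h *\<^sub>R ?a) - F x = ?h * pd i F (x + s *\<^sub>R ?a)"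
      by auto
    then have eq: "D n x = pd i F (x + s *\<^sub>R ?a)"
      unfolding D_def by (simp add: add.commute del: of_nat_Suc)
    show ?thesis
    proof (cases "x \<in> cball 0 (\<bar>r\<bar> + 1)")
      case True then show ?thesis using eq M by simp
    next
      case False
      have "norm (s *\<^sub>R ?a) \<le> 1" using s h by (simp add: norm_axis_1)
      then have "norm (x + s *\<^sub>R ?a) > r" using False norm_diff_ineq[of x "s *\<^sub>R ?a"] by auto
      then show ?thesis using partial_deriv_zero_outside[OF supp] eq False by simp
    qed
  qed
  have "(\<lambda>n. LINT x|lborel. D n x) \<longlonglongrightarrow> (LINT x|lborel. pd i F x)"
  proof (rule integral_dominated_convergence)
    show "integrable lborel (\<lambda>x::real^'n. M * indicator (cball 0 (\<bar>r\<bar> + 1)) x)"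
      by (intro integrable_mult_right integrable_real_indicator)
         (auto simp: emeasure_bounded_finite[OF bounded_cball, unfolded infinity_ennreal_def])
    show "AE x in lborel. (\<lambda>n. D n x) \<longlonglongrightarrow> pd i F x" using lim by simp
    show "AE x in lborel. norm (D n x) \<le> M * indicator (cball 0 (\<bar>r\<bar> + 1)) x" for n using bd by simp
    show "D n \<in> borel_measurable lborel" for n unfolding D_def using mF by simp
    show "pd i F \<in> borel_measurable lborel" using mF' by simp
  qed
  then show ?thesis using D0 LIMSEQ_unique by (simp add: LIMSEQ_const_iff)
qed

subsection \<open>Averages against cut-off kernels\<close>

text \<open>Differentiation stays within this family: the gradient of \<open>bump L (Suc k)\<close>
  is a multiple of z times \<open>bump L k\<close>. This lets integrations by parts lead from one
  weight to the next without spheres or surface measure.\<close>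

definition bump :: "real \<Rightarrow> nat \<Rightarrow> real^'n::finite \<Rightarrow> real" where
  "bump L k z = max 0 (L\<^sup>2 - z \<bullet> z) ^ k"

text \<open>Away from 0 one branch of the maximum is locally active. At 0 the difference quotient is
  at most \<open>\<bar>h\<bar> ^ k\<close>, which tends to 0 because k is positive.\<close>

lemma has_real_derivative_max_power:
  assumes "k \<ge> 1"
  shows "((\<lambda>y. max 0 y ^ Suc k) has_real_derivative real (Suc k) * max 0 y ^ k) (at y)"
proof -
  consider "y > 0" | "y < 0" | "y = 0" by linarith
  then show ?thesis
  proof cases
    case 1
    have "((\<lambda>y. y ^ Suc k) has_real_derivative real (Suc k) * y ^ k) (at y)"
      using DERIV_pow[of "Suc k" y UNIV] by simp
    then have "((\<lambda>y. max 0 y ^ Suc k) has_real_derivative real (Suc k) * y ^ k) (at y)"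
      by (rule DERIV_cong_ev[THEN iffD1, rotated -1])
         (use 1 eventually_gt_at_top in \<open>auto intro!: eventually_mono[OF order_tendstoD(1)[OF tendsto_ident_at, of 0 y UNIV]] simp: eventually_nhds intro: exI[of _ "{0<..}"]\<close>)
    then show ?thesis using 1 by simp
  next
    case 2
    have "((\<lambda>y. 0) has_real_derivative 0) (at y)" by simp
    then have "((\<lambda>y. max 0 y ^ Suc k) has_real_derivative 0) (at y)"
      by (rule DERIV_cong_ev[THEN iffD1, rotated -1])
         (use 2 in \<open>auto simp: eventually_nhds intro!: exI[of _ "{..<0}"]\<close>)
    then show ?thesis using 2 assms by (simp add: max_absorb1 zero_power)
  next
    case 3
    have "((\<lambda>h. max 0 h ^ Suc k / h) \<longlongrightarrow> 0) (at (0::real))"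
    proof (rule Lim_null_comparison)
      show "\<forall>\<^sub>F h in at 0. norm (max 0 h ^ Suc k / h) \<le> \<bar>h\<bar> ^ k"
        by (rule always_eventually) (auto simp: max_def)
      have "((\<lambda>h. \<bar>h\<bar> ^ k) \<longlongrightarrow> \<bar>0\<bar> ^ k) (at (0::real))" by (intro tendsto_intros)
      then show "((\<lambda>h. \<bar>h\<bar> ^ k) \<longlongrightarrow> 0) (at (0::real))" using assms by (simp add: power_0_left)
    qed
    then show ?thesis using 3 assms unfolding DERIV_def by (simp add: zero_power)
  qed
qed

lemma differentiable_inner_self: "(\<lambda>z. z \<bullet> z) differentiable (at (x :: real^'n::finite))"
  unfolding differentiable_def by (auto intro!: derivative_eq_intros exI)

lemma partial_deriv_inner_self: "pd i (\<lambda>z. z \<bullet> z) x = 2 * x $ i"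
proof -
  have "((\<lambda>z. z \<bullet> z) has_derivative (\<lambda>h. x \<bullet> h + h \<bullet> x)) (at x)"
    by (auto intro!: derivative_eq_intros)
  from has_derivative_imp_partial_deriv[OF this] show ?thesis
    by (simp add: inner_axis inner_axis' )
qed

lemma C1_on_inner_self: "C1_on S (\<lambda>z. z \<bullet> z)"
  unfolding C1_on_def
  by (auto simp: differentiable_inner_self partial_deriv_inner_self[abs_def] intro!: continuous_intros)

lemma bump_C1:
  assumes "k \<ge> 1"
  shows "C1_on S (bump L (Suc k))"
    and "pd i (bump L (Suc k)) z = - (2 * real (Suc k)) * (z $ i * bump L k z)"
proof -
  have C1: "C1_on S (\<lambda>z. L\<^sup>2 - z \<bullet> z)" for S :: "(real^'n) set"
    by (intro C1_on_diff C1_on_const C1_on_inner_self)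
  have "continuous_on UNIV (\<lambda>y. real (Suc k) * max 0 y ^ k)" by (intro continuous_intros)
  from C1_on_chain_real[OF C1 UNIV_I has_real_derivative_max_power[OF assms] this]
  show "C1_on S (bump L (Suc k))" by (simp add: bump_def[abs_def])
  have "(\<lambda>z. L\<^sup>2 - z \<bullet> z) differentiable (at z)" using C1[of UNIV] unfolding C1_on_def by blast
  from differentiable_chain_real(2)[OF this has_real_derivative_max_power[OF assms]]
  have "pd i (bump L (Suc k)) z =
    real (Suc k) * bump L k z * pd i (\<lambda>z. L\<^sup>2 - z \<bullet> z) z"
    by (simp add: bump_def[abs_def])
  also have "pd i (\<lambda>z. L\<^sup>2 - z \<bullet> z) z = - 2 * z $ i"
    by (subst partial_deriv_diff) (simp_all add: differentiable_inner_self partial_deriv_inner_self)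
  finally show "pd i (bump L (Suc k)) z = - (2 * real (Suc k)) * (z $ i * bump L k z)"
    by (simp add: algebra_simps)
qed

lemma bump_zero_outside:
  assumes "L > 0" "k \<ge> 1" "norm z > L"
  shows "bump L k z = 0"
proof -
  have "L\<^sup>2 < z \<bullet> z" using assms by (simp add: power2_norm_eq_inner[symmetric] power_strict_mono)
  then show ?thesis using assms by (simp add: bump_def max_def)
qed

lemma bump_nonneg: "bump L k z \<ge> 0" by (simp add: bump_def)

lemma bump_le: "bump L k z \<le> L ^ (2 * k)"
  unfolding bump_def power_mult by (rule power_mono) auto

lemma continuous_on_bump: "continuous_on S (bump L k)"
  unfolding bump_def by (intro continuous_intros)

section \<open>Shifted and dilated functions integrated against a cut-off\<close>

lemma C1_on_affine:
  assumes g: "C1_on T g" and sub: "\<And>z. z \<in> S \<Longrightarrow> x + t *\<^sub>R z \<in> T"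
  shows "C1_on S (\<lambda>z. g (x + t *\<^sub>R z))"
    and "z \<in> S \<Longrightarrow> pd i (\<lambda>z. g (x + t *\<^sub>R z)) z = t * pd i g (x + t *\<^sub>R z)"
proof -
  have D: "((\<lambda>z. g (x + t *\<^sub>R z)) has_derivative
      (\<lambda>h. \<Sum>j\<in>UNIV. (t *\<^sub>R h) $ j * pd j g (x + t *\<^sub>R z))) (at z)" if "z \<in> S" for z
  proof -
    have d: "((\<lambda>z. x + t *\<^sub>R z) has_derivative (\<lambda>h. t *\<^sub>R h)) (at z)"
      by (auto intro!: derivative_eq_intros)
    have "g differentiable (at (x + t *\<^sub>R z))" using g sub[OF that] unfolding C1_on_def by blast
    from has_derivative_compose[OF d has_derivative_partial_deriv[OF this]] show ?thesis by simp
  qed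
  have P: "pd i (\<lambda>z. g (x + t *\<^sub>R z)) z = t * pd i g (x + t *\<^sub>R z)"
    if "z \<in> S" for z i
  proof -
    have "pd i (\<lambda>z. g (x + t *\<^sub>R z)) z
        = (\<Sum>j\<in>UNIV. if j = i then t * pd j g (x + t *\<^sub>R z) else 0)"
      unfolding has_derivative_imp_partial_deriv[OF D[OF that]]
      by (rule sum.cong) (auto simp: axis_def)
    then show ?thesis by simp
  qed
  then show "z \<in> S \<Longrightarrow> pd i (\<lambda>z. g (x + t *\<^sub>R z)) z = t * pd i g (x + t *\<^sub>R z)" .
  show "C1_on S (\<lambda>z. g (x + t *\<^sub>R z))"
    unfolding C1_on_def
  proof (intro conjI ballI allI)
    show "(\<lambda>z. g (x + t *\<^sub>R z)) differentiable at z" if "z \<in> S" for z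
      using D[OF that] unfolding differentiable_def by blast
    fix i
    have "continuous_on T (pd i g)" using g unfolding C1_on_def by blast
    then have "continuous_on S (\<lambda>z. pd i g (x + t *\<^sub>R z))"
      by (rule continuous_on_compose2) (use sub in \<open>auto intro!: continuous_intros\<close>)
    then have "continuous_on S (\<lambda>z. t * pd i g (x + t *\<^sub>R z))"
      by (intro continuous_intros)
    then show "continuous_on S (pd i (\<lambda>z. g (x + t *\<^sub>R z)))"
      by (rule continuous_on_eq) (simp add: P)
  qed
qed

lemma shift_nonzero:
  fixes x z :: "'a::real_normed_vector"
  assumes "\<bar>t\<bar> * L < norm x" "norm z \<le> L"
  shows "x + t *\<^sub>R z \<noteq> 0"
proof
  assume "x + t *\<^sub>R z = 0"
  then have "x = - (t *\<^sub>R z)" by (simp add: eq_neg_iff_add_eq_0)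
  then have "norm x = \<bar>t\<bar> * norm z" by simp
  then show False using assms mult_left_mono[OF assms(2), of "\<bar>t\<bar>"] by simp
qed

text \<open>Two open sets cover the space: where \<open>\<bar>t\<bar> * norm z < norm x\<close> the
  shifted point avoids the origin, and where \<open>norm z > L\<close> the cut-off vanishes. The
  condition on t is exactly what makes them cover.\<close>

lemma continuous_on_cutoff_shift:
  fixes x :: "real^'n::finite"
  assumes \<phi>: "continuous_on UNIV \<phi>" "\<And>z. norm z > L \<Longrightarrow> \<phi> z = (0::real)"
    and k: "continuous_on (UNIV - {0}) k" and t: "\<bar>t\<bar> * L < norm x"
  shows "continuous_on UNIV (\<lambda>z. \<phi> z * k (x + t *\<^sub>R z))"
proof -
  let ?S = "{z. \<bar>t\<bar> * norm z < norm x}" let ?T = "{z :: real^'n. norm z > L}"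
  have op: "open ?S" "open ?T" by (intro open_Collect_less continuous_intros)+
  have U: "?S \<union> ?T = UNIV"
  proof -
    have "\<bar>t\<bar> * norm z < norm x" if "norm z \<le> L" for z :: "real^'n"
      using mult_left_mono[OF that, of "\<bar>t\<bar>"] t by linarith
    then show ?thesis by force
  qed
  have ne: "x + t *\<^sub>R z \<noteq> 0" if "z \<in> ?S" for z
    using that by (intro shift_nonzero[of t "norm z"]) auto
  have "continuous_on ?S (\<lambda>z. \<phi> z * k (x + t *\<^sub>R z))"
    by (intro continuous_intros continuous_on_compose2[OF k] continuous_on_subset[OF \<phi>(1)])
       (use ne in auto)
  moreover have "continuous_on ?T (\<lambda>z. \<phi> z * k (x + t *\<^sub>R z))"
    by (rule continuous_on_eq[of _ "\<lambda>_. 0"]) (use \<phi>(2) in auto)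
  ultimately show ?thesis using continuous_on_open_Un[OF op] U by metis
qed

text \<open>The shifted point meets the origin only where \<phi> vanishes, so the product is C1 on
  the whole space and its partial derivative integrates to 0. The chain rule produces the factor t;
  keeping it on the left admits t = 0.\<close>

lemma integral_cutoff_by_parts:
  fixes x :: "real^'n::finite"
  assumes \<phi>: "C1_on UNIV \<phi>" "\<And>z. norm z > L \<Longrightarrow> \<phi> z = 0"
    and g: "C1_on (UNIV - {0}) g" and t: "\<bar>t\<bar> * L < norm x"
  shows "t * (LINT z|lborel. \<phi> z * pd j g (x + t *\<^sub>R z))
      = - (LINT z|lborel. pd j \<phi> z * g (x + t *\<^sub>R z))"
proof -
  define G where "G z = \<phi> z * g (x + t *\<^sub>R z)" for z
  let ?S = "{z. \<bar>t\<bar> * norm z < norm x}" let ?T = "{z :: real^'n. norm z > L}"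
  have op: "open ?S" "open ?T" by (intro open_Collect_less continuous_intros)+
  have ST: "z \<in> ?S \<or> z \<in> ?T" for z
    using mult_left_mono[of "norm z" L "\<bar>t\<bar>"] t by force
  then have U: "?S \<union> ?T = UNIV" by blast
  have ne: "x + t *\<^sub>R z \<in> UNIV - {0}" if "z \<in> ?S" for z
    using that shift_nonzero[of t "norm z" x z] by auto
  note aff = C1_on_affine[OF g ne]
  have C1S: "C1_on ?S G" unfolding G_def
    by (intro C1_on_mult C1_on_subset[OF \<phi>(1)] aff) auto
  have C1T: "C1_on ?T G"
    by (rule C1_on_cong_open[OF op(2) _ C1_on_const[of _ 0]]) (simp add: G_def \<phi>(2))
  have C1: "C1_on UNIV G" using C1_on_UnionI[OF op C1S C1T] U by simp
  have \<phi>': "pd j \<phi> z = 0" if "norm z > L" for z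
    by (rule partial_deriv_zero_outside[where r=L and F=\<phi>]) (use \<phi> that in auto)
  have eq: "pd j G z = t * (\<phi> z * pd j g (x + t *\<^sub>R z)) + pd j \<phi> z * g (x + t *\<^sub>R z)" for z
  proof (cases "z \<in> ?T")
    case True
    then have "G z = 0" "pd j G z = 0"
      using partial_deriv_zero_outside[where r=L and F=G and x=z and i=j] \<phi>(2) by (auto simp: G_def)
    then show ?thesis using True \<phi>' \<phi>(2) by simp
  next
    case False
    then have S: "z \<in> ?S" using ST by blast
    have "(\<lambda>z. g (x + t *\<^sub>R z)) differentiable (at z)" using aff(1) S unfolding C1_on_def by blast
    moreover have "\<phi> differentiable (at z)" using \<phi>(1) unfolding C1_on_def by blast
    ultimately show ?thesis unfolding G_def using aff(2)[OF _ S]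
      by (simp add: partial_deriv_mult)
  qed
  have c1: "continuous_on UNIV \<phi>" "continuous_on (UNIV - {0}) g"
    using C1_on_continuous \<phi>(1) g by blast+
  have c2: "continuous_on UNIV (pd j \<phi>)" "continuous_on (UNIV - {0}) (pd j g)"
    using \<phi>(1) g unfolding C1_on_def by blast+
  have i1: "integrable lborel (\<lambda>z. \<phi> z * pd j g (x + t *\<^sub>R z))"
    by (rule compact_support_integrable[OF continuous_on_cutoff_shift[OF c1(1) \<phi>(2) c2(2) t], where r=L])
       (simp_all add: \<phi>(2))
  have i2: "integrable lborel (\<lambda>z. pd j \<phi> z * g (x + t *\<^sub>R z))"
    by (rule compact_support_integrable[OF continuous_on_cutoff_shift[OF c2(1) \<phi>' c1(2) t], where r=L])
       (simp_all add: \<phi>')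
  have "0 = (LINT z|lborel. pd j G z)"
    by (rule integral_partial_deriv_eq_0[OF C1, symmetric, of L]) (simp add: G_def \<phi>(2))
  also have "\<dots> = t * (LINT z|lborel. \<phi> z * pd j g (x + t *\<^sub>R z))
     + (LINT z|lborel. pd j \<phi> z * g (x + t *\<^sub>R z))"
    unfolding eq using i1 i2 by simp
  finally show ?thesis by simp
qed

text \<open>An integral over a box is the form to which continuity in a parameter and
  differentiation under the integral sign are applied below.\<close>

lemma integral_over_cbox:
  fixes F :: "real^'n::finite \<Rightarrow> real"
  assumes "continuous_on UNIV F" "\<And>z. norm z > L \<Longrightarrow> F z = 0"
  shows "(LINT z|lborel. F z) = integral (cbox (vec (- L)) (vec L)) F"
proof -
  let ?S = "cbox (vec (- L)) (vec L) :: (real^'n) set"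
  have "F z = 0" if "z \<notin> ?S" for z
  proof -
    have "\<not> (\<forall>i. \<bar>z $ i\<bar> \<le> L)" using that by (auto simp: mem_box_cart abs_le_iff minus_le_iff)
    then obtain i where "\<bar>z $ i\<bar> > L" by (auto simp: not_le)
    then have "norm z > L" using component_le_norm_cart[of z i] by linarith
    then show ?thesis by (rule assms(2))
  qed
  then have eq: "(\<lambda>z. indicator ?S z *\<^sub>R F z) = F" by (auto simp: fun_eq_iff indicator_def)
  have "set_integrable lborel ?S F" unfolding set_integrable_def eq
    by (rule compact_support_integrable[OF assms])
  from set_borel_integral_eq_integral(2)[OF this] show ?thesis
    unfolding set_lebesgue_integral_def eq .
qed

text \<open>The box sticks out of the ball of radius L; the l1 bound keeps its points within L times
  the dimension. This is the origin of the factor \<open>CARD('n)\<close> in the smallness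
  conditions on t and \<rho>.\<close>

lemma cbox_shift_nonzero:
  fixes x :: "real^'n::finite" and t L :: real
  assumes "\<bar>t\<bar> * (L * CARD('n)) < norm x" "z \<in> cbox (vec (- L)) (vec L)"
  shows "x + t *\<^sub>R z \<noteq> 0"
proof (rule shift_nonzero[OF assms(1)])
  have "norm z \<le> (\<Sum>i\<in>UNIV. \<bar>z $ i\<bar>)" by (rule norm_le_l1_cart)
  also have "\<dots> \<le> (\<Sum>i\<in>(UNIV::'n set). L)"
    by (rule sum_mono) (use assms(2) in \<open>auto simp: mem_box_cart abs_le_iff minus_le_iff\<close>)
  finally show "norm z \<le> L * CARD('n)" by (simp add: mult.commute)
qed

lemma norm_bound_of_card_bound:
  fixes x :: "real^'n::finite" and t L :: real
  assumes "\<bar>t\<bar> * (L * CARD('n)) < norm x" "L > 0"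
  shows "\<bar>t\<bar> * L < norm x"
proof -
  have "\<bar>t\<bar> * (L * 1) \<le> \<bar>t\<bar> * (L * CARD('n))"
    using assms(2) by (intro mult_left_mono) (auto simp: Suc_le_eq)
  then show ?thesis using assms(1) by simp
qed

lemma card_bound_mono:
  fixes x :: "real^'n::finite" and t L \<rho> :: real
  assumes "L > 0" "\<rho> * (L * CARD('n)) < norm x" "0 \<le> t" "t \<le> \<rho>"
  shows "\<bar>t\<bar> * (L * CARD('n)) < norm x"
proof -
  have "t * (L * CARD('n)) \<le> \<rho> * (L * CARD('n))" using assms by (intro mult_right_mono) auto
  with assms(2) have "t * (L * CARD('n)) < norm x" by linarith
  then show ?thesis using assms(3) by simp
qed

lemma continuous_on_cutoff_average:
  fixes x :: "real^'n::finite"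
  assumes \<phi>: "continuous_on UNIV \<phi>" "\<And>z. norm z > L \<Longrightarrow> \<phi> z = (0::real)"
    and k: "continuous_on (UNIV - {0}) k" and L: "L > 0"
  shows "continuous_on {t. \<bar>t\<bar> * (L * CARD('n)) < norm x} (\<lambda>t. LINT z|lborel. \<phi> z * k (x + t *\<^sub>R z))"
proof -
  let ?U = "{t. \<bar>t\<bar> * (L * CARD('n)) < norm x}"
  let ?S = "cbox (vec (- L)) (vec L) :: (real^'n) set"
  have sub: "(\<lambda>p. x + fst p *\<^sub>R snd p) ` (?U \<times> ?S) \<subseteq> UNIV - {0}"
  proof (rule image_subsetI)
    fix p assume "p \<in> ?U \<times> ?S"
    then have "\<bar>fst p\<bar> * (L * CARD('n)) < norm x" "snd p \<in> ?S" by auto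
    then show "x + fst p *\<^sub>R snd p \<in> UNIV - {0}" using cbox_shift_nonzero by blast
  qed
  have "continuous_on (?U \<times> ?S) (\<lambda>(t, z). \<phi> z * k (x + t *\<^sub>R z))"
    unfolding case_prod_beta
    by (intro continuous_intros continuous_on_compose2[OF k] continuous_on_compose2[OF \<phi>(1)])
       (use sub in simp_all)
  then have "continuous_on ?U (\<lambda>t. integral ?S (\<lambda>z. \<phi> z * k (x + t *\<^sub>R z)))"
    by (rule integral_continuous_on_param)
  moreover have "integral ?S (\<lambda>z. \<phi> z * k (x + t *\<^sub>R z)) = (LINT z|lborel. \<phi> z * k (x + t *\<^sub>R z))"
    if "t \<in> ?U" for t
  proof -
    have t: "\<bar>t\<bar> * L < norm x" using that norm_bound_of_card_bound[OF _ L] by simp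
    have zero: "\<phi> z * k (x + t *\<^sub>R z) = 0" if "norm z > L" for z
      unfolding \<phi>(2)[OF that] by (rule mult_zero_left)
    show ?thesis
      by (rule integral_over_cbox[where L=L, symmetric, OF continuous_on_cutoff_shift[OF \<phi> k t] zero])
  qed
  ultimately show ?thesis by (rule continuous_on_eq)
qed

lemma deriv_cutoff_average:
  fixes x :: "real^'n::finite"
  assumes \<phi>: "continuous_on UNIV \<phi>" "\<And>z. norm z > L \<Longrightarrow> \<phi> z = (0::real)"
    and g: "C1_on (UNIV - {0}) g" and L: "L > 0" and t: "\<bar>t\<bar> * (L * CARD('n)) < norm x"
  shows "((\<lambda>t. LINT z|lborel. \<phi> z * g (x + t *\<^sub>R z)) has_real_derivative
     (\<Sum>j\<in>UNIV. LINT z|lborel. (\<phi> z * z $ j) * pd j g (x + t *\<^sub>R z))) (at t)"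
proof -
  let ?c = "L * CARD('n)"
  have c: "?c > 0" using L by simp
  \<comment> \<open>The admissible t form the open interval U of half-length r. Convexity is what
    the Leibniz rule asks for, and openness turns the derivative within U into the derivative at
    t.\<close>
  define r where "r = norm x / ?c"
  define U where "U = {- r<..<r}"
  have U: "s \<in> U \<longleftrightarrow> \<bar>s\<bar> * ?c < norm x" for s
  proof -
    have "s \<in> U \<longleftrightarrow> \<bar>s\<bar> < r" by (auto simp: U_def abs_less_iff)
    also have "\<dots> \<longleftrightarrow> \<bar>s\<bar> * ?c < norm x" using c by (simp add: r_def pos_less_divide_eq)
    finally show ?thesis .
  qed
  have tU: "t \<in> U" using U t by blast
  have oU: "open U" unfolding U_def by simp
  let ?S = "cbox (vec (- L)) (vec L) :: (real^'n) set"
  have cp: "continuous_on (UNIV - {0}) (pd j g)" for j using g unfolding C1_on_def by blast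
  have cont1: "continuous_on UNIV (\<lambda>z. \<phi> z * g (x + s *\<^sub>R z))" if "s \<in> U" for s
    by (rule continuous_on_cutoff_shift[OF \<phi> C1_on_continuous[OF g] norm_bound_of_card_bound])
       (use that U L in auto)
  have cont2: "continuous_on UNIV (\<lambda>z. (\<phi> z * z $ j) * pd j g (x + t *\<^sub>R z))" for j
  proof (rule continuous_on_cutoff_shift[OF _ _ cp norm_bound_of_card_bound[OF t L]])
    show "continuous_on UNIV (\<lambda>z. \<phi> z * z $ j)" by (intro continuous_intros \<phi>(1))
  qed (simp add: \<phi>(2))
  have sub: "(\<lambda>p. x + fst p *\<^sub>R snd p) ` (U \<times> ?S) \<subseteq> UNIV - {0}"
  proof (rule image_subsetI)
    fix p assume "p \<in> U \<times> ?S"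
    then have "\<bar>fst p\<bar> * (L * CARD('n)) < norm x" "snd p \<in> ?S"
      using U[of "fst p"] unfolding mem_Times_iff by blast+
    then show "x + fst p *\<^sub>R snd p \<in> UNIV - {0}" using cbox_shift_nonzero by blast
  qed
  have "((\<lambda>t. integral ?S (\<lambda>z. \<phi> z * g (x + t *\<^sub>R z))) has_real_derivative
     integral ?S (\<lambda>z. \<phi> z * (\<Sum>j\<in>UNIV. z $ j * pd j g (x + t *\<^sub>R z)))) (at t within U)"
  proof (rule leibniz_rule_field_derivative)
    fix s z assume s: "s \<in> U" "z \<in> ?S"
    have "g differentiable (at (x + s *\<^sub>R z))"
      using g cbox_shift_nonzero[of s L x z] s U unfolding C1_on_def by blast
    from DERIV_cmult[OF partial_deriv_along_ray[OF this], of "\<phi> z"]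
    show "((\<lambda>s. \<phi> z * g (x + s *\<^sub>R z)) has_real_derivative \<phi> z * (\<Sum>j\<in>UNIV. z $ j * pd j g (x + s *\<^sub>R z))) (at s within U)"
      by (rule DERIV_subset) simp
  next
    fix s assume s: "s \<in> U"
    show "(\<lambda>z. \<phi> z * g (x + s *\<^sub>R z)) integrable_on ?S"
      by (rule integrable_continuous[OF continuous_on_subset[OF cont1[OF s]]]) simp
  next
    show "continuous_on (U \<times> ?S) (\<lambda>(t, z). \<phi> z * (\<Sum>j\<in>UNIV. z $ j * pd j g (x + t *\<^sub>R z)))"
      unfolding case_prod_beta
      by (intro continuous_intros continuous_on_compose2[OF cp] continuous_on_compose2[OF \<phi>(1)])
         (use sub in simp_all)
  next
    show "t \<in> U" using t U by blast
    show "convex U" unfolding U_def by simp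
  qed
  moreover have "integral ?S (\<lambda>z. \<phi> z * (\<Sum>j\<in>UNIV. z $ j * pd j g (x + t *\<^sub>R z)))
     = (\<Sum>j\<in>UNIV. LINT z|lborel. (\<phi> z * z $ j) * pd j g (x + t *\<^sub>R z))"
  proof -
    have "integral ?S (\<lambda>z. \<phi> z * (\<Sum>j\<in>UNIV. z $ j * pd j g (x + t *\<^sub>R z)))
      = (\<Sum>j\<in>UNIV. integral ?S (\<lambda>z. (\<phi> z * z $ j) * pd j g (x + t *\<^sub>R z)))"
      unfolding sum_distrib_left mult.assoc[symmetric]
      by (rule integral_sum) (simp_all add: integrable_continuous continuous_on_subset[OF cont2])
    also have "\<dots> = (\<Sum>j\<in>UNIV. LINT z|lborel. (\<phi> z * z $ j) * pd j g (x + t *\<^sub>R z))"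
      by (intro sum.cong refl integral_over_cbox[where L=L, symmetric] cont2) (simp add: \<phi>(2))
    finally show ?thesis .
  qed
  ultimately have "((\<lambda>t. integral ?S (\<lambda>z. \<phi> z * g (x + t *\<^sub>R z))) has_real_derivative
     (\<Sum>j\<in>UNIV. LINT z|lborel. (\<phi> z * z $ j) * pd j g (x + t *\<^sub>R z))) (at t)"
    using at_within_open[OF tU oU] by (simp only:)
  then show ?thesis
  proof (rule DERIV_cong_ev[THEN iffD1, OF refl _ refl, rotated])
    have "integral ?S (\<lambda>z. \<phi> z * g (x + s *\<^sub>R z)) = (LINT z|lborel. \<phi> z * g (x + s *\<^sub>R z))" if "s \<in> U" for s
      by (rule integral_over_cbox[OF cont1[OF that], where L=L, symmetric]) (simp add: \<phi>(2))
    then show "\<forall>\<^sub>F t in nhds t. integral ?S (\<lambda>z. \<phi> z * g (x + t *\<^sub>R z)) = (LINT z|lborel. \<phi> z * g (x + t *\<^sub>R z))"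
      unfolding eventually_nhds using oU tU by blast
  qed
qed

section \<open>Kernel identities for averages of a function and of its gradient\<close>

lemma bump_outside: "norm z > L \<Longrightarrow> L > 0 \<Longrightarrow> bump L (Suc k) z = 0"
  by (rule bump_zero_outside) auto

lemma partial_deriv_bump_outside:
  fixes z :: "real^'n::finite"
  assumes "norm z > L" "L > 0"
  shows "pd j (bump L (Suc k)) z = 0"
  by (rule partial_deriv_zero_outside[where r=L]) (use assms bump_outside in auto)

lemma partial_deriv_bump_4:
  "pd j (bump L 4) z = - (8 * bump L 3 z * z $ j)"
  using bump_C1(2)[of 3 j L z] by (simp add: numeral_eq_Suc)

lemma partial_deriv_bump_3:
  "pd j (bump L 3) z = - (6 * bump L 2 z * z $ j)"
  using bump_C1(2)[of 2 j L z] by (simp add: numeral_eq_Suc)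

lemma C1_on_bump_4: "C1_on S (bump L 4)" using bump_C1(1)[of 3 S L] by (simp add: numeral_eq_Suc)
lemma C1_on_bump_3: "C1_on S (bump L 3)" using bump_C1(1)[of 2 S L] by (simp add: numeral_eq_Suc)

lemma C1_on_partial_bump_4: "C1_on S (pd j (bump L 4))"
proof -
  have "pd j (bump L 4) = (\<lambda>z. (-8) * (bump L 3 z * z $ j))"
    by (simp add: fun_eq_iff partial_deriv_bump_4)
  moreover have "C1_on S (\<lambda>z. (-8) * (bump L 3 z * z $ j))"
    by (intro C1_on_cmult C1_on_mult C1_on_bump_3 C1_on_component)
  ultimately show ?thesis by (simp only:)
qed

lemma C2_on_bump_4: "C2_on S (bump L 4)"
  unfolding C2_on_def using C1_on_bump_4 C1_on_partial_bump_4 by blast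

lemma continuous_on_laplacian: "C2_on S u \<Longrightarrow> continuous_on S (laplacian u)"
  unfolding laplacian_def C2_on_def C1_on_def by (auto intro!: continuous_intros)

lemma integrable_cutoff_shift:
  fixes x :: "real^'n::finite"
  assumes \<phi>: "continuous_on UNIV \<phi>" "\<And>z. norm z > L \<Longrightarrow> \<phi> z = (0::real)"
    and k: "continuous_on (UNIV - {0}) k" and t: "\<bar>t\<bar> * L < norm x"
  shows "integrable lborel (\<lambda>z. \<phi> z * k (x + t *\<^sub>R z))"
proof (rule compact_support_integrable[OF continuous_on_cutoff_shift[OF \<phi> k t], where r=L])
  show "\<phi> z * k (x + t *\<^sub>R z) = 0" if "norm z > L" for z unfolding \<phi>(2)[OF that] by (rule mult_zero_left)
qed

text \<open>The weight \<open>8 * bump L 3 z * z $ j\<close> is \<open>- pd j (bump L 4) z\<close>,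
  so one integration by parts per coordinate moves the derivative back onto \<open>pd j u\<close>
  and brings a factor t.\<close>

lemma integral_gradient_bump:
  fixes x :: "real^'n::finite"
  assumes u: "C2_on (UNIV - {0}) u" and L: "L > 0" and t: "\<bar>t\<bar> * L < norm x"
  shows "(\<Sum>j\<in>UNIV. LINT z|lborel. (8 * bump L 3 z * z $ j) * pd j u (x + t *\<^sub>R z))
     = t * (LINT z|lborel. bump L 4 z * laplacian u (x + t *\<^sub>R z))"
proof -
  have out: "norm z > L \<Longrightarrow> bump L 4 z = 0" for z :: "real^'n"
    using bump_outside[of L z 3] L by (simp add: numeral_eq_Suc)
  have C1: "C1_on (UNIV - {0}) (pd j u)" for j using u unfolding C2_on_def by blast
  have cc: "continuous_on (UNIV - {0}) (pd j (pd j u))" for j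
    using C1[of j] unfolding C1_on_def by blast
  have "(LINT z|lborel. (8 * bump L 3 z * z $ j) * pd j u (x + t *\<^sub>R z))
     = t * (LINT z|lborel. bump L 4 z * pd j (pd j u) (x + t *\<^sub>R z))" for j
    using integral_cutoff_by_parts[OF C1_on_bump_4 out C1 t, of j j] by (simp add: partial_deriv_bump_4)
  then have "(\<Sum>j\<in>UNIV. LINT z|lborel. (8 * bump L 3 z * z $ j) * pd j u (x + t *\<^sub>R z))
     = t * (\<Sum>j\<in>UNIV. LINT z|lborel. bump L 4 z * pd j (pd j u) (x + t *\<^sub>R z))"
    by (simp add: sum_distrib_left)
  also have "(\<Sum>j\<in>UNIV. LINT z|lborel. bump L 4 z * pd j (pd j u) (x + t *\<^sub>R z))
     = (LINT z|lborel. (\<Sum>j\<in>UNIV. bump L 4 z * pd j (pd j u) (x + t *\<^sub>R z)))"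
    by (rule Bochner_Integration.integral_sum[symmetric])
       (rule integrable_cutoff_shift[OF continuous_on_bump out cc t])
  finally show ?thesis by (simp add: laplacian_def sum_distrib_left)
qed

text \<open>Integrating by parts in direction i and back in direction j moves the index i from u to
  the weight: each term becomes an integral of \<open>pd i (bump L 4)\<close> against a pure second
  derivative, and these add up to the Laplacian. The two factors t cancel, which requires t to be
  nonzero.\<close>

lemma integral_hessian_bump:
  fixes x :: "real^'n::finite"
  assumes u: "C2_on (UNIV - {0}) u" and L: "L > 0" and t: "\<bar>t\<bar> * L < norm x" "t \<noteq> 0"
  shows "(\<Sum>j\<in>UNIV. LINT z|lborel. (8 * bump L 3 z * z $ j) * pd j (pd i u) (x + t *\<^sub>R z))
     = - (LINT z|lborel. pd i (bump L 4) z * laplacian u (x + t *\<^sub>R z))"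
proof -
  have out: "norm z > L \<Longrightarrow> pd j (bump L 4) z = 0" for j and z :: "real^'n"
    using partial_deriv_bump_outside[of L z j 3] L by (simp add: numeral_eq_Suc)
  have C1: "C1_on (UNIV - {0}) (pd j u)" for j using u unfolding C2_on_def by blast
  have cc: "continuous_on (UNIV - {0}) (pd i (pd j u))" for i j
    using C1[of j] unfolding C1_on_def by blast
  have cB: "continuous_on UNIV (pd j (bump L 4) :: real^'n \<Rightarrow> real)" for j
    using C1_on_bump_4 unfolding C1_on_def by blast
  note ne = shift_nonzero[OF t(1)]
  have step: "(LINT z|lborel. (8 * bump L 3 z * z $ j) * pd j (pd i u) (x + t *\<^sub>R z))
     = - (LINT z|lborel. pd i (bump L 4) z * pd j (pd j u) (x + t *\<^sub>R z))" (is "?l = - ?r") for j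
  proof -
    have swap: "pd i (pd j (bump L 4)) = pd j (pd i (bump L 4 :: real^'n \<Rightarrow> real))"
      by (rule ext, rule partial_deriv_commute[OF C2_on_bump_4[of UNIV L]]) auto
    have "?l = (LINT z|lborel. - (pd j (bump L 4) z * pd i (pd j u) (x + t *\<^sub>R z)))"
    proof (rule Bochner_Integration.integral_cong[OF refl])
      fix z :: "real^'n"
      show "(8 * bump L 3 z * z $ j) * pd j (pd i u) (x + t *\<^sub>R z)
         = - (pd j (bump L 4) z * pd i (pd j u) (x + t *\<^sub>R z))"
      proof (cases "norm z \<le> L")
        case True
        then show ?thesis using partial_deriv_commute[OF u, of "x + t *\<^sub>R z" i j] ne
          by (simp add: partial_deriv_bump_4 open_delete)
      next
        case False
        then have z: "pd j (bump L 4) z = 0" using out by simp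
        then have "8 * bump L 3 z * z $ j = 0" by (simp add: partial_deriv_bump_4)
        then show ?thesis unfolding z by simp
      qed
    qed
    also have "\<dots> = - (LINT z|lborel. pd j (bump L 4) z * pd i (pd j u) (x + t *\<^sub>R z))"
      by simp
    finally have "t * ?l = - (t * (LINT z|lborel. pd j (bump L 4) z * pd i (pd j u) (x + t *\<^sub>R z)))"
      by simp
    also have "\<dots> = (LINT z|lborel. pd i (pd j (bump L 4)) z * pd j u (x + t *\<^sub>R z))"
      using integral_cutoff_by_parts[where \<phi>="pd j (bump L 4)" and g="pd j u" and j=i,
            OF C1_on_partial_bump_4 out C1 t(1)] by simp
    also have "\<dots> = - (t * ?r)"
      unfolding swap
      using integral_cutoff_by_parts[where \<phi>="pd i (bump L 4)" and g="pd j u" and j=j,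
            OF C1_on_partial_bump_4 out C1 t(1)] by simp
    finally have "t * ?l = t * (- ?r)" by simp
    then show ?thesis using t(2) by (simp only: mult_cancel_left) simp
  qed
  have "(\<Sum>j\<in>UNIV. LINT z|lborel. (8 * bump L 3 z * z $ j) * pd j (pd i u) (x + t *\<^sub>R z))
     = - (\<Sum>j\<in>UNIV. LINT z|lborel. pd i (bump L 4) z * pd j (pd j u) (x + t *\<^sub>R z))"
    by (simp only: step sum_negf)
  also have "(\<Sum>j\<in>UNIV. LINT z|lborel. pd i (bump L 4) z * pd j (pd j u) (x + t *\<^sub>R z))
     = (LINT z|lborel. (\<Sum>j\<in>UNIV. pd i (bump L 4) z * pd j (pd j u) (x + t *\<^sub>R z)))"
    by (rule Bochner_Integration.integral_sum[symmetric])
       (rule integrable_cutoff_shift[OF cB out cc t(1)])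
  finally show ?thesis by (simp add: laplacian_def sum_distrib_left)
qed

text \<open>The total mass of the kernel \<open>8 * bump L 3\<close>, that is, the factor in front
  of the value at x when an average shrinks to scale 0. The type argument only fixes the
  dimension.\<close>

definition bump_mass :: "'n::finite itself \<Rightarrow> real \<Rightarrow> real" where
  "bump_mass _ L = (LINT z|lborel. 8 * bump L 3 (z :: real^'n))"

lemma bump_mass_pos:
  assumes "L > 0"
  shows "bump_mass TYPE('n::finite) L > 0"
proof -
  have int: "integrable lborel (\<lambda>z. 8 * bump L 3 (z :: real^'n))"
    by (rule compact_support_integrable[where r=L])
       (use bump_zero_outside[OF assms, of 3] in \<open>auto intro!: continuous_intros continuous_on_bump\<close>)
  \<comment> \<open>On the ball of half the radius, L^2 minus the squared norm is at least 3/4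
    L^2.\<close>
  have "0 < 8 * (3 / 4 * L\<^sup>2) ^ 3 * measure lborel (cball (0 :: real^'n) (L / 2))"
    using assms content_cball_pos[of "L / 2" "0 :: real^'n"] by simp
  also have "\<dots> = (LINT z|lborel. 8 * (3 / 4 * L\<^sup>2) ^ 3 * indicator (cball (0 :: real^'n) (L / 2)) z)"
    by simp
  also have "\<dots> \<le> bump_mass TYPE('n) L"
    unfolding bump_mass_def
  proof (rule integral_mono[OF _ int])
    show "integrable lborel (\<lambda>z. 8 * (3 / 4 * L\<^sup>2) ^ 3 * indicator (cball (0 :: real^'n) (L / 2)) z)"
      by (intro integrable_mult_right integrable_real_indicator)
         (auto simp: emeasure_bounded_finite[OF bounded_cball, unfolded infinity_ennreal_def])
    show "8 * (3 / 4 * L\<^sup>2) ^ 3 * indicator (cball 0 (L / 2)) z \<le> 8 * bump L 3 z" for z :: "real^'n"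
    proof (cases "norm z \<le> L / 2")
      case True
      then have "(norm z)\<^sup>2 \<le> (L / 2)\<^sup>2" by (rule power_mono) simp
      then have "3 / 4 * L\<^sup>2 \<le> L\<^sup>2 - z \<bullet> z" by (simp add: power2_norm_eq_inner power_divide)
      then have "3 / 4 * L\<^sup>2 \<le> max 0 (L\<^sup>2 - z \<bullet> z)" by (simp add: le_max_iff_disj)
      then have "(3 / 4 * L\<^sup>2) ^ 3 \<le> bump L 3 z" unfolding bump_def by (rule power_mono) simp
      then show ?thesis using True by simp
    next
      case False
      then show ?thesis using bump_nonneg[of L 3 z] by simp
    qed
  qed
  finally show ?thesis .
qed

text \<open>
  Let M(t) be the integral of 8 bump L 3 z * u (x + t z) over z. Since bump L 4 has the gradient
  - 8 z bump L 3 z, integration by parts turns M'(t) into - t times the integral of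
  bump L 4 z * f (x + t z), and M(0) is a multiple of u x.
\<close>

lemma superharmonic_potential_le:
  fixes u f :: "real^'n::finite \<Rightarrow> real" and L \<rho> :: real
  assumes u: "C2_on (UNIV - {0}) u" and u0: "\<And>y. u y \<ge> 0"
    and f [measurable]: "f \<in> borel_measurable borel" and f0: "\<And>y. f y \<ge> 0"
    and eq: "\<And>y. y \<noteq> 0 \<Longrightarrow> - laplacian u y = f y"
    and L: "L > 0" and \<rho>: "\<rho> > 0" "\<rho> * (L * CARD('n)) < norm x"
  shows "(\<integral>\<^sup>*t. (ennreal t * (\<integral>\<^sup>*z. ennreal (bump L 4 z * f (x + t *\<^sub>R z)))) * indicator {0..\<rho>} t)
     \<le> ennreal (bump_mass TYPE('n) L * u x)"
proof -
  define M where "M t = (LINT z|lborel. 8 * bump L 3 z * u (x + t *\<^sub>R z))" for t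
  define I where "I t = (LINT z|lborel. bump L 4 z * f (x + t *\<^sub>R z))" for t
  have out3: "norm z > L \<Longrightarrow> 8 * bump L 3 z = 0" for z :: "real^'n"
    using bump_zero_outside[OF L, of 3 z] by simp
  have out4: "norm z > L \<Longrightarrow> bump L 4 z = 0" for z :: "real^'n"
    using bump_zero_outside[OF L, of 4 z] by simp
  have cf: "continuous_on (UNIV - {0}) f"
    by (rule continuous_on_eq[OF continuous_on_minus[OF continuous_on_laplacian[OF u]]]) (use eq in auto)
  have C1: "C1_on (UNIV - {0}) u" using u unfolding C2_on_def by blast
  note ct = card_bound_mono[OF L \<rho>(2)]
  note ne = shift_nonzero[OF norm_bound_of_card_bound[OF ct L]]
  have M': "(M has_real_derivative - (t * I t)) (at t)" if t: "0 \<le> t" "t \<le> \<rho>" for t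
  proof -
    note tL = norm_bound_of_card_bound[OF ct[OF t] L]
    have "(M has_real_derivative (\<Sum>j\<in>UNIV. LINT z|lborel. (8 * bump L 3 z * z $ j) * pd j u (x + t *\<^sub>R z))) (at t)"
      unfolding M_def
      by (rule deriv_cutoff_average[OF _ out3 C1 L ct[OF t]]) (intro continuous_intros continuous_on_bump)
    \<comment> \<open>Outside the support of the weight the shifted point may be the origin, where
      the equation says nothing; both integrands vanish there.\<close>
    moreover have "(LINT z|lborel. bump L 4 z * laplacian u (x + t *\<^sub>R z)) = (LINT z|lborel. - (bump L 4 z * f (x + t *\<^sub>R z)))"
    proof (rule Bochner_Integration.integral_cong[OF refl])
      show "bump L 4 z * laplacian u (x + t *\<^sub>R z) = - (bump L 4 z * f (x + t *\<^sub>R z))" for z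
        using eq[OF ne[OF t, of z], symmetric] out4[of z] by (cases "norm z \<le> L") auto
    qed
    ultimately show ?thesis unfolding integral_gradient_bump[OF u L tL] I_def by simp
  qed
  have I0: "I t \<ge> 0" for t unfolding I_def by (intro Bochner_Integration.integral_nonneg) (simp add: bump_nonneg f0)
  have [measurable]: "bump L 4 \<in> borel_measurable (borel :: (real^'n) measure)"
    by (rule borel_measurable_continuous_onI[OF continuous_on_bump])
  have [measurable]: "I \<in> borel_measurable borel" unfolding I_def by measurable
  have "(\<integral>\<^sup>*t. (ennreal t * (\<integral>\<^sup>*z. ennreal (bump L 4 z * f (x + t *\<^sub>R z)))) * indicator {0..\<rho>} t)
      = (\<integral>\<^sup>*t. ennreal (t * I t) * indicator {0..\<rho>} t)"
  proof (rule nn_integral_cong)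
    fix t :: real
    show "(ennreal t * (\<integral>\<^sup>*z. ennreal (bump L 4 z * f (x + t *\<^sub>R z)))) * indicator {0..\<rho>} t
      = ennreal (t * I t) * indicator {0..\<rho>} t"
    proof (cases "t \<in> {0..\<rho>}")
      case True
      then have t: "0 \<le> t" "t \<le> \<rho>" by auto
      have pos: "0 \<le> bump L 4 z * f (x + t *\<^sub>R z)" for z
        by (intro mult_nonneg_nonneg bump_nonneg f0)
      have "(\<integral>\<^sup>*z. ennreal (bump L 4 z * f (x + t *\<^sub>R z))) = ennreal (I t)"
        unfolding I_def
        by (rule nn_integral_eq_integral
              [OF integrable_cutoff_shift[OF continuous_on_bump out4 cf norm_bound_of_card_bound[OF ct[OF t] L]]])
           (assumption, rule AE_I2, rule pos)
      then show ?thesis using t I0 by (simp add: ennreal_mult)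
    next
      case False then show ?thesis by simp
    qed
  qed
  also have "\<dots> = ennreal ((- M \<rho>) - (- M 0))"
  proof (rule nn_integral_FTC_Icc[where F="\<lambda>t. - M t" and f="\<lambda>t. t * I t"])
    show "((\<lambda>t. - M t) has_real_derivative t * I t) (at t)" if "t \<in> {0..\<rho>}" for t
      using DERIV_minus[OF M'[of t]] that by simp
    show "0 \<le> t * I t" if "t \<in> {0..\<rho>}" for t using that I0 by simp
  qed (use \<rho> in auto)
  also have "\<dots> \<le> ennreal (bump_mass TYPE('n) L * u x)"
  proof (rule ennreal_leI)
    \<comment> \<open>The average left over at scale \<rho> has the good sign and is
      dropped.\<close>
    have "M \<rho> \<ge> 0" unfolding M_def by (intro Bochner_Integration.integral_nonneg) (simp add: bump_nonneg u0)
    moreover have "M 0 = bump_mass TYPE('n) L * u x" unfolding M_def bump_mass_def by simp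
    ultimately show "- M \<rho> - - M 0 \<le> bump_mass TYPE('n) L * u x" by simp
  qed
  finally show ?thesis .
qed

lemma cutoff_integral_le:
  fixes k \<phi> :: "real^'n::finite \<Rightarrow> real" and c L t :: real
  assumes \<phi>: "continuous_on UNIV \<phi>" "\<And>z. \<bar>\<phi> z\<bar> \<le> c * indicator (cball 0 L) z" and c: "c \<ge> 0"
    and k: "continuous_on (UNIV - {0}) k" "\<And>y. k y \<ge> 0" and t: "\<bar>t\<bar> * L < norm x"
  shows "ennreal \<bar>LINT z|lborel. \<phi> z * k (x + t *\<^sub>R z)\<bar>
    \<le> ennreal c * (\<integral>\<^sup>*z. ennreal (k (x + t *\<^sub>R z)) * indicator (cball 0 L) z)"
proof -
  note [measurable] = borel_measurable_continuous_punctured[OF k(1)]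
  have out: "\<phi> z = 0" if "norm z > L" for z using \<phi>(2)[of z] that by simp
  have "ennreal \<bar>LINT z|lborel. \<phi> z * k (x + t *\<^sub>R z)\<bar> \<le> (\<integral>\<^sup>*z. norm (\<phi> z * k (x + t *\<^sub>R z)))"
    using integral_norm_bound_ennreal[OF integrable_cutoff_shift[OF \<phi>(1) out k(1) t]] by simp
  also have "\<dots> \<le> (\<integral>\<^sup>*z. ennreal c * (ennreal (k (x + t *\<^sub>R z)) * indicator (cball 0 L) z))"
  proof (rule nn_integral_mono)
    fix z :: "real^'n"
    have "norm (\<phi> z * k (x + t *\<^sub>R z)) \<le> c * indicator (cball 0 L) z * k (x + t *\<^sub>R z)"
      unfolding real_norm_def abs_mult using k(2)[of "x + t *\<^sub>R z"] \<phi>(2)[of z] by (simp add: mult_right_mono)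
    from ennreal_leI[OF this]
    show "ennreal (norm (\<phi> z * k (x + t *\<^sub>R z))) \<le> ennreal c * (ennreal (k (x + t *\<^sub>R z)) * indicator (cball 0 L) z)"
      using c k(2) by (cases "norm z \<le> L") (simp_all add: ennreal_mult)
  qed
  also have "\<dots> = ennreal c * (\<integral>\<^sup>*z. ennreal (k (x + t *\<^sub>R z)) * indicator (cball 0 L) z)"
    by (rule nn_integral_cmult) measurable
  finally show ?thesis .
qed

text \<open>The average M(t) of \<open>pd i u\<close> is a multiple of \<open>pd i u x\<close> at t
  = 0. Its derivative is a Hessian integral, hence by \<open>integral_hessian_bump\<close> an
  integral of f without the factor t that occurs in \<open>superharmonic_potential_le\<close>: this
  is why a potential of order one appears in place of order two. At scale \<rho> the remaining
  derivative is moved onto the weight, leaving an average of u.\<close>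

lemma gradient_potential_bound:
  fixes u f :: "real^'n::finite \<Rightarrow> real" and L \<rho> :: real
  assumes u: "C2_on (UNIV - {0}) u" and u0: "\<And>y. u y \<ge> 0"
    and f [measurable]: "f \<in> borel_measurable borel" and f0: "\<And>y. f y \<ge> 0"
    and eq: "\<And>y. y \<noteq> 0 \<Longrightarrow> - laplacian u y = f y"
    and L: "L > 0" and \<rho>: "\<rho> > 0" "\<rho> * (L * CARD('n)) < norm x"
  shows "ennreal (bump_mass TYPE('n) L * \<bar>pd i u x\<bar>)
     \<le> ennreal (48 * L ^ 5 / \<rho>) * (\<integral>\<^sup>*z. ennreal (u (x + \<rho> *\<^sub>R z)) * indicator (cball 0 L) z)
      + ennreal (8 * L ^ 7) * (\<integral>\<^sup>*t. (\<integral>\<^sup>*z. ennreal (f (x + t *\<^sub>R z)) * indicator (cball 0 L) z) * indicator {0..\<rho>} t)"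
proof -
  define M where "M t = (LINT z|lborel. 8 * bump L 3 z * pd i u (x + t *\<^sub>R z))" for t
  define d where "d t = (\<Sum>j\<in>UNIV. LINT z|lborel. (8 * bump L 3 z * z $ j) * pd j (pd i u) (x + t *\<^sub>R z))" for t
  have out3: "norm z > L \<Longrightarrow> 8 * bump L 3 z = 0" for z :: "real^'n"
    using bump_zero_outside[OF L, of 3 z] by simp
  have out3': "norm z > L \<Longrightarrow> 8 * bump L 3 z * z $ j = 0" for z :: "real^'n" and j
    using out3[of z] by simp
  have out4: "norm z > L \<Longrightarrow> pd i (bump L 4) z = 0" for z :: "real^'n"
    using partial_deriv_bump_outside[of L z i 3] L by (simp add: numeral_eq_Suc)
  have cf: "continuous_on (UNIV - {0}) f"
    by (rule continuous_on_eq[OF continuous_on_minus[OF continuous_on_laplacian[OF u]]]) (use eq in auto)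
  have C1: "C1_on (UNIV - {0}) u" using u unfolding C2_on_def by blast
  have C1i: "C1_on (UNIV - {0}) (pd i u)" using u unfolding C2_on_def by blast
  have cij: "continuous_on (UNIV - {0}) (pd j (pd i u))" for j
    using C1i unfolding C1_on_def by blast
  have cB: "continuous_on UNIV (pd i (bump L 4) :: real^'n \<Rightarrow> real)"
    using C1_on_bump_4 unfolding C1_on_def by blast
  note ct = card_bound_mono[OF L \<rho>(2)]
  note ne = shift_nonzero[OF norm_bound_of_card_bound[OF ct L]]
  have M': "(M has_real_derivative d t) (at t)" if t: "0 \<le> t" "t \<le> \<rho>" for t
    unfolding M_def d_def
    by (rule deriv_cutoff_average[OF _ out3 C1i L ct[OF t]]) (intro continuous_intros continuous_on_bump)
  have "continuous_on {t. \<bar>t\<bar> * (L * CARD('n)) < norm x} d"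
    unfolding d_def
    by (intro continuous_on_sum continuous_on_cutoff_average[OF _ out3' cij L] continuous_intros continuous_on_bump)
  then have cd: "continuous_on {0..\<rho>} d" by (rule continuous_on_subset) (use ct in auto)
  \<comment> \<open>Both constants of the statement come from here: 8 times the case k = 3 gives 8
    L^7, and 48 times the case k = 2 gives 48 L^5.\<close>
  have comp: "\<bar>z $ j\<bar> * bump L k z \<le> L * L ^ (2 * k) * indicator (cball 0 L) z" if "k \<ge> 1" for z :: "real^'n" and j k
  proof (cases "norm z \<le> L")
    case True
    have "\<bar>z $ j\<bar> \<le> L" using component_le_norm_cart[of z j] True by linarith
    then show ?thesis using True L by (auto simp: bump_nonneg intro!: mult_mono bump_le)
  next
    case False
    then show ?thesis using bump_zero_outside[OF L that, of z] by simp
  qed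
  have di: "ennreal \<bar>d t\<bar> \<le> ennreal (8 * L ^ 7) * (\<integral>\<^sup>*z. ennreal (f (x + t *\<^sub>R z)) * indicator (cball 0 L) z)"
    if t: "0 < t" "t \<le> \<rho>" for t
  proof -
    have t0: "0 \<le> t" using t by simp
    have tL: "\<bar>t\<bar> * L < norm x" using norm_bound_of_card_bound[OF ct[OF t0 t(2)] L] .
    have "d t = - (LINT z|lborel. pd i (bump L 4) z * laplacian u (x + t *\<^sub>R z))"
      unfolding d_def using integral_hessian_bump[OF u L tL] t by simp
    also have "\<dots> = (LINT z|lborel. pd i (bump L 4) z * f (x + t *\<^sub>R z))"
      unfolding Bochner_Integration.integral_minus[symmetric]
    proof (rule Bochner_Integration.integral_cong[OF refl])
      show "- (pd i (bump L 4) z * laplacian u (x + t *\<^sub>R z)) = pd i (bump L 4) z * f (x + t *\<^sub>R z)" for z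
        using eq[OF ne[OF t0 t(2), of z], symmetric] out4[of z] by (cases "norm z \<le> L") auto
    qed
    finally have eq: "d t = \<dots>" .
    have "\<bar>pd i (bump L 4) z\<bar> \<le> 8 * L ^ 7 * indicator (cball 0 L) z" for z :: "real^'n"
      using mult_left_mono[OF comp[of 3 z i], of 8] bump_nonneg[of L 3 z]
      by (simp add: partial_deriv_bump_4 abs_mult power_numeral_reduce mult_ac)
    then show ?thesis
      unfolding eq by (rule cutoff_integral_le[OF cB _ _ cf f0 tL]) (use L in simp)
  qed
  have M\<rho>: "ennreal \<bar>M \<rho>\<bar> \<le> ennreal (48 * L ^ 5 / \<rho>) * (\<integral>\<^sup>*z. ennreal (u (x + \<rho> *\<^sub>R z)) * indicator (cball 0 L) z)"
  proof -
    have \<rho>L: "\<bar>\<rho>\<bar> * L < norm x" using norm_bound_of_card_bound[OF ct[of \<rho>] L] \<rho> by simp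
    have C18: "C1_on UNIV (\<lambda>z :: real^'n. 8 * bump L 3 z)" by (intro C1_on_cmult C1_on_bump_3)
    have p8: "pd i (\<lambda>z. 8 * bump L 3 z) z = - (48 * bump L 2 z * z $ i)" for z :: "real^'n"
      using C1_on_bump_3[of UNIV L] by (subst partial_deriv_cmult) (auto simp: C1_on_def partial_deriv_bump_3)
    have c2: "continuous_on UNIV (\<lambda>z :: real^'n. - (48 * bump L 2 z * z $ i))"
      by (intro continuous_intros continuous_on_bump)
    \<comment> \<open>The kernel \<open>8 * bump L 3\<close> has the partial derivatives
      \<open>- (48 * bump L 2 z * z $ i)\<close>; the factor \<rho> on the left is later divided
      out.\<close>
    have "\<rho> * M \<rho> = - (LINT z|lborel. - (48 * bump L 2 z * z $ i) * u (x + \<rho> *\<^sub>R z))"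
      unfolding M_def using integral_cutoff_by_parts[OF C18 out3 C1 \<rho>L, of i] unfolding p8 .
    then have "M \<rho> = - (1 / \<rho>) * (LINT z|lborel. - (48 * bump L 2 z * z $ i) * u (x + \<rho> *\<^sub>R z))"
      using \<rho> by (simp add: field_simps)
    then have "ennreal \<bar>M \<rho>\<bar> = ennreal (1 / \<rho>) * ennreal (norm (LINT z|lborel. - (48 * bump L 2 z * z $ i) * u (x + \<rho> *\<^sub>R z)))"
      using \<rho> by (simp add: abs_mult ennreal_mult[symmetric])
    also have "\<dots> \<le> ennreal (1 / \<rho>) * (ennreal (48 * L ^ 5) * (\<integral>\<^sup>*z. ennreal (u (x + \<rho> *\<^sub>R z)) * indicator (cball 0 L) z))"
    proof -
      have "\<bar>- (48 * bump L 2 z * z $ i)\<bar> \<le> 48 * L ^ 5 * indicator (cball 0 L) z" for z :: "real^'n"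
        using mult_left_mono[OF comp[of 2 z i], of 48] bump_nonneg[of L 2 z]
        by (simp add: abs_mult power_numeral_reduce mult_ac)
      then show ?thesis unfolding real_norm_def
        by (intro mult_left_mono cutoff_integral_le[OF c2 _ _ C1_on_continuous[OF C1] u0 \<rho>L]) (use L in simp_all)
    qed
    also have "\<dots> = ennreal (48 * L ^ 5 / \<rho>) * (\<integral>\<^sup>*z. ennreal (u (x + \<rho> *\<^sub>R z)) * indicator (cball 0 L) z)"
      using \<rho> L by (simp add: mult.assoc[symmetric] ennreal_mult[symmetric])
    finally show ?thesis .
  qed
  have intd: "set_integrable lborel {0..\<rho>} d" by (rule borel_integrable_atLeastAtMost'[OF cd])
  have "(d has_integral (M \<rho> - M 0)) {0..\<rho>}"
    by (rule fundamental_theorem_of_calculus)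
       (use \<rho> M' in \<open>auto simp: has_real_derivative_iff_has_vector_derivative intro: has_vector_derivative_at_within\<close>)
  then have FTC: "M \<rho> - M 0 = (LINT t|lborel. indicator {0..\<rho>} t *\<^sub>R d t)"
    using set_borel_integral_eq_integral(2)[OF intd] unfolding set_lebesgue_integral_def
    by (metis integral_unique)
  have "ennreal \<bar>M \<rho> - M 0\<bar> \<le> (\<integral>\<^sup>*t. norm (indicator {0..\<rho>} t *\<^sub>R d t))"
    using integral_norm_bound_ennreal[OF intd[unfolded set_integrable_def]] unfolding FTC by simp
  also have "\<dots> \<le> (\<integral>\<^sup>*t. ennreal (8 * L ^ 7) * ((\<integral>\<^sup>*z. ennreal (f (x + t *\<^sub>R z)) * indicator (cball 0 L) z) * indicator {0..\<rho>} t))"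
  proof (rule nn_integral_mono_AE)
    \<comment> \<open>The bound on d comes from the Hessian identity, which excludes t = 0; a single
      scale is negligible.\<close>
    have "AE t in lborel. t \<noteq> (0::real)" by (rule AE_lborel_singleton)
    then show "AE t in lborel. ennreal (norm (indicator {0..\<rho>} t *\<^sub>R d t)) \<le> ennreal (8 * L ^ 7) * ((\<integral>\<^sup>*z. ennreal (f (x + t *\<^sub>R z)) * indicator (cball 0 L) z) * indicator {0..\<rho>} t)"
    proof (rule AE_mp, intro AE_I2 impI)
      fix t :: real assume "t \<noteq> 0"
      then show "ennreal (norm (indicator {0..\<rho>} t *\<^sub>R d t)) \<le> ennreal (8 * L ^ 7) * ((\<integral>\<^sup>*z. ennreal (f (x + t *\<^sub>R z)) * indicator (cball 0 L) z) * indicator {0..\<rho>} t)"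
        using di[of t] by (cases "t \<in> {0..\<rho>}") auto
    qed
  qed
  also have "\<dots> = ennreal (8 * L ^ 7) * (\<integral>\<^sup>*t. (\<integral>\<^sup>*z. ennreal (f (x + t *\<^sub>R z)) * indicator (cball 0 L) z) * indicator {0..\<rho>} t)"
    by (rule nn_integral_cmult) measurable
  finally have d_bd: "ennreal \<bar>M \<rho> - M 0\<bar> \<le> \<dots>" .
  have "bump_mass TYPE('n) L * \<bar>pd i u x\<bar> = \<bar>M 0\<bar>"
    using bump_mass_pos[OF L, where 'n='n] unfolding M_def bump_mass_def by (simp add: abs_mult)
  also have "\<dots> \<le> \<bar>M \<rho>\<bar> + \<bar>M \<rho> - M 0\<bar>" by linarith
  finally have "ennreal (bump_mass TYPE('n) L * \<bar>pd i u x\<bar>) \<le> ennreal (\<bar>M \<rho>\<bar> + \<bar>M \<rho> - M 0\<bar>)"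
    by (rule ennreal_leI)
  also have "\<dots> = ennreal \<bar>M \<rho>\<bar> + ennreal \<bar>M \<rho> - M 0\<bar>" by simp
  also have "\<dots> \<le> ennreal (48 * L ^ 5 / \<rho>) * (\<integral>\<^sup>*z. ennreal (u (x + \<rho> *\<^sub>R z)) * indicator (cball 0 L) z)
      + ennreal (8 * L ^ 7) * (\<integral>\<^sup>*t. (\<integral>\<^sup>*z. ennreal (f (x + t *\<^sub>R z)) * indicator (cball 0 L) z) * indicator {0..\<rho>} t)"
    by (rule add_mono[OF M\<rho> d_bd])
  finally show ?thesis .
qed

subsection \<open>Riesz potentials as integrals over scales\<close>

lemma nn_integral_affine:
  fixes h :: "real^'n::finite \<Rightarrow> ennreal"
  assumes [measurable]: "h \<in> borel_measurable borel" and c: "c \<noteq> 0"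
  shows "(\<integral>\<^sup>*y. h y) = ennreal (\<bar>c\<bar> ^ CARD('n)) * (\<integral>\<^sup>*z. h (x + c *\<^sub>R z))"
  by (subst lborel_affine[OF c, of x])
     (simp add: nn_integral_density nn_integral_distr nn_integral_cmult DIM_cart ennreal_power)

lemma nn_integral_translate:
  fixes h :: "real^'n::finite \<Rightarrow> ennreal"
  assumes "h \<in> borel_measurable borel"
  shows "(\<integral>\<^sup>*z. h (z + x)) = (\<integral>\<^sup>*z. h z)"
  using nn_integral_affine[OF assms, of 1 x] by (simp add: add.commute)

text \<open>For t > 0 this is t^(-N) times the integral of f over the ball of radius r t about x.
  The scaled variable z keeps it meaningful at t = 0 and makes every shift a translation.\<close>

definition ball_integral :: "real \<Rightarrow> (real^'n::finite \<Rightarrow> ennreal) \<Rightarrow> real \<Rightarrow> real^'n \<Rightarrow> ennreal" where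
  "ball_integral r f t x = (\<integral>\<^sup>*z. f (x + t *\<^sub>R z) * indicator (cball 0 r) z)"

text \<open>
  Up to constants these are the potentials with kernels |y|^(1-N) and |y|^(2-N), cut off at
  distance about \<open>\<rho>\<close>; writing them as integrals over all scales t keeps singular kernels out.
\<close>

definition riesz1 :: "real \<Rightarrow> (real^'n::finite \<Rightarrow> ennreal) \<Rightarrow> real^'n \<Rightarrow> ennreal" where
  "riesz1 \<rho> f x = (\<integral>\<^sup>*t. ball_integral 1 f t x * indicator {0..\<rho>} t)"

text \<open>The weight t results from integrating out a smaller scale s in [0, t]; the radius 2,
  against 1 in \<open>riesz1\<close>, is the price of recentring a ball.\<close>

definition riesz2 :: "real \<Rightarrow> (real^'n::finite \<Rightarrow> ennreal) \<Rightarrow> real^'n \<Rightarrow> ennreal" where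
  "riesz2 \<rho> f x = (\<integral>\<^sup>*t. (ennreal t * ball_integral 2 f t x) * indicator {0..\<rho>} t)"

lemma measurable_ball_integral [measurable (raw)]:
  fixes f :: "real^'n::finite \<Rightarrow> ennreal"
  assumes [measurable]: "f \<in> borel_measurable borel" "a \<in> borel_measurable M" "b \<in> borel_measurable M"
  shows "(\<lambda>w. ball_integral r f (a w) (b w)) \<in> borel_measurable M"
  unfolding ball_integral_def by measurable

lemma measurable_riesz1 [measurable (raw)]:
  fixes f :: "real^'n::finite \<Rightarrow> ennreal"
  assumes [measurable]: "f \<in> borel_measurable borel" "b \<in> borel_measurable M"
  shows "(\<lambda>w. riesz1 \<rho> f (b w)) \<in> borel_measurable M"
  unfolding riesz1_def by measurable

lemma measurable_riesz2 [measurable (raw)]: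
  fixes f :: "real^'n::finite \<Rightarrow> ennreal"
  assumes [measurable]: "f \<in> borel_measurable borel" "b \<in> borel_measurable M"
  shows "(\<lambda>w. riesz2 \<rho> f (b w)) \<in> borel_measurable M"
  unfolding riesz2_def by measurable

lemma nn_integral_swap:
  fixes F :: "'a::euclidean_space \<Rightarrow> 'b::euclidean_space \<Rightarrow> ennreal"
  assumes "case_prod F \<in> borel_measurable (lborel \<Otimes>\<^sub>M lborel)"
  shows "(\<integral>\<^sup>*x. (\<integral>\<^sup>*y. F x y)) = (\<integral>\<^sup>*y. (\<integral>\<^sup>*x. F x y))"
  using lborel_pair.Fubini'[OF assms] by simp

text \<open>For s \<le> t the shift by s y is absorbed by doubling the radius of the larger ball.\<close>

lemma ball_integral_shift_le:
  fixes g :: "real^'n::finite \<Rightarrow> ennreal"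
  assumes [measurable]: "g \<in> borel_measurable borel" and st: "0 \<le> s" "s \<le> t" and y: "norm y \<le> 1"
  shows "ball_integral 1 g t (x - s *\<^sub>R y) \<le> ball_integral 2 g t x"
proof (cases "t = 0")
  case True
  then have "s = 0" using st by simp
  then show ?thesis unfolding ball_integral_def using True
    by (auto intro!: nn_integral_mono mult_left_mono simp: indicator_def)
next
  case False
  then have t: "t > 0" using st by simp
  let ?v = "(s / t) *\<^sub>R y"
  have "s * norm y \<le> t" using mult_left_le[OF y st(1)] st(2) by simp
  then have v: "norm ?v \<le> 1" using st t by simp
  have "ball_integral 1 g t (x - s *\<^sub>R y)
     = (\<integral>\<^sup>*z. g (x - s *\<^sub>R y + t *\<^sub>R (z + ?v)) * indicator (cball 0 1) (z + ?v))"
    unfolding ball_integral_def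
    by (rule nn_integral_translate[symmetric, where h="\<lambda>z. g (x - s *\<^sub>R y + t *\<^sub>R z) * indicator (cball 0 1) z"]) measurable
  also have "\<dots> \<le> (\<integral>\<^sup>*z. g (x + t *\<^sub>R z) * indicator (cball 0 2) z)"
  proof (intro nn_integral_mono mult_mono)
    fix z :: "real^'n"
    have "t *\<^sub>R (z + ?v) = t *\<^sub>R z + s *\<^sub>R y" using t by (simp add: scaleR_add_right)
    then have "x - s *\<^sub>R y + t *\<^sub>R (z + ?v) = x + t *\<^sub>R z" by simp
    then show "g (x - s *\<^sub>R y + t *\<^sub>R (z + ?v)) \<le> g (x + t *\<^sub>R z)" by (simp only: order_refl)
    have "norm z \<le> 2" if "norm (z + ?v) \<le> 1"
      using norm_diff_triangle_ineq[of z "- ?v" 0 0] norm_triangle_ineq2[of z "- ?v"] that v by simp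
    then show "(indicator (cball 0 1) (z + ?v) :: ennreal) \<le> indicator (cball 0 2) z"
      by (auto simp: indicator_def)
  qed auto
  finally show ?thesis unfolding ball_integral_def .
qed

text \<open>Writing out the average of f at the smaller scale and translating x by s y puts f back
  at x, while the ball for g is recentred at distance at most s, hence covered by the doubled ball.
  The leftover integral in y is the volume of the unit ball.\<close>

lemma nn_integral_ball_integral_mult_le:
  fixes f g :: "real^'n::finite \<Rightarrow> ennreal"
  assumes [measurable]: "f \<in> borel_measurable borel" "g \<in> borel_measurable borel" and st: "0 \<le> s" "s \<le> t"
  shows "(\<integral>\<^sup>*x. ball_integral 1 f s x * ball_integral 1 g t x)
     \<le> emeasure lborel (cball (0 :: real^'n) 1) * (\<integral>\<^sup>*x. f x * ball_integral 2 g t x)"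
proof -
  have "(\<integral>\<^sup>*x. ball_integral 1 f s x * ball_integral 1 g t x)
    = (\<integral>\<^sup>*x. (\<integral>\<^sup>*y. f (x + s *\<^sub>R y) * indicator (cball 0 1) y * ball_integral 1 g t x))"
    unfolding ball_integral_def[of _ f] by (subst nn_integral_multc) measurable
  also have "\<dots> = (\<integral>\<^sup>*y. (\<integral>\<^sup>*x. f (x + s *\<^sub>R y) * indicator (cball 0 1) y * ball_integral 1 g t x))"
    by (rule nn_integral_swap) measurable
  also have "\<dots> \<le> (\<integral>\<^sup>*y. indicator (cball (0 :: real^'n) 1) y * (\<integral>\<^sup>*x. f x * ball_integral 2 g t x))"
  proof (rule nn_integral_mono)
    fix y :: "real^'n"
    have "(\<integral>\<^sup>*x. f (x + s *\<^sub>R y) * indicator (cball 0 1) y * ball_integral 1 g t x)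
       = (\<integral>\<^sup>*x. (\<lambda>x. f x * indicator (cball 0 1) y * ball_integral 1 g t (x - s *\<^sub>R y)) (x + s *\<^sub>R y))"
      by simp
    also have "\<dots> = (\<integral>\<^sup>*x. f x * indicator (cball 0 1) y * ball_integral 1 g t (x - s *\<^sub>R y))"
      by (rule nn_integral_translate) measurable
    also have "\<dots> \<le> (\<integral>\<^sup>*x. indicator (cball 0 1) y * (f x * ball_integral 2 g t x))"
    proof (rule nn_integral_mono)
      fix x :: "real^'n"
      show "f x * indicator (cball 0 1) y * ball_integral 1 g t (x - s *\<^sub>R y) \<le> indicator (cball 0 1) y * (f x * ball_integral 2 g t x)"
        using ball_integral_shift_le[OF _ st, of g y x] by (cases "norm y \<le> 1") (auto intro!: mult_left_mono)
    qed
    also have "\<dots> = indicator (cball 0 1) y * (\<integral>\<^sup>*x. f x * ball_integral 2 g t x)"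
      by (rule nn_integral_cmult) measurable
    finally show "(\<integral>\<^sup>*x. f (x + s *\<^sub>R y) * indicator (cball 0 1) y * ball_integral 1 g t x) \<le> \<dots>" .
  qed
  also have "\<dots> = emeasure lborel (cball (0 :: real^'n) 1) * (\<integral>\<^sup>*x. f x * ball_integral 2 g t x)"
    by (subst nn_integral_multc) auto
  finally show ?thesis .
qed

text \<open>For s at most t the preceding bound does not involve s, so integrating s over [0, t]
  contributes a factor t. This is precisely the weight in \<open>riesz2\<close>: two potentials of
  order one compose to one of order two.\<close>

lemma riesz1_product_ordered_le:
  fixes f g :: "real^'n::finite \<Rightarrow> ennreal"
  assumes [measurable]: "f \<in> borel_measurable borel" "g \<in> borel_measurable borel"
  shows "(\<integral>\<^sup>*x. (\<integral>\<^sup>*s. (\<integral>\<^sup>*t. ball_integral 1 f s x * ball_integral 1 g t x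
            * indicator {(s, t). 0 \<le> s \<and> s \<le> t \<and> t \<le> \<rho>} (s, t))))
     \<le> emeasure lborel (cball (0 :: real^'n) 1) * (\<integral>\<^sup>*x. f x * riesz2 \<rho> g x)" (is "?L \<le> ?B * _")
proof -
  define S :: "(real \<times> real) set" where "S = {(s, t). 0 \<le> s \<and> s \<le> t \<and> t \<le> \<rho>}"
  let ?H = "\<lambda>t. \<integral>\<^sup>*x. f x * ball_integral 2 g t x"
  have "S = {p. 0 \<le> fst p \<and> fst p \<le> snd p \<and> snd p \<le> \<rho>}" by (auto simp: S_def)
  also have "closed \<dots>" by (intro closed_Collect_conj closed_Collect_le continuous_intros)
  finally have "S \<in> sets borel" by (rule borel_closed)
  then have [measurable]: "S \<in> sets (borel \<Otimes>\<^sub>M borel)" by (simp only: borel_prod)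
  have "?L = (\<integral>\<^sup>*x. (\<integral>\<^sup>*s. (\<integral>\<^sup>*t. ball_integral 1 f s x * ball_integral 1 g t x * indicator S (s, t))))"
    by (simp only: S_def)
  also have "\<dots> = (\<integral>\<^sup>*s. (\<integral>\<^sup>*x. (\<integral>\<^sup>*t. ball_integral 1 f s x * ball_integral 1 g t x * indicator S (s, t))))"
    by (rule nn_integral_swap) measurable
  also have "\<dots> = (\<integral>\<^sup>*s. (\<integral>\<^sup>*t. (\<integral>\<^sup>*x. ball_integral 1 f s x * ball_integral 1 g t x * indicator S (s, t))))"
    by (intro nn_integral_cong nn_integral_swap) measurable
  also have "\<dots> \<le> (\<integral>\<^sup>*s. (\<integral>\<^sup>*t. ?B * ?H t * indicator S (s, t)))"
  proof (intro nn_integral_mono)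
    fix s t :: real
    show "(\<integral>\<^sup>*x. ball_integral 1 f s x * ball_integral 1 g t x * indicator S (s, t)) \<le> ?B * ?H t * indicator S (s, t)"
      using nn_integral_ball_integral_mult_le[of f g s t] by (cases "(s, t) \<in> S") (auto simp: S_def)
  qed
  also have "\<dots> = (\<integral>\<^sup>*t. (\<integral>\<^sup>*s. ?B * ?H t * indicator S (s, t)))"
    by (rule nn_integral_swap) measurable
  also have "\<dots> = (\<integral>\<^sup>*t. ?B * (ennreal t * indicator {0..\<rho>} t * ?H t))"
  proof (rule nn_integral_cong)
    fix t :: real
    have "(\<integral>\<^sup>*s. ?B * ?H t * indicator S (s, t)) = (\<integral>\<^sup>*s. (?B * ?H t * indicator {0..\<rho>} t) * indicator {0..t} s)"
      by (intro nn_integral_cong) (auto simp: S_def indicator_def)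
    also have "\<dots> = (?B * ?H t * indicator {0..\<rho>} t) * emeasure lborel {0..t}"
      by (rule nn_integral_cmult_indicator) simp
    also have "\<dots> = ?B * (ennreal t * indicator {0..\<rho>} t * ?H t)"
      by (cases "0 \<le> t") (auto simp: mult_ac)
    finally show "(\<integral>\<^sup>*s. ?B * ?H t * indicator S (s, t)) = ?B * (ennreal t * indicator {0..\<rho>} t * ?H t)" .
  qed
  also have "\<dots> = ?B * (\<integral>\<^sup>*t. ennreal t * indicator {0..\<rho>} t * ?H t)"
    by (rule nn_integral_cmult) measurable
  also have "(\<integral>\<^sup>*t. ennreal t * indicator {0..\<rho>} t * ?H t)
     = (\<integral>\<^sup>*t. (\<integral>\<^sup>*x. ennreal t * indicator {0..\<rho>} t * (f x * ball_integral 2 g t x)))"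
    by (subst nn_integral_cmult) measurable
  also have "\<dots> = (\<integral>\<^sup>*x. (\<integral>\<^sup>*t. ennreal t * indicator {0..\<rho>} t * (f x * ball_integral 2 g t x)))"
    by (rule nn_integral_swap) measurable
  also have "\<dots> = (\<integral>\<^sup>*x. (\<integral>\<^sup>*t. f x * ((ennreal t * ball_integral 2 g t x) * indicator {0..\<rho>} t)))"
    by (simp add: mult_ac)
  also have "\<dots> = (\<integral>\<^sup>*x. f x * riesz2 \<rho> g x)"
    unfolding riesz2_def by (subst nn_integral_cmult) measurable
  finally show ?thesis .
qed

text \<open>The product is a double integral over a square of scales (s, t), which is split along
  the diagonal; on the half where t is the smaller scale, f and g exchange roles. The diagonal is
  counted twice, which an upper bound allows.\<close>

lemma riesz1_product_le:
  fixes f g :: "real^'n::finite \<Rightarrow> ennreal"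
  assumes [measurable]: "f \<in> borel_measurable borel" "g \<in> borel_measurable borel"
  shows "(\<integral>\<^sup>*x. riesz1 \<rho> f x * riesz1 \<rho> g x)
     \<le> emeasure lborel (cball (0 :: real^'n) 1)
       * ((\<integral>\<^sup>*x. f x * riesz2 \<rho> g x) + (\<integral>\<^sup>*x. g x * riesz2 \<rho> f x))"
proof -
  define S :: "(real \<times> real) set" where "S = {(s, t). 0 \<le> s \<and> s \<le> t \<and> t \<le> \<rho>}"
  have "S = {p. 0 \<le> fst p \<and> fst p \<le> snd p \<and> snd p \<le> \<rho>}" by (auto simp: S_def)
  also have "closed \<dots>" by (intro closed_Collect_conj closed_Collect_le continuous_intros)
  finally have "S \<in> sets borel" by (rule borel_closed)
  then have [measurable]: "S \<in> sets (borel \<Otimes>\<^sub>M borel)" by (simp only: borel_prod)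
  let ?F = "\<lambda>x s t. ball_integral 1 f s x * ball_integral 1 g t x * indicator S (s, t)"
  let ?G = "\<lambda>x s t. ball_integral 1 g s x * ball_integral 1 f t x * indicator S (s, t)"
  have "(\<integral>\<^sup>*x. riesz1 \<rho> f x * riesz1 \<rho> g x)
     \<le> (\<integral>\<^sup>*x. (\<integral>\<^sup>*s. (\<integral>\<^sup>*t. ?F x s t)) + (\<integral>\<^sup>*s. (\<integral>\<^sup>*t. ?G x s t)))"
  proof (rule nn_integral_mono)
    fix x :: "real^'n"
    have "riesz1 \<rho> f x * riesz1 \<rho> g x = (\<integral>\<^sup>*s. (\<integral>\<^sup>*t. (ball_integral 1 f s x * indicator {0..\<rho>} s) * (ball_integral 1 g t x * indicator {0..\<rho>} t)))"
      unfolding riesz1_def by (subst nn_integral_cmult, measurable, subst nn_integral_multc) measurable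
    also have "\<dots> \<le> (\<integral>\<^sup>*s. (\<integral>\<^sup>*t. ?F x s t + ?G x t s))"
    proof (intro nn_integral_mono)
      fix s t :: real
      show "(ball_integral 1 f s x * indicator {0..\<rho>} s) * (ball_integral 1 g t x * indicator {0..\<rho>} t) \<le> ?F x s t + ?G x t s"
        by (cases "s \<le> t") (auto simp: S_def indicator_def mult_ac)
    qed
    also have "\<dots> = (\<integral>\<^sup>*s. (\<integral>\<^sup>*t. ?F x s t)) + (\<integral>\<^sup>*s. (\<integral>\<^sup>*t. ?G x t s))"
      by (subst nn_integral_add, measurable, subst nn_integral_add) measurable
    also have "(\<integral>\<^sup>*s. (\<integral>\<^sup>*t. ?G x t s)) = (\<integral>\<^sup>*t. (\<integral>\<^sup>*s. ?G x t s))"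
      by (rule nn_integral_swap) measurable
    finally show "riesz1 \<rho> f x * riesz1 \<rho> g x \<le> (\<integral>\<^sup>*s. (\<integral>\<^sup>*t. ?F x s t)) + (\<integral>\<^sup>*s. (\<integral>\<^sup>*t. ?G x s t))" .
  qed
  also have "\<dots> = (\<integral>\<^sup>*x. (\<integral>\<^sup>*s. (\<integral>\<^sup>*t. ?F x s t))) + (\<integral>\<^sup>*x. (\<integral>\<^sup>*s. (\<integral>\<^sup>*t. ?G x s t)))"
    by (rule nn_integral_add) measurable
  also have "\<dots> \<le> emeasure lborel (cball (0 :: real^'n) 1) * (\<integral>\<^sup>*x. f x * riesz2 \<rho> g x)
     + emeasure lborel (cball (0 :: real^'n) 1) * (\<integral>\<^sup>*x. g x * riesz2 \<rho> f x)"
    unfolding S_def by (intro add_mono riesz1_product_ordered_le) measurable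
  finally show ?thesis by (simp add: distrib_left)
qed

text \<open>The assumption decouples the two points, after which translation invariance makes the
  integral in x independent of t and z. What remains is the measure of the set of pairs (t, z),
  which is \<rho> times the volume of the unit ball.\<close>

lemma nn_integral_mult_riesz1_le:
  fixes w g h :: "real^'n::finite \<Rightarrow> ennreal"
  assumes [measurable]: "w \<in> borel_measurable borel" "g \<in> borel_measurable borel" "h \<in> borel_measurable borel"
    and le: "\<And>x y. w x * g y \<le> h x + h y" and \<rho>: "\<rho> \<ge> 0"
  shows "(\<integral>\<^sup>*x. w x * riesz1 \<rho> g x)
     \<le> ennreal \<rho> * emeasure lborel (cball (0 :: real^'n) 1) * (2 * (\<integral>\<^sup>*x. h x))"
proof -
  let ?b = "indicator (cball 0 1) :: real^'n \<Rightarrow> ennreal"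
  have "(\<integral>\<^sup>*x. w x * riesz1 \<rho> g x)
     = (\<integral>\<^sup>*x. (\<integral>\<^sup>*t. (\<integral>\<^sup>*z. w x * (g (x + t *\<^sub>R z) * ?b z * indicator {0..\<rho>} t))))"
    unfolding riesz1_def ball_integral_def
    by (subst nn_integral_cmult, measurable, subst nn_integral_multc, measurable, subst nn_integral_cmult) measurable
  also have "\<dots> = (\<integral>\<^sup>*t. (\<integral>\<^sup>*x. (\<integral>\<^sup>*z. w x * (g (x + t *\<^sub>R z) * ?b z * indicator {0..\<rho>} t))))"
    by (rule nn_integral_swap) measurable
  also have "\<dots> = (\<integral>\<^sup>*t. (\<integral>\<^sup>*z. (\<integral>\<^sup>*x. w x * (g (x + t *\<^sub>R z) * ?b z * indicator {0..\<rho>} t))))"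
    by (intro nn_integral_cong nn_integral_swap) measurable
  also have "\<dots> \<le> (\<integral>\<^sup>*t. (\<integral>\<^sup>*z. (2 * (\<integral>\<^sup>*x. h x)) * (?b z * indicator {0..\<rho>} t)))"
  proof (intro nn_integral_mono)
    fix t :: real and z :: "real^'n"
    have "(\<integral>\<^sup>*x. w x * (g (x + t *\<^sub>R z) * ?b z * indicator {0..\<rho>} t))
      \<le> (\<integral>\<^sup>*x. (h x + h (x + t *\<^sub>R z)) * (?b z * indicator {0..\<rho>} t))"
    proof (rule nn_integral_mono)
      fix x :: "real^'n"
      show "w x * (g (x + t *\<^sub>R z) * ?b z * indicator {0..\<rho>} t) \<le> (h x + h (x + t *\<^sub>R z)) * (?b z * indicator {0..\<rho>} t)"
        using mult_right_mono[OF le[of x "x + t *\<^sub>R z"], of "?b z * indicator {0..\<rho>} t"] by (simp add: mult.assoc)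
    qed
    also have "\<dots> = (\<integral>\<^sup>*x. h x + h (x + t *\<^sub>R z)) * (?b z * indicator {0..\<rho>} t)"
      by (rule nn_integral_multc) measurable
    also have "(\<integral>\<^sup>*x. h x + h (x + t *\<^sub>R z)) = 2 * (\<integral>\<^sup>*x. h x)"
      by (subst nn_integral_add) (auto simp: nn_integral_translate mult_2)
    finally show "(\<integral>\<^sup>*x. w x * (g (x + t *\<^sub>R z) * ?b z * indicator {0..\<rho>} t)) \<le> (2 * (\<integral>\<^sup>*x. h x)) * (?b z * indicator {0..\<rho>} t)" .
  qed
  also have "\<dots> = (\<integral>\<^sup>*t. (2 * (\<integral>\<^sup>*x. h x)) * (emeasure lborel (cball (0::real^'n) 1) * indicator {0..\<rho>} t))"
    by (subst nn_integral_cmult, measurable, subst nn_integral_multc) auto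
  also have "\<dots> = (2 * (\<integral>\<^sup>*x. h x)) * (emeasure lborel (cball (0::real^'n) 1) * ennreal \<rho>)"
    using \<rho> by (subst nn_integral_cmult, measurable, subst nn_integral_cmult_indicator) auto
  finally show ?thesis by (simp add: mult_ac)
qed

subsection \<open>Energy bounds on annuli\<close>

text \<open>The l1 norm of the gradient: as a sum over coordinates it inherits bounds and
  measurability from the partial derivatives.\<close>

definition grad1 :: "(real^'n::finite \<Rightarrow> real) \<Rightarrow> real^'n \<Rightarrow> real" where
  "grad1 u x = (\<Sum>i\<in>UNIV. \<bar>pd i u x\<bar>)"

lemma grad1_nonneg: "grad1 u x \<ge> 0" by (simp add: grad1_def sum_nonneg)

lemma partial_le_grad1: "\<bar>pd i u x\<bar> \<le> grad1 u x"
  unfolding grad1_def by (rule member_le_sum) auto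

definition annulus :: "real \<Rightarrow> real \<Rightarrow> (real^'n::finite) set" where
  "annulus r s = ball 0 s - ball 0 r"

lemma mem_annulus: "x \<in> annulus r s \<longleftrightarrow> r \<le> norm x \<and> norm x < s"
  by (auto simp: annulus_def)

lemma annulus_borel [measurable]: "annulus r s \<in> sets borel" by (simp add: annulus_def)

lemma emeasure_annulus_finite: "emeasure lborel (annulus r s :: (real^'n::finite) set) < \<infinity>"
  by (rule emeasure_bounded_finite, rule bounded_subset[OF bounded_ball[of 0 s]]) (auto simp: annulus_def)

text \<open>The value of f at the origin is left free, so that f may be given by a formula with a
  power of the norm, whatever \<open>0 powr a\<close> means.\<close>

definition superharmonic_pair ::
  "(real^'n::finite \<Rightarrow> real) \<Rightarrow> (real^'n \<Rightarrow> real) \<Rightarrow> bool" where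
  "superharmonic_pair u f \<longleftrightarrow> C2_on (UNIV - {0}) u \<and> continuous_on UNIV u \<and> (\<forall>x. u x \<ge> 0)
     \<and> f \<in> borel_measurable borel \<and> (\<forall>x. f x \<ge> 0) \<and> (\<forall>x. x \<noteq> 0 \<longrightarrow> - laplacian u x = f x)"

lemma superharmonic_pair_borel:
  "superharmonic_pair u f \<Longrightarrow> u \<in> borel_measurable borel"
  unfolding superharmonic_pair_def by (auto intro: borel_measurable_continuous_onI)

text \<open>\<open>gradient_potential_bound\<close> with L = 1. Points at distance at most \<rho> <
  \<delta> from the smaller annulus lie in the larger one, so u and f may be cut off outside
  it.\<close>

lemma grad1_annulus_bound:
  fixes R1 R4 \<rho> \<delta> :: real
  assumes R: "0 < R1" and \<rho>: "0 < \<rho>" "\<rho> * CARD('n::finite) < R1" "\<rho> < \<delta>"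
  obtains K :: real where "K \<ge> 0"
    "\<And>(u :: real^'n \<Rightarrow> real) f x. superharmonic_pair u f \<Longrightarrow> x \<in> annulus (R1 + \<delta>) (R4 - \<delta>) \<Longrightarrow>
      ennreal (grad1 u x) \<le> ennreal K * ((\<integral>\<^sup>*y. ennreal (u y) * indicator (annulus R1 R4) y)
         + riesz1 \<rho> (\<lambda>y. ennreal (f y) * indicator (annulus R1 R4) y) x)"
proof -
  let ?c = "bump_mass TYPE('n) 1"
  have c: "?c > 0" by (rule bump_mass_pos) simp
  \<comment> \<open>The first entry combines 48 / \<rho> from the average of u with \<rho>^(-N) from
    undoing the dilation; the second is the constant in front of the potential.\<close>
  define K1 where "K1 = max (48 / \<rho> / \<rho> ^ CARD('n)) 8"
  have K1: "K1 \<ge> 0" "48 / \<rho> / \<rho> ^ CARD('n) \<le> K1" "8 \<le> K1" by (auto simp: K1_def)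
  define K where "K = CARD('n) * (K1 / ?c)"
  show ?thesis
  proof (rule that[of K])
    show "K \<ge> 0" unfolding K_def using K1 c by simp
    fix u f :: "real^'n \<Rightarrow> real" and x :: "real^'n"
    assume sp: "superharmonic_pair u f" and x: "x \<in> annulus (R1 + \<delta>) (R4 - \<delta>)"
    let ?A = "annulus R1 R4 :: (real^'n) set"
    let ?U = "\<integral>\<^sup>*y. ennreal (u y) * indicator ?A y"
    let ?F = "\<lambda>y. ennreal (f y) * indicator ?A y"
    from sp have u: "C2_on (UNIV - {0}) u" "\<And>x. u x \<ge> 0" and f[measurable]: "f \<in> borel_measurable borel"
      and f0: "\<And>x. f x \<ge> 0" and eq: "\<And>x. x \<noteq> 0 \<Longrightarrow> - laplacian u x = f x"
      unfolding superharmonic_pair_def by auto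
    note [measurable] = superharmonic_pair_borel[OF sp]
    have \<rho>x: "\<rho> * (1 * real CARD('n)) < norm x" using x \<rho> R by (auto simp: mem_annulus)
    have inA: "x + t *\<^sub>R z \<in> ?A" if "0 \<le> t" "t \<le> \<rho>" "norm z \<le> 1" for t z
    proof -
      have "norm (t *\<^sub>R z) \<le> \<rho>" using that mult_mono[of t \<rho> "norm z" 1] by simp
      then show ?thesis
        using x \<rho> norm_triangle_ineq[of x "t *\<^sub>R z"] norm_diff_ineq[of x "t *\<^sub>R z"]
        unfolding mem_annulus by linarith
    qed
    have U: "(\<integral>\<^sup>*z. ennreal (u (x + \<rho> *\<^sub>R z)) * indicator (cball 0 1) z) \<le> ennreal (1 / \<rho> ^ CARD('n)) * ?U"
    proof -
      have "(\<integral>\<^sup>*z. ennreal (u (x + \<rho> *\<^sub>R z)) * indicator (cball 0 1) z)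
        \<le> (\<integral>\<^sup>*z. ennreal (u (x + \<rho> *\<^sub>R z)) * indicator ?A (x + \<rho> *\<^sub>R z))"
        using inA[of \<rho>] \<rho> by (intro nn_integral_mono mult_left_mono) (auto simp: indicator_def)
      also have "\<dots> = (ennreal (1 / \<rho> ^ CARD('n)) * ennreal (\<bar>\<rho>\<bar> ^ CARD('n))) * \<dots>"
        using \<rho> by (simp add: ennreal_mult[symmetric])
      also have "\<dots> = ennreal (1 / \<rho> ^ CARD('n)) * ?U"
        by (subst nn_integral_affine[of "\<lambda>y. ennreal (u y) * indicator ?A y" \<rho> x]) (use \<rho> in \<open>auto simp: mult.assoc\<close>)
      finally show ?thesis .
    qed
    have F: "(\<integral>\<^sup>*t. (\<integral>\<^sup>*z. ennreal (f (x + t *\<^sub>R z)) * indicator (cball 0 1) z) * indicator {0..\<rho>} t) \<le> riesz1 \<rho> ?F x"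
      unfolding riesz1_def ball_integral_def
    proof (rule nn_integral_mono)
      fix t :: real
      have "(\<integral>\<^sup>*z. ennreal (f (x + t *\<^sub>R z)) * indicator (cball 0 1) z)
         \<le> (\<integral>\<^sup>*z. ennreal (f (x + t *\<^sub>R z)) * indicator ?A (x + t *\<^sub>R z) * indicator (cball 0 1) z)"
        if "t \<in> {0..\<rho>}"
      proof (rule nn_integral_mono)
        fix z show "ennreal (f (x + t *\<^sub>R z)) * indicator (cball 0 1) z \<le> ennreal (f (x + t *\<^sub>R z)) * indicator ?A (x + t *\<^sub>R z) * indicator (cball 0 1) z"
          using inA[of t z] that by (cases "norm z \<le> 1") auto
      qed
      then show "(\<integral>\<^sup>*z. ennreal (f (x + t *\<^sub>R z)) * indicator (cball 0 1) z) * indicator {0..\<rho>} t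
        \<le> (\<integral>\<^sup>*z. ennreal (f (x + t *\<^sub>R z)) * indicator ?A (x + t *\<^sub>R z) * indicator (cball 0 1) z) * indicator {0..\<rho>} t"
        by (cases "t \<in> {0..\<rho>}") auto
    qed
    have P: "ennreal \<bar>pd i u x\<bar> \<le> ennreal (K1 / ?c) * (?U + riesz1 \<rho> ?F x)" for i
    proof -
      have "ennreal \<bar>pd i u x\<bar> = ennreal (1 / ?c) * ennreal (?c * \<bar>pd i u x\<bar>)"
        using c by (simp add: ennreal_mult[symmetric])
      also have "\<dots> \<le> ennreal (1 / ?c) * (ennreal (48 * 1 ^ 5 / \<rho>) * (ennreal (1 / \<rho> ^ CARD('n)) * ?U) + ennreal (8 * 1 ^ 7) * riesz1 \<rho> ?F x)"
        by (intro mult_left_mono order_trans[OF gradient_potential_bound[OF u f f0 eq _ \<rho>(1) \<rho>x]] add_mono U F) auto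
      also have "\<dots> = ennreal (1 / ?c) * (ennreal (48 / \<rho> / \<rho> ^ CARD('n)) * ?U + ennreal 8 * riesz1 \<rho> ?F x)"
        using \<rho> by (simp add: mult.assoc[symmetric] ennreal_mult[symmetric])
      also have "\<dots> \<le> ennreal (1 / ?c) * (ennreal K1 * ?U + ennreal K1 * riesz1 \<rho> ?F x)"
        by (intro mult_left_mono add_mono mult_right_mono ennreal_leI K1) auto
      also have "\<dots> = ennreal (1 / ?c) * ennreal K1 * (?U + riesz1 \<rho> ?F x)"
        by (simp add: distrib_left mult.assoc)
      also have "ennreal (1 / ?c) * ennreal K1 = ennreal (K1 / ?c)"
        using c K1 by (simp add: ennreal_mult[symmetric])
      finally show ?thesis .
    qed
    have "ennreal (grad1 u x) = (\<Sum>i\<in>UNIV. ennreal \<bar>pd i u x\<bar>)"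
      unfolding grad1_def by (rule sum_ennreal[symmetric]) simp
    also have "\<dots> \<le> (\<Sum>i\<in>(UNIV :: 'n set). ennreal (K1 / ?c) * (?U + riesz1 \<rho> ?F x))"
      by (intro sum_mono P)
    also have "\<dots> = ennreal K * (?U + riesz1 \<rho> ?F x)"
    proof -
      have "ennreal K = of_nat CARD('n) * ennreal (K1 / ?c)"
        unfolding K_def using K1 c by (subst ennreal_mult) (auto simp: ennreal_of_nat_eq_real_of_nat)
      then show ?thesis by (simp add: mult.assoc)
    qed
    finally show "ennreal (grad1 u x) \<le> ennreal K * (?U + riesz1 \<rho> ?F x)" .
  qed
qed

text \<open>\<open>superharmonic_potential_le\<close> with L = 4: on the ball of radius 2 used by
  \<open>riesz2\<close> the weight \<open>bump 4 4\<close> is at least (4^2 - 2^2)^4 = 12^4, so it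
  dominates the indicator of that ball up to a constant.\<close>

lemma riesz2_le_superharmonic:
  fixes R1 \<rho> :: real
  assumes \<rho>: "0 < \<rho>" "\<rho> * (4 * real CARD('n::finite)) < R1"
  obtains K :: real where "K \<ge> 0"
    "\<And>(u :: real^'n \<Rightarrow> real) f F x. superharmonic_pair u f \<Longrightarrow> R1 \<le> norm x \<Longrightarrow>
       (\<And>y. F y \<le> ennreal (f y)) \<Longrightarrow> riesz2 \<rho> F x \<le> ennreal K * ennreal (u x)"
proof -
  let ?c = "bump_mass TYPE('n) 4"
  have c: "?c > 0" by (rule bump_mass_pos) simp
  show ?thesis
  proof (rule that[of "?c / 12 ^ 4"])
    show "?c / 12 ^ 4 \<ge> 0" using c by simp
    fix u f :: "real^'n \<Rightarrow> real" and F and x :: "real^'n"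
    assume sp: "superharmonic_pair u f" and x: "R1 \<le> norm x" and F: "\<And>y. F y \<le> ennreal (f y)"
    from sp have u: "C2_on (UNIV - {0}) u" "\<And>x. u x \<ge> 0" and f[measurable]: "f \<in> borel_measurable borel"
      and f0: "\<And>x. f x \<ge> 0" and eq: "\<And>x. x \<noteq> 0 \<Longrightarrow> - laplacian u x = f x"
      unfolding superharmonic_pair_def by auto
    have \<rho>x: "\<rho> * (4 * real CARD('n)) < norm x" using x \<rho> by simp
    have [measurable]: "bump 4 4 \<in> borel_measurable (borel :: (real^'n) measure)"
      by (rule borel_measurable_continuous_onI[OF continuous_on_bump])
    have ball: "ball_integral 2 F t x \<le> ennreal (1 / 12 ^ 4) * (\<integral>\<^sup>*z. ennreal (bump 4 4 z * f (x + t *\<^sub>R z)))" for t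
    proof -
      have "ball_integral 2 F t x \<le> (\<integral>\<^sup>*z. ennreal (1 / 12 ^ 4) * ennreal (bump 4 4 z * f (x + t *\<^sub>R z)))"
        unfolding ball_integral_def
      proof (rule nn_integral_mono)
        fix z :: "real^'n"
        show "F (x + t *\<^sub>R z) * indicator (cball 0 2) z \<le> ennreal (1 / 12 ^ 4) * ennreal (bump 4 4 z * f (x + t *\<^sub>R z))"
        proof (cases "norm z \<le> 2")
          case True
          have "(norm z)\<^sup>2 \<le> 2\<^sup>2" by (rule power_mono[OF True]) simp
          then have "12 \<le> max 0 (4\<^sup>2 - z \<bullet> z)" by (simp add: power2_norm_eq_inner le_max_iff_disj)
          then have "12 ^ 4 \<le> bump 4 4 z" unfolding bump_def by (rule power_mono) simp
          have pos: "0 \<le> bump 4 4 z * f (x + t *\<^sub>R z)" by (intro mult_nonneg_nonneg bump_nonneg f0)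
          from \<open>12 ^ 4 \<le> bump 4 4 z\<close> have "12 ^ 4 * f (x + t *\<^sub>R z) \<le> bump 4 4 z * f (x + t *\<^sub>R z)"
            by (rule mult_right_mono) (rule f0)
          then have "f (x + t *\<^sub>R z) \<le> 1 / 12 ^ 4 * (bump 4 4 z * f (x + t *\<^sub>R z))" by simp
          then have "ennreal (f (x + t *\<^sub>R z)) \<le> ennreal (1 / 12 ^ 4 * (bump 4 4 z * f (x + t *\<^sub>R z)))"
            by (rule ennreal_leI)
          then have "ennreal (f (x + t *\<^sub>R z)) \<le> ennreal (1 / 12 ^ 4) * ennreal (bump 4 4 z * f (x + t *\<^sub>R z))"
            by (subst (asm) ennreal_mult[OF _ pos]) simp_all
          then show ?thesis using True F[of "x + t *\<^sub>R z"] by (simp add: order_trans)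
        next
          case False then show ?thesis by simp
        qed
      qed
      also have "\<dots> = ennreal (1 / 12 ^ 4) * (\<integral>\<^sup>*z. ennreal (bump 4 4 z * f (x + t *\<^sub>R z)))"
        by (rule nn_integral_cmult) measurable
      finally show ?thesis .
    qed
    have "riesz2 \<rho> F x \<le> (\<integral>\<^sup>*t. ennreal (1 / 12 ^ 4) * ((ennreal t * (\<integral>\<^sup>*z. ennreal (bump 4 4 z * f (x + t *\<^sub>R z)))) * indicator {0..\<rho>} t))"
      unfolding riesz2_def
    proof (rule nn_integral_mono)
      fix t :: real
      have "ennreal t * ball_integral 2 F t x * indicator {0..\<rho>} t
        \<le> ennreal t * (ennreal (1 / 12 ^ 4) * (\<integral>\<^sup>*z. ennreal (bump 4 4 z * f (x + t *\<^sub>R z)))) * indicator {0..\<rho>} t"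
        by (intro mult_right_mono mult_left_mono ball) auto
      then show "ennreal t * ball_integral 2 F t x * indicator {0..\<rho>} t
        \<le> ennreal (1 / 12 ^ 4) * ((ennreal t * (\<integral>\<^sup>*z. ennreal (bump 4 4 z * f (x + t *\<^sub>R z)))) * indicator {0..\<rho>} t)"
        by (simp add: mult_ac)
    qed
    also have "\<dots> = ennreal (1 / 12 ^ 4) * (\<integral>\<^sup>*t. (ennreal t * (\<integral>\<^sup>*z. ennreal (bump 4 4 z * f (x + t *\<^sub>R z)))) * indicator {0..\<rho>} t)"
      by (rule nn_integral_cmult) measurable
    also have "\<dots> \<le> ennreal (1 / 12 ^ 4) * ennreal (?c * u x)"
      by (intro mult_left_mono superharmonic_potential_le[OF u f f0 eq _ \<rho>(1) \<rho>x]) auto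
    also have "\<dots> = ennreal (?c / 12 ^ 4) * ennreal (u x)"
      using c u by (simp add: ennreal_mult[symmetric])
    finally show "riesz2 \<rho> F x \<le> ennreal (?c / 12 ^ 4) * ennreal (u x)" .
  qed
qed

text \<open>The function h is a single majorant for everything that the hypothesis controls. Each
  gradient is bounded by a constant plus a potential; expanding leaves single potentials and
  potentials times u or v, settled by \<open>nn_integral_mult_riesz1_le\<close>, and the product of
  two potentials, settled by \<open>riesz1_product_le\<close> with
  \<open>riesz2_le_superharmonic\<close>.\<close>

lemma annulus_energy_bound:
  fixes R1 R4 \<delta> E :: real
  assumes R: "0 < R1" and \<delta>: "0 < \<delta>"
  obtains C :: real where "C \<ge> 0"
    "\<And>(u :: real^'n::finite \<Rightarrow> real) v f g h. superharmonic_pair u f \<Longrightarrow> superharmonic_pair v g \<Longrightarrow>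
      h \<in> borel_measurable borel \<Longrightarrow>
      (\<And>x. x \<in> annulus R1 R4 \<Longrightarrow> ennreal (u x) \<le> h x \<and> ennreal (v x) \<le> h x \<and> ennreal (f x) \<le> h x
         \<and> ennreal (g x) \<le> h x \<and> ennreal (u x * g x) \<le> h x \<and> ennreal (v x * f x) \<le> h x) \<Longrightarrow>
      (\<And>x y. x \<in> annulus R1 R4 \<Longrightarrow> y \<in> annulus R1 R4 \<Longrightarrow>
         ennreal (u x * g y) \<le> h x + h y \<and> ennreal (v x * f y) \<le> h x + h y) \<Longrightarrow>
      (\<integral>\<^sup>*x. h x * indicator (annulus R1 R4) x) \<le> ennreal E \<Longrightarrow>
      (\<integral>\<^sup>*x. ennreal (u x * g x + v x * f x + grad1 u x * grad1 v x + u x * grad1 v x + v x * grad1 u x)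
          * indicator (annulus (R1 + \<delta>) (R4 - \<delta>)) x) \<le> ennreal C"
proof -
  let ?N = "real CARD('n)"
  have N: "?N > 0" by simp
  \<comment> \<open>The first entry keeps shifted points inside the larger annulus; the second keeps
    them off the origin both for L = 1 and for L = 4.\<close>
  define \<rho> where "\<rho> = min (\<delta> / 2) (R1 / (8 * ?N))"
  have \<rho>: "0 < \<rho>" "\<rho> < \<delta>" using R \<delta> by (auto simp: \<rho>_def)
  have "\<rho> \<le> R1 / (8 * ?N)" by (simp add: \<rho>_def)
  then have "\<rho> * (8 * ?N) \<le> R1" by (simp add: pos_le_divide_eq)
  then have \<rho>N: "\<rho> * ?N < R1" "\<rho> * (4 * ?N) < R1" using mult_pos_pos[OF \<rho>(1) N] by linarith+
  let ?A = "annulus R1 R4 :: (real^'n) set" and ?A' = "annulus (R1 + \<delta>) (R4 - \<delta>) :: (real^'n) set"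
  let ?b = "emeasure lborel (cball (0 :: real^'n) 1)"
  obtain K where K: "K \<ge> 0" and grad: "\<And>(u :: real^'n \<Rightarrow> real) f x. superharmonic_pair u f \<Longrightarrow> x \<in> ?A' \<Longrightarrow>
      ennreal (grad1 u x) \<le> ennreal K * ((\<integral>\<^sup>*y. ennreal (u y) * indicator ?A y)
         + riesz1 \<rho> (\<lambda>y. ennreal (f y) * indicator ?A y) x)"
    using grad1_annulus_bound[OF R \<rho>(1) \<rho>N(1) \<rho>(2), of R4] by blast
  obtain K' where K': "K' \<ge> 0" and pot: "\<And>(u :: real^'n \<Rightarrow> real) f F x. superharmonic_pair u f \<Longrightarrow> R1 \<le> norm x \<Longrightarrow>
       (\<And>y. F y \<le> ennreal (f y)) \<Longrightarrow> riesz2 \<rho> F x \<le> ennreal K' * ennreal (u x)"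
    using riesz2_le_superharmonic[OF \<rho>(1) \<rho>N(2)] by blast
  define e where "e = ennreal E"
  define k where "k = ennreal K"
  \<comment> \<open>The common bound that \<open>nn_integral_mult_riesz1_le\<close> gives for every
    term with exactly one potential.\<close>
  define q where "q = ennreal \<rho> * ?b * (2 * e)"
  define C where "C = 2 * e + k * k * (e * e * emeasure lborel ?A + e * q + e * q + ?b * (ennreal K' * e + ennreal K' * e))
      + k * (e * e + q) + k * (e * e + q)"
  have b: "?b < \<infinity>" by (rule emeasure_lborel_cball_finite)
  have Cfin: "C < \<infinity>"
    unfolding C_def q_def e_def k_def using b emeasure_annulus_finite[of R1 R4, where 'n='n]
    by (auto simp: ennreal_mult_less_top ennreal_add_eq_top)
  show ?thesis
  proof (rule that[of "enn2real C"])
    show "enn2real C \<ge> 0" by simp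
    fix u v f g :: "real^'n \<Rightarrow> real" and h
    assume sp: "superharmonic_pair u f" "superharmonic_pair v g" and [measurable]: "h \<in> borel_measurable borel"
      and hx: "\<And>x. x \<in> ?A \<Longrightarrow> ennreal (u x) \<le> h x \<and> ennreal (v x) \<le> h x \<and> ennreal (f x) \<le> h x
         \<and> ennreal (g x) \<le> h x \<and> ennreal (u x * g x) \<le> h x \<and> ennreal (v x * f x) \<le> h x"
      and hxy: "\<And>x y. x \<in> ?A \<Longrightarrow> y \<in> ?A \<Longrightarrow> ennreal (u x * g y) \<le> h x + h y \<and> ennreal (v x * f y) \<le> h x + h y"
      and hE: "(\<integral>\<^sup>*x. h x * indicator ?A x) \<le> ennreal E"
    note [measurable] = superharmonic_pair_borel[OF sp(1)] superharmonic_pair_borel[OF sp(2)]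
    have [measurable]: "f \<in> borel_measurable borel" "g \<in> borel_measurable borel"
      and pos: "\<And>x. u x \<ge> 0" "\<And>x. v x \<ge> 0" "\<And>x. f x \<ge> 0" "\<And>x. g x \<ge> 0"
      using sp unfolding superharmonic_pair_def by auto
    define H where "H x = h x * indicator ?A x" for x
    define F where "F x = ennreal (f x) * indicator ?A x" for x
    define G where "G x = ennreal (g x) * indicator ?A x" for x
    define U where "U x = ennreal (u x) * indicator ?A x" for x
    define V where "V x = ennreal (v x) * indicator ?A x" for x
    have [measurable]: "H \<in> borel_measurable borel" "F \<in> borel_measurable borel" "G \<in> borel_measurable borel"
       "U \<in> borel_measurable borel" "V \<in> borel_measurable borel"
      unfolding H_def F_def G_def U_def V_def by measurable
    have HE: "(\<integral>\<^sup>*x. H x) \<le> e" using hE unfolding H_def e_def .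
    have FH: "F x \<le> H x" "G x \<le> H x" "U x \<le> H x" "V x \<le> H x" for x
      using hx[of x] by (auto simp: F_def G_def U_def V_def H_def indicator_def)
    have UE: "(\<integral>\<^sup>*x. U x) \<le> e" "(\<integral>\<^sup>*x. V x) \<le> e"
      by (rule order_trans[OF nn_integral_mono HE], rule FH)+
    have FV: "F x * V x \<le> H x" "G x * U x \<le> H x" for x
      using hx[of x] pos by (auto simp: F_def G_def U_def V_def H_def ennreal_mult[symmetric] mult.commute indicator_def)
    have UG: "U x * G y \<le> H x + H y" "V x * F y \<le> H x + H y" for x y
      using hxy[of x y] pos by (auto simp: F_def G_def U_def V_def H_def ennreal_mult[symmetric] indicator_def)
    let ?IF = "riesz1 \<rho> F" and ?IG = "riesz1 \<rho> G"
    have gu: "ennreal (grad1 u x) \<le> k * (e + ?IF x)" and gv: "ennreal (grad1 v x) \<le> k * (e + ?IG x)" if "x \<in> ?A'" for x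
    proof -
      have "ennreal (grad1 u x) \<le> k * ((\<integral>\<^sup>*y. U y) + ?IF x)"
        using grad[OF sp(1) that] unfolding k_def U_def F_def .
      also have "\<dots> \<le> k * (e + ?IF x)" by (intro mult_left_mono add_mono UE) auto
      finally show "ennreal (grad1 u x) \<le> k * (e + ?IF x)" .
      have "ennreal (grad1 v x) \<le> k * ((\<integral>\<^sup>*y. V y) + ?IG x)"
        using grad[OF sp(2) that] unfolding k_def V_def G_def .
      also have "\<dots> \<le> k * (e + ?IG x)" by (intro mult_left_mono add_mono UE) auto
      finally show "ennreal (grad1 v x) \<le> k * (e + ?IG x)" .
    qed
    \<comment> \<open>The expansion of the integrand after inserting the gradient bounds, with u g,
      v f, u and v replaced by their majorant H. The constant C is its integral with each piece
      estimated.\<close>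
    let ?P = "\<lambda>x. 2 * H x + k * k * (e * e * indicator ?A x + e * ?IG x + e * ?IF x + ?IF x * ?IG x)
        + k * (e * H x + U x * ?IG x) + k * (e * H x + V x * ?IF x)"
    have "(\<integral>\<^sup>*x. ennreal (u x * g x + v x * f x + grad1 u x * grad1 v x + u x * grad1 v x + v x * grad1 u x)
          * indicator ?A' x) \<le> (\<integral>\<^sup>*x. ?P x)"
    proof (rule nn_integral_mono)
      fix x :: "real^'n"
      show "ennreal (u x * g x + v x * f x + grad1 u x * grad1 v x + u x * grad1 v x + v x * grad1 u x)
          * indicator ?A' x \<le> ?P x"
      proof (cases "x \<in> ?A'")
        case True
        then have A: "x \<in> ?A" using \<delta> by (auto simp: mem_annulus)
        have eqs: "U x = ennreal (u x)" "V x = ennreal (v x)" "F x = ennreal (f x)" "G x = ennreal (g x)" using A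
          by (auto simp: U_def V_def F_def G_def)
        have "ennreal (u x * g x + v x * f x + grad1 u x * grad1 v x + u x * grad1 v x + v x * grad1 u x)
          = G x * U x + F x * V x + ennreal (grad1 u x) * ennreal (grad1 v x) + U x * ennreal (grad1 v x) + V x * ennreal (grad1 u x)"
          unfolding eqs
          by (simp add: ennreal_mult pos grad1_nonneg mult_nonneg_nonneg add_nonneg_nonneg mult.commute)
        also have "\<dots> \<le> H x + H x + (k * (e + ?IF x)) * (k * (e + ?IG x)) + U x * (k * (e + ?IG x)) + V x * (k * (e + ?IF x))"
          by (intro add_mono mult_mono FV gu gv True) auto
        also have "\<dots> = H x + H x + k * k * (e * e + e * ?IG x + e * ?IF x + ?IF x * ?IG x) + k * (e * U x + U x * ?IG x) + k * (e * V x + V x * ?IF x)"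
          by (simp add: algebra_simps)
        also have "\<dots> \<le> H x + H x + k * k * (e * e * indicator ?A x + e * ?IG x + e * ?IF x + ?IF x * ?IG x) + k * (e * H x + U x * ?IG x) + k * (e * H x + V x * ?IF x)"
          using A by (intro add_mono mult_left_mono FH) auto
        finally show ?thesis using True by (simp add: mult_2)
      next
        case False then show ?thesis by simp
      qed
    qed
    also have "\<dots> = 2 * (\<integral>\<^sup>*x. H x) + k * k * (e * e * emeasure lborel ?A + e * (\<integral>\<^sup>*x. ?IG x) + e * (\<integral>\<^sup>*x. ?IF x) + (\<integral>\<^sup>*x. ?IF x * ?IG x))
        + k * (e * (\<integral>\<^sup>*x. H x) + (\<integral>\<^sup>*x. U x * ?IG x)) + k * (e * (\<integral>\<^sup>*x. H x) + (\<integral>\<^sup>*x. V x * ?IF x))"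
      by (simp add: nn_integral_add nn_integral_cmult)
    also have "\<dots> \<le> C"
    proof -
      have I: "(\<integral>\<^sup>*x. ?IG x) \<le> q" "(\<integral>\<^sup>*x. ?IF x) \<le> q"
         "(\<integral>\<^sup>*x. U x * ?IG x) \<le> q" "(\<integral>\<^sup>*x. V x * ?IF x) \<le> q"
      proof -
        have q: "X \<le> q" if "X \<le> ennreal \<rho> * ?b * (2 * (\<integral>\<^sup>*x. H x))" for X
          by (rule order_trans[OF that]) (auto simp: q_def intro!: mult_left_mono HE)
        \<comment> \<open>The weight 1 brings the plain integrals of the potentials under the same
          estimate as the mixed terms.\<close>
        have one: "1 * G y \<le> H x + H y" "1 * F y \<le> H x + H y" for x y
          using FH[of y] by (auto intro: add_increasing)
        show "(\<integral>\<^sup>*x. ?IG x) \<le> q"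
          by (rule q) (use nn_integral_mult_riesz1_le[of "\<lambda>_. 1" G H \<rho>] one \<rho> in simp)
        show "(\<integral>\<^sup>*x. ?IF x) \<le> q"
          by (rule q) (use nn_integral_mult_riesz1_le[of "\<lambda>_. 1" F H \<rho>] one \<rho> in simp)
        show "(\<integral>\<^sup>*x. U x * ?IG x) \<le> q"
          by (rule q, rule nn_integral_mult_riesz1_le) (use UG \<rho> in auto)
        show "(\<integral>\<^sup>*x. V x * ?IF x) \<le> q"
          by (rule q, rule nn_integral_mult_riesz1_le) (use UG \<rho> in auto)
      qed
      \<comment> \<open>Here the signs close the argument: \<open>riesz2 \<rho> G\<close> is at most
        a multiple of v on the annulus, F vanishes elsewhere, and f v is dominated by H. The other
        integral is symmetric.\<close>
      have R2: "(\<integral>\<^sup>*x. F x * riesz2 \<rho> G x) \<le> ennreal K' * e" "(\<integral>\<^sup>*x. G x * riesz2 \<rho> F x) \<le> ennreal K' * e"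
      proof -
        have le: "(\<integral>\<^sup>*x. A x * riesz2 \<rho> B x) \<le> ennreal K' * e"
          if B: "\<And>x. x \<in> ?A \<Longrightarrow> riesz2 \<rho> B x \<le> ennreal K' * W x"
            and A: "\<And>x. x \<notin> ?A \<Longrightarrow> A x = 0" "\<And>x. A x * W x \<le> H x" for A B W
        proof -
          have "A x * riesz2 \<rho> B x \<le> ennreal K' * H x" for x
          proof (cases "x \<in> ?A")
            case True
            then have "A x * riesz2 \<rho> B x \<le> A x * (ennreal K' * W x)" by (intro mult_left_mono B) auto
            also have "\<dots> = ennreal K' * (A x * W x)" by (simp add: mult_ac)
            also have "\<dots> \<le> ennreal K' * H x" by (intro mult_left_mono A) simp
            finally show ?thesis .
          qed (simp add: A)
          then have "(\<integral>\<^sup>*x. A x * riesz2 \<rho> B x) \<le> (\<integral>\<^sup>*x. ennreal K' * H x)"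
            by (intro nn_integral_mono)
          also have "\<dots> = ennreal K' * (\<integral>\<^sup>*x. H x)" by (rule nn_integral_cmult) measurable
          also have "\<dots> \<le> ennreal K' * e" by (intro mult_left_mono HE) simp
          finally show ?thesis .
        qed
        show "(\<integral>\<^sup>*x. F x * riesz2 \<rho> G x) \<le> ennreal K' * e"
          by (rule le[where W=V, OF _ _ FV(1)])
             (use pot[OF sp(2), of _ G] in \<open>auto simp: mem_annulus F_def G_def V_def indicator_def\<close>)
        show "(\<integral>\<^sup>*x. G x * riesz2 \<rho> F x) \<le> ennreal K' * e"
          by (rule le[where W=U, OF _ _ FV(2)])
             (use pot[OF sp(1), of _ F] in \<open>auto simp: mem_annulus F_def G_def U_def indicator_def\<close>)
      qed
      have "(\<integral>\<^sup>*x. ?IF x * ?IG x) \<le> ?b * ((\<integral>\<^sup>*x. F x * riesz2 \<rho> G x) + (\<integral>\<^sup>*x. G x * riesz2 \<rho> F x))"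
        by (rule riesz1_product_le) measurable
      also have "\<dots> \<le> ?b * (ennreal K' * e + ennreal K' * e)" by (intro mult_left_mono add_mono R2) simp
      finally have "(\<integral>\<^sup>*x. ?IF x * ?IG x) \<le> ?b * (ennreal K' * e + ennreal K' * e)" .
      then show ?thesis unfolding C_def by (intro add_mono mult_left_mono I HE) auto
    qed
    also have "C = ennreal (enn2real C)" using Cfin by simp
    finally show "(\<integral>\<^sup>*x. ennreal (u x * g x + v x * f x + grad1 u x * grad1 v x + u x * grad1 v x + v x * grad1 u x)
          * indicator ?A' x) \<le> ennreal (enn2real C)" .
  qed
qed

text \<open>
  The factors \<open>\<kappa>\<close> and \<open>\<mu>\<close> arise when u and v are rescaled. They equal 1 for the natural scaling
  at large radii, and are at most 1 when the small radii near the origin are scaled up.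
\<close>

definition weighted_HLE :: "real \<Rightarrow> real \<Rightarrow> real \<Rightarrow> real \<Rightarrow> real \<Rightarrow> real \<Rightarrow>
    (real^'n::finite \<Rightarrow> real) \<Rightarrow> (real^'n \<Rightarrow> real) \<Rightarrow> bool" where
  "weighted_HLE \<kappa> \<mu> p q a b u v \<longleftrightarrow>
     C2_on (UNIV - {0}) u \<and> continuous_on UNIV u \<and> (\<forall>x. u x \<ge> 0) \<and>
     C2_on (UNIV - {0}) v \<and> continuous_on UNIV v \<and> (\<forall>x. v x \<ge> 0) \<and>
     (\<forall>x. x \<noteq> 0 \<longrightarrow> - laplacian u x = \<kappa> * norm x powr a * v x powr p \<and>
                   - laplacian v x = \<mu> * norm x powr b * u x powr q)"

lemma weighted_HLE_of_solution:
  assumes "nonneg_HLE_solution p q a b u v" "p > 0" "q > 0"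
  shows "weighted_HLE 1 1 p q a b u v"
proof -
  have pw: "\<bar>t\<bar> powr (r - 1) * t = t powr r" if "t \<ge> 0" "r > 0" for t r :: real
  proof (cases "t = 0")
    case False
    then have "t powr (r - 1) * t powr 1 = t powr r" using that by (subst powr_add[symmetric]) simp
    then show ?thesis using that False by simp
  qed simp
  show ?thesis
    using assms pw unfolding weighted_HLE_def nonneg_HLE_solution_def HLE_solution_def
    by (simp add: mult.assoc)
qed

lemma weighted_HLE_superharmonic:
  assumes "weighted_HLE \<kappa> \<mu> p q a b u v" "\<kappa> \<ge> 0" "\<mu> \<ge> 0"
  shows "superharmonic_pair u (\<lambda>x. \<kappa> * norm x powr a * v x powr p)"
    and "superharmonic_pair v (\<lambda>x. \<mu> * norm x powr b * u x powr q)"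
proof -
  have [measurable]: "u \<in> borel_measurable borel" "v \<in> borel_measurable borel"
    using assms(1) unfolding weighted_HLE_def by (auto intro: borel_measurable_continuous_onI)
  show "superharmonic_pair u (\<lambda>x. \<kappa> * norm x powr a * v x powr p)"
    "superharmonic_pair v (\<lambda>x. \<mu> * norm x powr b * u x powr q)"
    using assms unfolding superharmonic_pair_def weighted_HLE_def by auto
qed

section \<open>Elementary inequalities for powers, and their use on annuli\<close>

lemma powr_le_sum_endpoints:
  fixes r R y a :: real
  assumes "0 < r" "r \<le> y" "y \<le> R"
  shows "y powr a \<le> r powr a + R powr a"
proof (cases "a \<ge> 0")
  case True
  then have "y powr a \<le> R powr a" using assms by (intro powr_mono2) auto
  then show ?thesis using powr_ge_zero[of r a] by linarith
next
  case False
  then have "y powr a \<le> r powr a" using assms by (intro powr_mono2') auto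
  then show ?thesis using powr_ge_zero[of R a] by linarith
qed

lemma powr_le_one_plus:
  fixes s q r :: real
  assumes "0 \<le> s" "0 \<le> q" "q \<le> r"
  shows "s powr q \<le> 1 + s powr r"
proof (cases "s \<le> 1")
  case True
  then have "s powr q \<le> 1" using assms by (intro powr_le1) auto
  then show ?thesis using powr_ge_zero[of s r] by linarith
next
  case False
  then have "s powr q \<le> s powr r" using assms by (intro powr_mono) auto
  then show ?thesis by linarith
qed

lemma mult_powr_self: "0 \<le> s \<Longrightarrow> s * s powr q = s powr (q + 1)" for s q :: real
  by (cases "s = 0") (auto simp: powr_add)

text \<open>Young's inequality without sharp constants: replace the smaller of the two numbers by
  the larger.\<close>

lemma mult_powr_le_sum:
  fixes s t q :: real
  assumes "0 \<le> s" "0 \<le> t" "0 \<le> q"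
  shows "s * t powr q \<le> s powr (q + 1) + t powr (q + 1)"
proof (cases "s \<le> t")
  case True
  then have "s * t powr q \<le> t * t powr q" by (intro mult_right_mono) auto
  then show ?thesis using assms mult_powr_self[of t q] powr_ge_zero[of s "q + 1"] by linarith
next
  case False
  then have "t powr q \<le> s powr q" using assms by (intro powr_mono2) auto
  then have "s * t powr q \<le> s * s powr q" using assms by (intro mult_left_mono) auto
  then show ?thesis using assms mult_powr_self[of s q] powr_ge_zero[of t "q + 1"] by linarith
qed

definition HLE_density :: "real \<Rightarrow> real \<Rightarrow> real \<Rightarrow> real \<Rightarrow> real \<Rightarrow> real \<Rightarrow>
    (real^'n::finite \<Rightarrow> real) \<Rightarrow> (real^'n \<Rightarrow> real) \<Rightarrow> real^'n \<Rightarrow> real" where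
  "HLE_density \<kappa> \<mu> p q a b u v x =
     u x * (\<mu> * norm x powr b * u x powr q) + v x * (\<kappa> * norm x powr a * v x powr p)"

text \<open>Collects the quantities that dominate the Pohozaev field on an annulus, as
  \<open>pohozaev_field_bound\<close> shows.\<close>

definition boundary_density :: "real \<Rightarrow> real \<Rightarrow> real \<Rightarrow> real \<Rightarrow> real \<Rightarrow> real \<Rightarrow>
    (real^'n::finite \<Rightarrow> real) \<Rightarrow> (real^'n \<Rightarrow> real) \<Rightarrow> real^'n \<Rightarrow> real" where
  "boundary_density \<kappa> \<mu> p q a b u v x = HLE_density \<kappa> \<mu> p q a b u v x
     + grad1 u x * grad1 v x + u x * grad1 v x + v x * grad1 u x"

text \<open>On an annulus the powers of the norm are bounded, so a multiple of 2 + u^(q+1) + v^(p+1)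
  serves as majorant in \<open>annulus_energy_bound\<close>. Its size depends on D but not on the
  solution, and coefficients up to 1 do not enlarge it.\<close>

lemma weighted_energy_bound:
  fixes R1 R4 \<delta> D p q a b :: real
  assumes R: "0 < R1" and \<delta>: "0 < \<delta>" and pq: "0 < p" "0 < q" and D: "0 \<le> D"
  obtains C :: real where "C \<ge> 0"
    "\<And>(u :: real^'n::finite \<Rightarrow> real) v \<kappa> \<mu>. weighted_HLE \<kappa> \<mu> p q a b u v \<Longrightarrow>
      0 \<le> \<kappa> \<Longrightarrow> \<kappa> \<le> 1 \<Longrightarrow> 0 \<le> \<mu> \<Longrightarrow> \<mu> \<le> 1 \<Longrightarrow>
      (\<integral>\<^sup>*x. ennreal (u x powr (q + 1) + v x powr (p + 1)) * indicator (annulus R1 R4) x) \<le> ennreal D \<Longrightarrow>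
      (\<integral>\<^sup>*x. ennreal (boundary_density \<kappa> \<mu> p q a b u v x)
          * indicator (annulus (R1 + \<delta>) (R4 - \<delta>)) x) \<le> ennreal C"
proof -
  let ?A = "annulus R1 R4 :: (real^'n) set"
  \<comment> \<open>The 1 is for the terms without a weight, such as u itself; the sums over the two
    radii bound both weights whatever the signs of a and b.\<close>
  define k where "k = 1 + (R1 powr a + R4 powr a) + (R1 powr b + R4 powr b)"
  have k1: "k \<ge> 1" unfolding k_def by simp
  have kw: "norm x powr a \<le> k" "norm x powr b \<le> k" if "x \<in> ?A" for x
    using powr_le_sum_endpoints[OF R, of "norm x" R4 a] powr_le_sum_endpoints[OF R, of "norm x" R4 b] that
    unfolding k_def by (auto simp: mem_annulus add_increasing2 intro: add_increasing add_increasing2)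
  define E where "E = enn2real (ennreal k * (2 * emeasure lborel ?A + ennreal D))"
  have fin: "ennreal k * (2 * emeasure lborel ?A + ennreal D) < \<infinity>"
    using emeasure_annulus_finite[of R1 R4, where 'n='n] by (auto simp: ennreal_mult_less_top ennreal_add_eq_top)
  obtain C where C: "C \<ge> 0" "\<And>(u :: real^'n \<Rightarrow> real) v f g h. superharmonic_pair u f \<Longrightarrow> superharmonic_pair v g \<Longrightarrow>
      h \<in> borel_measurable borel \<Longrightarrow>
      (\<And>x. x \<in> ?A \<Longrightarrow> ennreal (u x) \<le> h x \<and> ennreal (v x) \<le> h x \<and> ennreal (f x) \<le> h x
         \<and> ennreal (g x) \<le> h x \<and> ennreal (u x * g x) \<le> h x \<and> ennreal (v x * f x) \<le> h x) \<Longrightarrow>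
      (\<And>x y. x \<in> ?A \<Longrightarrow> y \<in> ?A \<Longrightarrow>
         ennreal (u x * g y) \<le> h x + h y \<and> ennreal (v x * f y) \<le> h x + h y) \<Longrightarrow>
      (\<integral>\<^sup>*x. h x * indicator ?A x) \<le> ennreal E \<Longrightarrow>
      (\<integral>\<^sup>*x. ennreal (u x * g x + v x * f x + grad1 u x * grad1 v x + u x * grad1 v x + v x * grad1 u x)
          * indicator (annulus (R1 + \<delta>) (R4 - \<delta>)) x) \<le> ennreal C"
    using annulus_energy_bound[OF R \<delta>, of R4 E] by blast
  show ?thesis
  proof (rule that[OF C(1)])
    fix u v :: "real^'n \<Rightarrow> real" and \<kappa> \<mu>
    assume sol: "weighted_HLE \<kappa> \<mu> p q a b u v" and \<kappa>: "0 \<le> \<kappa>" "\<kappa> \<le> 1" and \<mu>: "0 \<le> \<mu>" "\<mu> \<le> 1"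
      and int: "(\<integral>\<^sup>*x. ennreal (u x powr (q + 1) + v x powr (p + 1)) * indicator ?A x) \<le> ennreal D"
    let ?f = "\<lambda>x. \<kappa> * norm x powr a * v x powr p" and ?g = "\<lambda>x. \<mu> * norm x powr b * u x powr q"
    have u0: "\<And>x. u x \<ge> 0" and v0: "\<And>x. v x \<ge> 0" using sol unfolding weighted_HLE_def by auto
    have [measurable]: "u \<in> borel_measurable borel" "v \<in> borel_measurable borel"
      using sol unfolding weighted_HLE_def by (auto intro: borel_measurable_continuous_onI)
    \<comment> \<open>The constant pays for replacing lower powers of u and v by the powers q + 1
      and p + 1.\<close>
    define m where "m x = 2 + (u x powr (q + 1) + v x powr (p + 1))" for x
    define h where "h x = ennreal (k * m x)" for x
    have [measurable]: "h \<in> borel_measurable borel" unfolding h_def m_def by measurable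
    have m: "u x \<le> m x" "v x \<le> m x" "u x powr q \<le> m x" "v x powr p \<le> m x"
       "u x powr (q + 1) \<le> m x" "v x powr (p + 1) \<le> m x" "m x \<ge> 0" for x
      using powr_le_one_plus[OF u0[of x], of 1 "q + 1"] powr_le_one_plus[OF v0[of x], of 1 "p + 1"]
        powr_le_one_plus[OF u0[of x], of q "q + 1"] powr_le_one_plus[OF v0[of x], of p "p + 1"]
        powr_ge_zero[of "u x" "q + 1"] powr_ge_zero[of "v x" "p + 1"] pq u0[of x] v0[of x]
      unfolding m_def by auto
    have wt: "\<mu> * norm x powr b * s \<le> k * t" "\<kappa> * norm x powr a * s \<le> k * t" if "x \<in> ?A" "0 \<le> s" "s \<le> t" for x s t
    proof -
      have "\<mu> * norm x powr b \<le> 1 * k" "\<kappa> * norm x powr a \<le> 1 * k"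
        using kw[OF that(1)] \<mu> \<kappa> by (intro mult_mono; simp)+
      then show "\<mu> * norm x powr b * s \<le> k * t" "\<kappa> * norm x powr a * s \<le> k * t"
        using that k1 by (intro mult_mono; simp)+
    qed
    have le_k: "s \<le> k * t" if "s \<le> t" "0 \<le> t" for s t :: real
      using that k1 mult_right_mono[OF k1, of t] by linarith
    have hx: "ennreal (u x) \<le> h x \<and> ennreal (v x) \<le> h x \<and> ennreal (?f x) \<le> h x
         \<and> ennreal (?g x) \<le> h x \<and> ennreal (u x * ?g x) \<le> h x \<and> ennreal (v x * ?f x) \<le> h x" if x: "x \<in> ?A" for x
    proof -
      have "u x * ?g x = \<mu> * norm x powr b * u x powr (q + 1)" "v x * ?f x = \<kappa> * norm x powr a * v x powr (p + 1)"
        using mult_powr_self[OF u0[of x], of q] mult_powr_self[OF v0[of x], of p] by (simp_all add: mult_ac)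
      then have "u x * ?g x \<le> k * m x" "v x * ?f x \<le> k * m x"
        using wt(1)[OF x powr_ge_zero m(5)] wt(2)[OF x powr_ge_zero m(6)] by (simp_all only:)
      moreover have "u x \<le> k * m x" "v x \<le> k * m x" by (intro le_k m)+
      moreover have "?f x \<le> k * m x" "?g x \<le> k * m x" by (intro wt[OF x] m powr_ge_zero)+
      ultimately show ?thesis unfolding h_def by (intro conjI ennreal_leI)
    qed
    have hxy: "ennreal (u x * ?g y) \<le> h x + h y \<and> ennreal (v x * ?f y) \<le> h x + h y" if "x \<in> ?A" "y \<in> ?A" for x y
    proof -
      have "u x * ?g y = \<mu> * norm y powr b * (u x * u y powr q)" by (simp add: mult_ac)
      also have "\<dots> \<le> k * (m x + m y)"
        using mult_powr_le_sum[OF u0[of x] u0[of y], of q] pq u0 m(5)[of x] m(5)[of y] by (intro wt that) auto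
      finally have 1: "u x * ?g y \<le> k * (m x + m y)" .
      have "v x * ?f y = \<kappa> * norm y powr a * (v x * v y powr p)" by (simp add: mult_ac)
      also have "\<dots> \<le> k * (m x + m y)"
        using mult_powr_le_sum[OF v0[of x] v0[of y], of p] pq v0 m(6)[of x] m(6)[of y] by (intro wt that) auto
      finally have 2: "v x * ?f y \<le> k * (m x + m y)" .
      have "h x + h y = ennreal (k * (m x + m y))"
        unfolding h_def using k1 m(7) by (simp add: distrib_left ennreal_plus[symmetric] del: ennreal_plus)
      then show ?thesis using 1 2 by (simp add: ennreal_leI)
    qed
    have hE: "(\<integral>\<^sup>*x. h x * indicator ?A x) \<le> ennreal E"
    proof -
      have "(\<integral>\<^sup>*x. h x * indicator ?A x)
        = (\<integral>\<^sup>*x. ennreal k * (2 * indicator ?A x + ennreal (u x powr (q + 1) + v x powr (p + 1)) * indicator ?A x))"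
      proof (rule nn_integral_cong)
        fix x
        have "h x = ennreal k * (2 + ennreal (u x powr (q + 1) + v x powr (p + 1)))"
        proof -
          have "ennreal (m x) = ennreal 2 + ennreal (u x powr (q + 1) + v x powr (p + 1))"
            unfolding m_def by (rule ennreal_plus) auto
          moreover have "h x = ennreal k * ennreal (m x)"
            unfolding h_def using k1 m(7) by (intro ennreal_mult) auto
          ultimately show ?thesis by simp
        qed
        then show "h x * indicator ?A x = ennreal k * (2 * indicator ?A x + ennreal (u x powr (q + 1) + v x powr (p + 1)) * indicator ?A x)"
          by (simp add: indicator_def)
      qed
      also have "\<dots> = ennreal k * (2 * emeasure lborel ?A + (\<integral>\<^sup>*x. ennreal (u x powr (q + 1) + v x powr (p + 1)) * indicator ?A x))"
        by (subst nn_integral_cmult, measurable, subst nn_integral_add, measurable, subst nn_integral_cmult) auto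
      also have "\<dots> \<le> ennreal k * (2 * emeasure lborel ?A + ennreal D)"
        by (intro mult_left_mono add_left_mono int) simp
      also have "\<dots> = ennreal E" unfolding E_def using fin by simp
      finally show ?thesis .
    qed
    show "(\<integral>\<^sup>*x. ennreal (boundary_density \<kappa> \<mu> p q a b u v x)
          * indicator (annulus (R1 + \<delta>) (R4 - \<delta>)) x) \<le> ennreal C"
      unfolding boundary_density_def HLE_density_def
      by (rule C(2)[OF weighted_HLE_superharmonic[OF sol \<kappa>(1) \<mu>(1)] _ hx hxy hE]) auto
  qed
qed

subsection \<open>The Pohozaev identity\<close>

text \<open>With the absolute value the power is C1 on the whole line, so the potential terms can be
  differentiated at zeros of u and v too. At 0 the difference quotient has size
  \<open>\<bar>h\<bar> powr (r - 1)\<close>, which tends to 0.\<close>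

lemma has_real_derivative_abs_powr:
  fixes r :: real
  assumes r: "r > 1"
  shows "((\<lambda>t. \<bar>t\<bar> powr r) has_real_derivative r * (sgn t * \<bar>t\<bar> powr (r - 1))) (at t)"
proof -
  consider "t > 0" | "t < 0" | "t = 0" by linarith
  then show ?thesis
  proof cases
    case 1
    have "((\<lambda>t. t powr r) has_real_derivative r * t powr (r - 1)) (at t)"
      by (rule has_real_derivative_powr[OF 1])
    then have "((\<lambda>t. \<bar>t\<bar> powr r) has_real_derivative r * t powr (r - 1)) (at t)"
      by (rule has_field_derivative_transform_within_open[where S="{0<..}"]) (use 1 in auto)
    then show ?thesis using 1 by simp
  next
    case 2
    then have "- t > 0" by simp
    from DERIV_chain2[OF has_real_derivative_powr[OF this, of r] DERIV_minus[OF DERIV_ident]]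
    have "((\<lambda>t. (- t) powr r) has_real_derivative r * (- t) powr (r - 1) * - 1) (at t)" .
    then have "((\<lambda>t. \<bar>t\<bar> powr r) has_real_derivative r * (- t) powr (r - 1) * - 1) (at t)"
      by (rule has_field_derivative_transform_within_open[where S="{..<0}"]) (use 2 in auto)
    then show ?thesis using 2 by simp
  next
    case 3
    have "((\<lambda>h. \<bar>h\<bar> powr r / h) \<longlongrightarrow> 0) (at (0::real))"
    proof (rule Lim_null_comparison)
      show "\<forall>\<^sub>F h in at 0. norm (\<bar>h\<bar> powr r / h) \<le> \<bar>h\<bar> powr (r - 1)"
        by (rule always_eventually) (auto simp: powr_diff)
      have "((\<lambda>h. \<bar>h\<bar> powr (r - 1)) \<longlongrightarrow> \<bar>0\<bar> powr (r - 1)) (at (0::real))"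
        by (intro tendsto_powr' tendsto_intros) (use r in auto)
      then show "((\<lambda>h. \<bar>h\<bar> powr (r - 1)) \<longlongrightarrow> 0) (at (0::real))" using r by simp
    qed
    then show ?thesis using 3 r unfolding DERIV_def by simp
  qed
qed

text \<open>Splitting into powers of the positive and of the negative part removes the jump of
  \<open>sgn\<close> at 0.\<close>

lemma continuous_on_sgn_abs_powr:
  fixes r :: real
  assumes "r > 0"
  shows "continuous_on UNIV (\<lambda>t. sgn t * \<bar>t\<bar> powr r)"
proof -
  have "continuous_on UNIV (\<lambda>t. max t 0 powr r - max (- t) 0 powr r)"
    by (intro continuous_on_diff continuous_on_powr' continuous_intros) (use assms in auto)
  then show ?thesis
    by (rule continuous_on_eq) (use assms in \<open>auto simp: sgn_if max_def\<close>)
qed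

lemma norm_powr_eq: "norm x powr b = (x \<bullet> x) powr (b / 2)" for x :: "'a::real_inner"
proof (cases "x = 0")
  case False
  then have eq: "x \<bullet> x = norm x powr 2" by (simp add: power2_norm_eq_inner)
  show ?thesis unfolding eq powr_powr by simp
qed simp

lemma C1_on_norm_powr: "C1_on (UNIV - {0}) (\<lambda>x :: real^'n::finite. norm x powr b)"
  unfolding norm_powr_eq
proof (rule C1_on_chain_real[OF C1_on_inner_self, where T="{0<..}"])
  show "x \<bullet> x \<in> {0<..}" if "x \<in> UNIV - {0}" for x :: "real^'n" using that by simp
  show "((\<lambda>s. s powr (b / 2)) has_real_derivative b / 2 * y powr (b / 2 - 1)) (at y)" if "y \<in> {0<..}" for y
    using that by (intro has_real_derivative_powr) auto
  show "continuous_on {0<..} (\<lambda>y. b / 2 * y powr (b / 2 - 1))"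
    by (intro continuous_intros) auto
qed

lemma partial_deriv_norm_powr:
  fixes x :: "real^'n::finite"
  assumes "x \<noteq> 0"
  shows "pd i (\<lambda>x. norm x powr b) x = b * norm x powr (b - 2) * x $ i"
proof -
  have "x \<bullet> x > 0" using assms by simp
  from differentiable_chain_real(2)[OF differentiable_inner_self has_real_derivative_powr[OF this]]
  have "pd i (\<lambda>x. norm x powr b) x = b / 2 * (x \<bullet> x) powr (b / 2 - 1) * (2 * x $ i)"
    unfolding norm_powr_eq partial_deriv_inner_self .
  also have "(x \<bullet> x) powr (b / 2 - 1) = norm x powr (b - 2)"
    unfolding norm_powr_eq by (simp add: diff_divide_distrib)
  finally show ?thesis by simp
qed

lemma C1_on_abs_powr:
  assumes "C1_on S u" "(q::real) > 0"
  shows "C1_on S (\<lambda>x. \<bar>u x\<bar> powr (q + 1))"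
proof (rule C1_on_chain_real[OF assms(1), where T=UNIV and h="\<lambda>t. \<bar>t\<bar> powr (q + 1)"])
  show "((\<lambda>t. \<bar>t\<bar> powr (q + 1)) has_real_derivative (q + 1) * (sgn y * \<bar>y\<bar> powr q)) (at y)" for y
    using has_real_derivative_abs_powr[of "q + 1" y] assms(2) by simp
  show "continuous_on UNIV (\<lambda>y. (q + 1) * (sgn y * \<bar>y\<bar> powr q))"
    by (intro continuous_on_mult continuous_on_const continuous_on_sgn_abs_powr assms(2))
qed simp

lemma partial_deriv_abs_powr:
  assumes "u differentiable (at x)" "(q::real) > 0" "u x \<ge> 0"
  shows "pd i (\<lambda>x. \<bar>u x\<bar> powr (q + 1)) x = (q + 1) * u x powr q * pd i u x"
proof -
  have "((\<lambda>t. \<bar>t\<bar> powr (q + 1)) has_real_derivative (q + 1) * (sgn (u x) * \<bar>u x\<bar> powr q)) (at (u x))"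
    using has_real_derivative_abs_powr[of "q + 1" "u x"] assms(2) by simp
  from differentiable_chain_real(2)[OF assms(1) this, of i]
  show ?thesis using assms(3) by (cases "u x = 0") auto
qed

text \<open>The Noether current of dilations for the Lagrangian Du.Dv - W, whose Euler-Lagrange
  equations are the system: W is the potential with derivatives g in u and f in v. The variations
  are x.Du + \<alpha>2 u and x.Dv + \<alpha>1 v, with \<alpha>1 and \<alpha>2 still to be
  chosen.\<close>

definition pohozaev_field :: "real \<Rightarrow> real \<Rightarrow> real \<Rightarrow> real \<Rightarrow> real \<Rightarrow> real \<Rightarrow> real \<Rightarrow> real \<Rightarrow>
    (real^'n::finite \<Rightarrow> real) \<Rightarrow> (real^'n \<Rightarrow> real) \<Rightarrow> 'n \<Rightarrow> real^'n \<Rightarrow> real" where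
  "pohozaev_field \<kappa> \<mu> p q a b \<alpha>1 \<alpha>2 u v i x =
     x $ i * ((\<Sum>j\<in>UNIV. pd j u x * pd j v x)
        - (\<mu> / (q + 1) * (norm x powr b * \<bar>u x\<bar> powr (q + 1)) + \<kappa> / (p + 1) * (norm x powr a * \<bar>v x\<bar> powr (p + 1))))
     - (\<Sum>j\<in>UNIV. x $ j * pd j u x) * pd i v x
     - (\<Sum>j\<in>UNIV. x $ j * pd j v x) * pd i u x
     - \<alpha>2 * (u x * pd i v x) - \<alpha>1 * (v x * pd i u x)"

lemma C1_on_differentiable: "C1_on S f \<Longrightarrow> x \<in> S \<Longrightarrow> f differentiable (at x)"
  unfolding C1_on_def by blast

lemma C1_on_pohozaev_field:
  assumes "C2_on (UNIV - {0}) u" "C2_on (UNIV - {0}) v" "p > 0" "q > 0"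
  shows "C1_on (UNIV - {0}) (pohozaev_field \<kappa> \<mu> p q a b \<alpha>1 \<alpha>2 u v i)"
proof -
  have C1: "C1_on (UNIV - {0}) u" "C1_on (UNIV - {0}) v"
    "\<And>j. C1_on (UNIV - {0}) (pd j u)" "\<And>j. C1_on (UNIV - {0}) (pd j v)"
    using assms(1,2) unfolding C2_on_def by blast+
  show ?thesis
    unfolding pohozaev_field_def
    by (intro C1_on_diff C1_on_add C1_on_mult C1_on_component C1_on_sum C1_on_const
        C1_on_norm_powr C1_on_abs_powr C1 assms(3,4)) simp_all
qed

text \<open>With X = x this expands x.D(Du.Dv); by symmetry of the Hessians its two parts are those
  that arise from differentiating x.Du and x.Dv, and they cancel in the divergence.\<close>

lemma sum_hessian_symmetric:
  fixes X A B :: "'n::finite \<Rightarrow> real"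
  assumes "\<And>i j. U i j = U j i" "\<And>i j. V i j = V j i"
  shows "(\<Sum>i\<in>UNIV. X i * (\<Sum>j\<in>UNIV. A j * V i j + U i j * B j))
     = (\<Sum>i\<in>UNIV. (\<Sum>j\<in>UNIV. X j * U i j) * B i) + (\<Sum>i\<in>UNIV. (\<Sum>j\<in>UNIV. X j * V i j) * A i)"
proof -
  have "(\<Sum>i\<in>UNIV. X i * (\<Sum>j\<in>UNIV. A j * V i j + U i j * B j))
    = (\<Sum>i\<in>UNIV. \<Sum>j\<in>UNIV. X i * U i j * B j) + (\<Sum>i\<in>UNIV. \<Sum>j\<in>UNIV. X i * V i j * A j)"
    by (simp add: sum_distrib_left sum.distrib distrib_left mult_ac)
  also have "(\<Sum>i\<in>UNIV. \<Sum>j\<in>UNIV. X i * U i j * B j) = (\<Sum>j\<in>UNIV. \<Sum>i\<in>UNIV. X i * U i j * B j)"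
    by (rule sum.swap)
  also have "(\<Sum>i\<in>UNIV. \<Sum>j\<in>UNIV. X i * V i j * A j) = (\<Sum>j\<in>UNIV. \<Sum>i\<in>UNIV. X i * V i j * A j)"
    by (rule sum.swap)
  finally show ?thesis
    by (simp add: sum_distrib_right) (simp add: assms(1)[of _ "_ :: 'n"] assms)
qed

text \<open>Hessian terms cancel by symmetry, and (x.Du) g and (x.Dv) f cancel against the
  derivative of the potential. The coefficient of Du.Dv is N - 2 - \<alpha>1 - \<alpha>2, which is
  0, so only u g and v f survive.\<close>

lemma pohozaev_divergence:
  fixes u v :: "real^'n::finite \<Rightarrow> real"
  assumes sol: "weighted_HLE \<kappa> \<mu> p q a b u v" and pq: "p > 0" "q > 0"
    and \<alpha>: "\<alpha>1 + \<alpha>2 = real CARD('n) - 2" and x: "x \<noteq> 0"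
  shows "(\<Sum>i\<in>UNIV. pd i (pohozaev_field \<kappa> \<mu> p q a b \<alpha>1 \<alpha>2 u v i) x)
     = - (((real CARD('n) + b) / (q + 1) - \<alpha>2) * (u x * (\<mu> * norm x powr b * u x powr q))
        + ((real CARD('n) + a) / (p + 1) - \<alpha>1) * (v x * (\<kappa> * norm x powr a * v x powr p)))"
proof -
  have C2: "C2_on (UNIV - {0}) u" "C2_on (UNIV - {0}) v" and u0: "u x \<ge> 0" and v0: "v x \<ge> 0"
    and eq: "- laplacian u x = \<kappa> * norm x powr a * v x powr p" "- laplacian v x = \<mu> * norm x powr b * u x powr q"
    using sol x unfolding weighted_HLE_def by auto
  have xS: "x \<in> UNIV - {0}" and op: "open (UNIV - {0 :: real^'n})" using x by auto
  have C1: "C1_on (UNIV - {0}) u" "C1_on (UNIV - {0}) v"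
    "\<And>j. C1_on (UNIV - {0}) (pd j u)" "\<And>j. C1_on (UNIV - {0}) (pd j v)"
    using C2 unfolding C2_on_def by blast+
  note d = C1[THEN C1_on_differentiable, OF xS]
  let ?W1 = "\<lambda>x. norm x powr b * \<bar>u x\<bar> powr (q + 1)" and ?W2 = "\<lambda>x. norm x powr a * \<bar>v x\<bar> powr (p + 1)"
  have CW: "C1_on (UNIV - {0}) ?W1" "C1_on (UNIV - {0}) ?W2"
    by (intro C1_on_mult C1_on_norm_powr C1_on_abs_powr C1 pq)+
  note dW = CW[THEN C1_on_differentiable, OF xS]
  define U where "U i = pd i u x" for i
  define V where "V i = pd i v x" for i
  define UU where "UU i j = pd i (pd j u) x" for i j
  define VV where "VV i j = pd i (pd j v) x" for i j
  define f where "f = \<kappa> * norm x powr a * v x powr p"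
  define g where "g = \<mu> * norm x powr b * u x powr q"
  define XU where "XU = (\<Sum>j\<in>UNIV. x $ j * U j)"
  define XV where "XV = (\<Sum>j\<in>UNIV. x $ j * V j)"
  define P where "P = (\<Sum>j\<in>UNIV. U j * V j)"
  define W1 where "W1 = ?W1 x"
  define W2 where "W2 = ?W2 x"
  have W: "\<mu> * W1 = u x * g" "\<kappa> * W2 = v x * f"
    using mult_powr_self[OF u0, of q] mult_powr_self[OF v0, of p] u0 v0
    by (simp_all add: W1_def W2_def f_def g_def mult_ac)
  have dW1: "pd i ?W1 x = norm x powr b * ((q + 1) * u x powr q * U i) + b * norm x powr (b - 2) * x $ i * u x powr (q + 1)" for i
    using C1_on_differentiable[OF C1_on_norm_powr xS] C1_on_differentiable[OF C1_on_abs_powr[OF C1(1) pq(2)] xS] d(1) u0 pq x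
    by (simp add: partial_deriv_mult partial_deriv_norm_powr partial_deriv_abs_powr U_def)
  have dW2: "pd i ?W2 x = norm x powr a * ((p + 1) * v x powr p * V i) + a * norm x powr (a - 2) * x $ i * v x powr (p + 1)" for i
    using C1_on_differentiable[OF C1_on_norm_powr xS] C1_on_differentiable[OF C1_on_abs_powr[OF C1(2) pq(1)] xS] d(2) v0 pq x
    by (simp add: partial_deriv_mult partial_deriv_norm_powr partial_deriv_abs_powr V_def)
  have nrm: "norm x powr (c - 2) * (\<Sum>i\<in>UNIV. x $ i * x $ i) = norm x powr c" for c
  proof -
    have eq: "(\<Sum>i\<in>UNIV. x $ i * x $ i) = norm x powr 2"
      using x by (simp add: power2_norm_eq_inner inner_vec_def)
    show ?thesis unfolding eq powr_add[symmetric] by simp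
  qed
  \<comment> \<open>Euler's relation for the homogeneous weight |x|^b yields the term b W1; the rest
    is the chain rule in u. The same holds for W2 below.\<close>
  have XW1: "(\<Sum>i\<in>UNIV. x $ i * pd i ?W1 x) = (q + 1) * (norm x powr b * u x powr q) * XU + b * W1"
  proof -
    have "(\<Sum>i\<in>UNIV. x $ i * pd i ?W1 x)
       = (q + 1) * (norm x powr b * u x powr q) * XU + b * (norm x powr (b - 2) * (\<Sum>i\<in>UNIV. x $ i * x $ i)) * u x powr (q + 1)"
      unfolding dW1 XU_def by (simp add: sum.distrib sum_distrib_left sum_distrib_right algebra_simps)
    then show ?thesis unfolding nrm W1_def using u0 by simp
  qed
  have XW2: "(\<Sum>i\<in>UNIV. x $ i * pd i ?W2 x) = (p + 1) * (norm x powr a * v x powr p) * XV + a * W2"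
  proof -
    have "(\<Sum>i\<in>UNIV. x $ i * pd i ?W2 x)
       = (p + 1) * (norm x powr a * v x powr p) * XV + a * (norm x powr (a - 2) * (\<Sum>i\<in>UNIV. x $ i * x $ i)) * v x powr (p + 1)"
      unfolding dW2 XV_def by (simp add: sum.distrib sum_distrib_left sum_distrib_right algebra_simps)
    then show ?thesis unfolding nrm W2_def using v0 by simp
  qed
  have sym: "UU i j = UU j i" "VV i j = VV j i" for i j
    unfolding UU_def VV_def by (rule partial_deriv_commute[OF C2(1) op xS] partial_deriv_commute[OF C2(2) op xS])+
  have lap: "(\<Sum>i\<in>UNIV. UU i i) = - f" "(\<Sum>i\<in>UNIV. VV i i) = - g"
    using eq unfolding UU_def VV_def laplacian_def f_def g_def by linarith+
  have D: "pd i (pohozaev_field \<kappa> \<mu> p q a b \<alpha>1 \<alpha>2 u v i) x =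
      (P - (\<mu> / (q + 1) * W1 + \<kappa> / (p + 1) * W2))
      + x $ i * ((\<Sum>j\<in>UNIV. U j * VV i j + UU i j * V j)
          - (\<mu> / (q + 1) * pd i ?W1 x + \<kappa> / (p + 1) * pd i ?W2 x))
      - (XU * VV i i + (U i + (\<Sum>j\<in>UNIV. x $ j * UU i j)) * V i)
      - (XV * UU i i + (V i + (\<Sum>j\<in>UNIV. x $ j * VV i j)) * U i)
      - \<alpha>2 * (u x * VV i i + U i * V i) - \<alpha>1 * (v x * UU i i + V i * U i)" for i
  proof -
    let ?S = "\<lambda>x. (\<Sum>j\<in>UNIV. pd j u x * pd j v x) - (\<mu> / (q + 1) * ?W1 x + \<kappa> / (p + 1) * ?W2 x)"
    let ?XU = "\<lambda>x. \<Sum>j\<in>UNIV. x $ j * pd j u x" and ?XV = "\<lambda>x. \<Sum>j\<in>UNIV. x $ j * pd j v x"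
    have CS: "C1_on (UNIV - {0}) ?S"
      by (intro C1_on_diff C1_on_add C1_on_mult C1_on_sum C1_on_const CW C1) simp
    have CX: "C1_on (UNIV - {0}) ?XU" "C1_on (UNIV - {0}) ?XV"
      by (intro C1_on_sum C1_on_mult C1_on_component C1; simp)+
    note dS = CS[THEN C1_on_differentiable, OF xS] and dX = CX[THEN C1_on_differentiable, OF xS]
    have pS: "pd i ?S x = (\<Sum>j\<in>UNIV. U j * VV i j + UU i j * V j)
          - (\<mu> / (q + 1) * pd i ?W1 x + \<kappa> / (p + 1) * pd i ?W2 x)"
    proof -
      have "pd i ?S x = pd i (\<lambda>x. \<Sum>j\<in>UNIV. pd j u x * pd j v x) x
         - pd i (\<lambda>x. \<mu> / (q + 1) * ?W1 x + \<kappa> / (p + 1) * ?W2 x) x"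
        by (rule partial_deriv_diff; rule C1_on_differentiable[OF _ xS]; intro CW C1_on_add C1_on_sum C1_on_mult C1_on_const C1; simp)
      also have "pd i (\<lambda>x. \<mu> / (q + 1) * ?W1 x + \<kappa> / (p + 1) * ?W2 x) x
         = \<mu> / (q + 1) * pd i ?W1 x + \<kappa> / (p + 1) * pd i ?W2 x"
        by (simp only: partial_deriv_add[OF differentiable_mult[OF differentiable_const dW(1)] differentiable_mult[OF differentiable_const dW(2)]]
              partial_deriv_cmult[OF dW(1)] partial_deriv_cmult[OF dW(2)])
      also have "pd i (\<lambda>x. \<Sum>j\<in>UNIV. pd j u x * pd j v x) x = (\<Sum>j\<in>UNIV. U j * VV i j + UU i j * V j)"
        by (subst partial_deriv_sum) (auto intro!: differentiable_mult d simp: partial_deriv_mult[OF d(3) d(4)] U_def V_def UU_def VV_def)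
      finally show ?thesis .
    qed
    have pXU: "pd i ?XU x = U i + (\<Sum>j\<in>UNIV. x $ j * UU i j)"
    proof -
      have "pd i ?XU x = (\<Sum>j\<in>UNIV. x $ j * UU i j + (if i = j then U j else 0))"
        by (subst partial_deriv_sum) (auto intro!: differentiable_mult d sum.cong simp: partial_deriv_mult[OF differentiable_component d(3)] partial_deriv_component U_def UU_def)
      then show ?thesis by (simp add: sum.distrib)
    qed
    have pXV: "pd i ?XV x = V i + (\<Sum>j\<in>UNIV. x $ j * VV i j)"
    proof -
      have "pd i ?XV x = (\<Sum>j\<in>UNIV. x $ j * VV i j + (if i = j then V j else 0))"
        by (subst partial_deriv_sum) (auto intro!: differentiable_mult d sum.cong simp: partial_deriv_mult[OF differentiable_component d(4)] partial_deriv_component V_def VV_def)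
      then show ?thesis by (simp add: sum.distrib)
    qed
    have "pohozaev_field \<kappa> \<mu> p q a b \<alpha>1 \<alpha>2 u v i = (\<lambda>x. x $ i * ?S x - ?XU x * pd i v x
        - ?XV x * pd i u x - \<alpha>2 * (u x * pd i v x) - \<alpha>1 * (v x * pd i u x))"
      unfolding pohozaev_field_def by (rule ext) simp
    moreover have t: "(\<lambda>x. x $ i * ?S x) differentiable at x" "(\<lambda>x. ?XU x * pd i v x) differentiable at x"
       "(\<lambda>x. ?XV x * pd i u x) differentiable at x"
       "(\<lambda>x. u x * pd i v x) differentiable at x" "(\<lambda>x. v x * pd i u x) differentiable at x"
      by (intro differentiable_mult differentiable_component dS dX d)+
    moreover have t2: "(\<lambda>x. \<alpha>2 * (u x * pd i v x)) differentiable at x" "(\<lambda>x. \<alpha>1 * (v x * pd i u x)) differentiable at x"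
      by (intro differentiable_mult differentiable_const d)+
    ultimately have "pd i (pohozaev_field \<kappa> \<mu> p q a b \<alpha>1 \<alpha>2 u v i) x
      = pd i (\<lambda>x. x $ i * ?S x) x - pd i (\<lambda>x. ?XU x * pd i v x) x
        - pd i (\<lambda>x. ?XV x * pd i u x) x - \<alpha>2 * pd i (\<lambda>x. u x * pd i v x) x
        - \<alpha>1 * pd i (\<lambda>x. v x * pd i u x) x"
      by (simp only: partial_deriv_diff partial_deriv_cmult differentiable_diff)
    also have "pd i (\<lambda>x. x $ i * ?S x) x = x $ i * pd i ?S x + ?S x"
      by (simp only: partial_deriv_mult[OF differentiable_component dS] partial_deriv_component refl if_True mult_1_left)
    also have "pd i (\<lambda>x. ?XU x * pd i v x) x = XU * VV i i + pd i ?XU x * V i"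
      by (simp add: partial_deriv_mult[OF dX(1) d(4)] XU_def U_def V_def VV_def)
    also have "pd i (\<lambda>x. ?XV x * pd i u x) x = XV * UU i i + pd i ?XV x * U i"
      by (simp add: partial_deriv_mult[OF dX(2) d(3)] XV_def U_def V_def UU_def)
    also have "pd i (\<lambda>x. u x * pd i v x) x = u x * VV i i + U i * V i"
      by (simp add: partial_deriv_mult[OF d(1) d(4)] U_def V_def VV_def)
    also have "pd i (\<lambda>x. v x * pd i u x) x = v x * UU i i + V i * U i"
      by (simp add: partial_deriv_mult[OF d(2) d(3)] U_def V_def UU_def)
    finally show ?thesis
      unfolding pS pXU pXV by (simp add: P_def W1_def W2_def U_def V_def)
  qed
  have "(\<Sum>i\<in>UNIV. pd i (pohozaev_field \<kappa> \<mu> p q a b \<alpha>1 \<alpha>2 u v i) x) =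
      real CARD('n) * (P - (\<mu> / (q + 1) * W1 + \<kappa> / (p + 1) * W2))
      + ((\<Sum>i\<in>UNIV. x $ i * (\<Sum>j\<in>UNIV. U j * VV i j + UU i j * V j))
          - (\<mu> / (q + 1) * (\<Sum>i\<in>UNIV. x $ i * pd i ?W1 x) + \<kappa> / (p + 1) * (\<Sum>i\<in>UNIV. x $ i * pd i ?W2 x)))
      - (XU * (\<Sum>i\<in>UNIV. VV i i) + (P + (\<Sum>i\<in>UNIV. (\<Sum>j\<in>UNIV. x $ j * UU i j) * V i)))
      - (XV * (\<Sum>i\<in>UNIV. UU i i) + (P + (\<Sum>i\<in>UNIV. (\<Sum>j\<in>UNIV. x $ j * VV i j) * U i)))
      - \<alpha>2 * (u x * (\<Sum>i\<in>UNIV. VV i i) + P) - \<alpha>1 * (v x * (\<Sum>i\<in>UNIV. UU i i) + P)"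
  proof -
    have PV: "(\<Sum>i\<in>UNIV. V i * U i) = P" unfolding P_def by (simp add: mult.commute)
    have "(\<Sum>i\<in>UNIV. x $ i * (\<mu> / (q + 1) * pd i ?W1 x + \<kappa> / (p + 1) * pd i ?W2 x))
       = \<mu> / (q + 1) * (\<Sum>i\<in>UNIV. x $ i * pd i ?W1 x) + \<kappa> / (p + 1) * (\<Sum>i\<in>UNIV. x $ i * pd i ?W2 x)"
      unfolding distrib_left sum.distrib sum_distrib_left by (simp only: mult_ac)
    then show ?thesis
      unfolding D
      by (simp only: sum.distrib sum_subtractf sum_distrib_left[symmetric] distrib_right right_diff_distrib PV P_def[symmetric]
        sum_constant card_UNIV of_nat_id)
         (simp add: algebra_simps)
  qed
  also have "\<dots> = real CARD('n) * (P - (\<mu> / (q + 1) * W1 + \<kappa> / (p + 1) * W2))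
      - (\<mu> / (q + 1) * ((q + 1) * (norm x powr b * u x powr q) * XU + b * W1)
        + \<kappa> / (p + 1) * ((p + 1) * (norm x powr a * v x powr p) * XV + a * W2))
      + XU * g - P + XV * f - P + \<alpha>2 * (u x * g) - \<alpha>2 * P + \<alpha>1 * (v x * f) - \<alpha>1 * P"
    unfolding XW1 XW2 lap sum_hessian_symmetric[OF sym] by (simp add: algebra_simps)
  also have "\<mu> / (q + 1) * ((q + 1) * (norm x powr b * u x powr q) * XU + b * W1) = g * XU + b / (q + 1) * (\<mu> * W1)"
    using pq unfolding g_def by (simp add: field_simps)
  also have "\<kappa> / (p + 1) * ((p + 1) * (norm x powr a * v x powr p) * XV + a * W2) = f * XV + a / (p + 1) * (\<kappa> * W2)"
    using pq unfolding f_def by (simp add: field_simps)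
  also have "real CARD('n) * (P - (\<mu> / (q + 1) * W1 + \<kappa> / (p + 1) * W2))
     = real CARD('n) * P - (real CARD('n) / (q + 1) * (\<mu> * W1) + real CARD('n) / (p + 1) * (\<kappa> * W2))"
    by (simp add: algebra_simps)
  finally have "(\<Sum>i\<in>UNIV. pd i (pohozaev_field \<kappa> \<mu> p q a b \<alpha>1 \<alpha>2 u v i) x)
    = (real CARD('n) - 2 - (\<alpha>1 + \<alpha>2)) * P
     - (((real CARD('n) + b) / (q + 1) - \<alpha>2) * (u x * g) + ((real CARD('n) + a) / (p + 1) - \<alpha>1) * (v x * f))"
    unfolding W by (simp add: algebra_simps add_divide_distrib)
  then show ?thesis unfolding \<alpha> f_def g_def by simp
qed

section \<open>From the divergence identity to an integral inequality\<close>

lemma continuous_on_vanishing_near_0: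
  fixes k :: "real^'n::finite \<Rightarrow> real"
  assumes "continuous_on (UNIV - {0}) k" "r > 0" "\<And>x. norm x < r \<Longrightarrow> k x = 0"
  shows "continuous_on UNIV k"
proof -
  have "continuous_on (ball 0 r) k"
    by (rule continuous_on_eq[of _ "\<lambda>_. 0"]) (use assms(3) in auto)
  then have "continuous_on ((UNIV - {0}) \<union> ball 0 r) k"
    by (intro continuous_on_open_Un assms(1)) auto
  moreover have "(UNIV - {0}) \<union> ball 0 r = (UNIV :: (real^'n) set)" using assms(2) by auto
  ultimately show ?thesis by simp
qed

lemma continuous_on_HLE_density:
  fixes u v :: "real^'n::finite \<Rightarrow> real"
  assumes "weighted_HLE \<kappa> \<mu> p q a b u v" "p > 0" "q > 0"
  shows "continuous_on (UNIV - {0}) (HLE_density \<kappa> \<mu> p q a b u v)"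
proof -
  have cu: "continuous_on UNIV u" "continuous_on UNIV v" and pos: "\<And>x. u x \<ge> 0" "\<And>x. v x \<ge> 0"
    using assms(1) unfolding weighted_HLE_def by auto
  have cn: "continuous_on (UNIV - {0 :: real^'n}) (\<lambda>x. norm x powr s)" for s
    by (rule C1_on_continuous[OF C1_on_norm_powr])
  have cp: "continuous_on (UNIV - {0}) (\<lambda>x. u x powr q)" "continuous_on (UNIV - {0}) (\<lambda>x. v x powr p)"
    by (intro continuous_on_powr' continuous_on_subset[OF cu(1)] continuous_on_subset[OF cu(2)] continuous_intros;
        use pos assms in simp)+
  show ?thesis unfolding HLE_density_def
    by (intro continuous_intros cn cp continuous_on_subset[OF cu(1)] continuous_on_subset[OF cu(2)]) auto
qed

text \<open>Since \<zeta> vanishes near the origin, \<zeta> times the field is C1 with compact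
  support and its divergence integrates to 0. With both coefficients equal to c, the interior part
  is the single nonnegative function on the left.\<close>

lemma pohozaev_inequality:
  fixes u v \<zeta> :: "real^'n::finite \<Rightarrow> real"
  assumes sol: "weighted_HLE \<kappa> \<mu> p q a b u v" and \<kappa>: "\<kappa> \<ge> 0" "\<mu> \<ge> 0" and pq: "p > 0" "q > 0" and c: "c \<ge> 0"
    and \<alpha>: "\<alpha>1 + \<alpha>2 = real CARD('n) - 2"
      "(real CARD('n) + a) / (p + 1) - \<alpha>1 = c" "(real CARD('n) + b) / (q + 1) - \<alpha>2 = c"
    and \<zeta>: "C1_on UNIV \<zeta>" "\<And>x. \<zeta> x \<ge> 0" "\<And>x. norm x < \<rho> \<Longrightarrow> \<zeta> x = 0" "\<And>x. norm x > r \<Longrightarrow> \<zeta> x = 0"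
    and r0: "\<rho> > 0"
  shows "(\<integral>\<^sup>*x. ennreal (c * (\<zeta> x * HLE_density \<kappa> \<mu> p q a b u v x)))
    \<le> (\<integral>\<^sup>*x. ennreal \<bar>\<Sum>i\<in>UNIV. pd i \<zeta> x * pohozaev_field \<kappa> \<mu> p q a b \<alpha>1 \<alpha>2 u v i x\<bar>)"
proof -
  let ?Z = "pohozaev_field \<kappa> \<mu> p q a b \<alpha>1 \<alpha>2 u v"
  define w where "w = HLE_density \<kappa> \<mu> p q a b u v"
  have C2: "C2_on (UNIV - {0}) u" "C2_on (UNIV - {0}) v" and u0: "\<And>x. u x \<ge> 0" and v0: "\<And>x. v x \<ge> 0"
    and cu: "continuous_on UNIV u" "continuous_on UNIV v"
    using sol unfolding weighted_HLE_def by auto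
  have w0: "w x \<ge> 0" for x unfolding w_def HLE_density_def using u0 v0 \<kappa> by simp
  have CZ: "C1_on (UNIV - {0}) (?Z i)" for i by (rule C1_on_pohozaev_field[OF C2 pq])
  define G where "G i x = \<zeta> x * ?Z i x" for i x
  have near: "G i x = 0" if "norm x < \<rho>" for i x using \<zeta>(3)[OF that] by (simp add: G_def)
  have far: "G i x = 0" if "norm x > r" for i x using \<zeta>(4)[OF that] by (simp add: G_def)
  have CG: "C1_on UNIV (G i)" for i
  proof -
    have "C1_on (UNIV - {0}) (G i)" unfolding G_def by (intro C1_on_mult CZ C1_on_subset[OF \<zeta>(1)]) auto
    moreover have "C1_on (ball 0 \<rho>) (G i)"
      by (rule C1_on_cong_open[OF _ _ C1_on_const[of _ 0]]) (auto simp: near)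
    ultimately have "C1_on ((UNIV - {0}) \<union> ball 0 \<rho>) (G i)" by (intro C1_on_UnionI) auto
    moreover have "(UNIV - {0}) \<union> ball 0 \<rho> = (UNIV :: (real^'n) set)" using r0 by auto
    ultimately show ?thesis by simp
  qed
  define T where "T x = (\<Sum>i\<in>UNIV. pd i \<zeta> x * ?Z i x)" for x
  have div: "(\<Sum>i\<in>UNIV. pd i (G i) x) = T x - c * (\<zeta> x * w x)" for x
  proof (cases "x = 0")
    case True
    have zero: "pd i F x = 0" if "\<And>y. norm y < \<rho> \<Longrightarrow> F y = 0" for F :: "real^'n \<Rightarrow> real" and i
      using partial_deriv_transform_open[of "ball 0 \<rho>" x F "\<lambda>_. 0" i] that r0 True by simp
    show ?thesis using zero[of \<zeta>] zero[of "G _"] \<zeta>(3) near r0 True by (simp add: T_def)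
  next
    case False
    then have "pd i (G i) x = \<zeta> x * pd i (?Z i) x + pd i \<zeta> x * ?Z i x" for i
      unfolding G_def using C1_on_differentiable[OF CZ, of x i] C1_on_differentiable[OF \<zeta>(1), of x]
      by (intro partial_deriv_mult) auto
    then have "(\<Sum>i\<in>UNIV. pd i (G i) x) = \<zeta> x * (\<Sum>i\<in>UNIV. pd i (?Z i) x) + T x"
      by (simp add: sum.distrib sum_distrib_left T_def)
    also have "(\<Sum>i\<in>UNIV. pd i (?Z i) x) = - (c * w x)"
      unfolding pohozaev_divergence[OF sol pq \<alpha>(1) False] \<alpha>(2,3) w_def HLE_density_def by (simp add: algebra_simps)
    finally show ?thesis by simp
  qed
  have intG: "integrable lborel (pd i (G i))" for i
    by (rule compact_support_integrable[where r=r])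
       (use CG in \<open>auto simp: C1_on_def intro!: partial_deriv_zero_outside[where r=r] far\<close>)
  have intw: "integrable lborel (\<lambda>x. c * (\<zeta> x * w x))"
  proof (rule compact_support_integrable[where r=r])
    have "continuous_on (UNIV - {0}) w" unfolding w_def by (rule continuous_on_HLE_density[OF sol pq])
    then have "continuous_on (UNIV - {0}) (\<lambda>x. c * (\<zeta> x * w x))"
      by (intro continuous_intros continuous_on_subset[OF C1_on_continuous[OF \<zeta>(1)]]) auto
    then show "continuous_on UNIV (\<lambda>x. c * (\<zeta> x * w x))"
      by (rule continuous_on_vanishing_near_0[OF _ r0]) (simp add: \<zeta>(3))
  qed (simp add: \<zeta>(4))
  have Teq: "T = (\<lambda>x. (\<Sum>i\<in>UNIV. pd i (G i) x) + c * (\<zeta> x * w x))" using div by (simp add: fun_eq_iff)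
  have intT: "integrable lborel T" unfolding Teq by (intro Bochner_Integration.integrable_add Bochner_Integration.integrable_sum intG intw)
  have "(LINT x|lborel. T x) = (\<Sum>i\<in>UNIV. LINT x|lborel. pd i (G i) x) + (LINT x|lborel. c * (\<zeta> x * w x))"
    unfolding Teq using intG intw
    by (subst Bochner_Integration.integral_add) (auto intro!: Bochner_Integration.integrable_sum simp: Bochner_Integration.integral_sum)
  also have "(\<Sum>i\<in>UNIV. LINT x|lborel. pd i (G i) x) = 0"
    by (rule sum.neutral, rule ballI, rule integral_partial_deriv_eq_0[OF CG far])
  finally have eq: "(LINT x|lborel. T x) = (LINT x|lborel. c * (\<zeta> x * w x))" by simp
  have "(\<integral>\<^sup>*x. ennreal (c * (\<zeta> x * w x))) = ennreal (LINT x|lborel. c * (\<zeta> x * w x))"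
    by (rule nn_integral_eq_integral[OF intw]) (use c \<zeta>(2) w0 in simp)
  also have "\<dots> \<le> ennreal \<bar>LINT x|lborel. T x\<bar>" unfolding eq by (rule ennreal_leI) simp
  also have "\<dots> \<le> (\<integral>\<^sup>*x. ennreal \<bar>T x\<bar>)" using integral_norm_bound_ennreal[OF intT] by simp
  finally show ?thesis unfolding w_def T_def .
qed

lemma radial_cutoff_exists:
  fixes r2 r3 :: real
  assumes r: "0 < r2" "r2 < r3"
  obtains \<eta> :: "real^'n::finite \<Rightarrow> real" and K where
    "C1_on UNIV \<eta>" "\<And>x. 0 \<le> \<eta> x" "\<And>x. \<eta> x \<le> 1" "\<And>x. norm x \<le> r2 \<Longrightarrow> \<eta> x = 1" "\<And>x. norm x \<ge> r3 \<Longrightarrow> \<eta> x = 0"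
    "K \<ge> 0" "\<And>i x. \<bar>pd i \<eta> x\<bar> \<le> K" "\<And>i x. norm x < r2 \<or> norm x > r3 \<Longrightarrow> pd i \<eta> x = 0"
proof -
  define d where "d = inverse (r3\<^sup>2 - r2\<^sup>2)"
  have d: "r3\<^sup>2 - r2\<^sup>2 > 0" "d > 0" using r power_strict_mono[of r2 r3 2] by (auto simp: d_def)
  \<comment> \<open>Two truncated squares composed: the inner one is 0 up to radius r2 and, by the
    normalisation d, reaches 1 at radius r3; the outer one clips at 0. Squaring makes each
    truncation C1.\<close>
  define \<eta> where "\<eta> x = max 0 (1 - max 0 (d * (x \<bullet> x - r2\<^sup>2)) ^ Suc 1) ^ Suc 1" for x :: "real^'n"
  have cm: "continuous_on UNIV (\<lambda>y. real (Suc 1) * max 0 y ^ 1)" by (intro continuous_intros)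
  have C1: "C1_on UNIV \<eta>"
    unfolding \<eta>_def
    by (rule C1_on_chain_real[OF _ UNIV_I has_real_derivative_max_power cm], intro C1_on_diff C1_on_const,
        rule C1_on_chain_real[OF _ UNIV_I has_real_derivative_max_power cm],
        intro C1_on_cmult C1_on_diff C1_on_const C1_on_inner_self) simp_all
  have one: "\<eta> x = 1" if "norm x \<le> r2" for x
  proof -
    have "(norm x)\<^sup>2 \<le> r2\<^sup>2" using that by (intro power_mono) auto
    then have "d * (x \<bullet> x - r2\<^sup>2) \<le> 0" using d by (simp add: power2_norm_eq_inner mult_le_0_iff)
    then have "max 0 (d * (x \<bullet> x - r2\<^sup>2)) = 0" by simp
    then show ?thesis by (simp add: \<eta>_def)
  qed
  have zero: "\<eta> x = 0" if "norm x \<ge> r3" for x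
  proof -
    have "r3\<^sup>2 \<le> (norm x)\<^sup>2" using that r by (intro power_mono) auto
    then have "d * (r3\<^sup>2 - r2\<^sup>2) \<le> d * (x \<bullet> x - r2\<^sup>2)" using d by (intro mult_left_mono) (auto simp: power2_norm_eq_inner)
    then have "1 \<le> max 0 (d * (x \<bullet> x - r2\<^sup>2))" using d by (simp add: d_def)
    then have "1 \<le> max 0 (d * (x \<bullet> x - r2\<^sup>2)) ^ Suc 1" by (rule one_le_power)
    then show ?thesis unfolding \<eta>_def by (simp only: max_absorb1 diff_le_0_iff_le) simp
  qed
  have "continuous_on UNIV (pd i \<eta>)" for i using C1 unfolding C1_on_def by blast
  then have "\<exists>M. \<forall>x. \<bar>pd i \<eta> x\<bar> \<le> M" for i
    by (rule compact_support_bounded[where r=r3]) (auto intro!: partial_deriv_zero_outside[where r=r3] zero)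
  then obtain M where M: "\<And>i x. \<bar>pd i \<eta> x\<bar> \<le> M i" by metis
  have M0: "M i \<ge> 0" for i using M[of i 0] abs_ge_zero order_trans by blast
  show ?thesis
  proof (rule that[OF C1])
    show "0 \<le> \<eta> x" for x by (simp add: \<eta>_def)
    show "\<eta> x \<le> 1" for x unfolding \<eta>_def by (rule power_le_one) auto
    show "(\<Sum>i\<in>UNIV. M i) \<ge> 0" by (intro sum_nonneg M0)
    show "\<bar>pd i \<eta> x\<bar> \<le> (\<Sum>i\<in>UNIV. M i)" for i x
      by (rule order_trans[OF M]) (intro member_le_sum M0; simp)
    show "pd i \<eta> x = 0" if "norm x < r2 \<or> norm x > r3" for i x
      using that
    proof
      assume "norm x < r2"
      then have "pd i \<eta> x = pd i (\<lambda>_. 1) x"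
        by (intro partial_deriv_transform_open[of "ball 0 r2"]) (auto intro: one)
      then show ?thesis by simp
    next
      assume "norm x > r3"
      then show ?thesis by (intro partial_deriv_zero_outside[where r=r3]) (auto intro: zero)
    qed
  qed (use one zero in auto)
qed

text \<open>The factor 3 counts Du.Dv and the two products with x.Du and x.Dv; the potential is at
  most the density because q + 1 and p + 1 exceed 1.\<close>

lemma pohozaev_field_bound:
  fixes u v :: "real^'n::finite \<Rightarrow> real"
  assumes u0: "u x \<ge> 0" and v0: "v x \<ge> 0" and \<kappa>: "\<kappa> \<ge> 0" "\<mu> \<ge> 0" and pq: "p > 0" "q > 0"
  shows "\<bar>pohozaev_field \<kappa> \<mu> p q a b \<alpha>1 \<alpha>2 u v i x\<bar>
    \<le> norm x * (HLE_density \<kappa> \<mu> p q a b u v x + 3 * (grad1 u x * grad1 v x))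
      + \<bar>\<alpha>2\<bar> * (u x * grad1 v x) + \<bar>\<alpha>1\<bar> * (v x * grad1 u x)"
proof -
  let ?P = "\<Sum>j\<in>UNIV. pd j u x * pd j v x"
  let ?W = "\<mu> / (q + 1) * (norm x powr b * \<bar>u x\<bar> powr (q + 1)) + \<kappa> / (p + 1) * (norm x powr a * \<bar>v x\<bar> powr (p + 1))"
  let ?w = "HLE_density \<kappa> \<mu> p q a b u v x"
  have W: "0 \<le> ?W" "?W \<le> ?w"
  proof -
    show "0 \<le> ?W" using \<kappa> pq by simp
    have "\<mu> / (q + 1) \<le> \<mu>" "\<kappa> / (p + 1) \<le> \<kappa>" using \<kappa> pq by (simp_all add: field_simps)
    then have "?W \<le> \<mu> * (norm x powr b * \<bar>u x\<bar> powr (q + 1)) + \<kappa> * (norm x powr a * \<bar>v x\<bar> powr (p + 1))"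
      by (intro add_mono mult_right_mono) auto
    also have "\<dots> = ?w" using u0 v0 unfolding HLE_density_def
      by (simp add: mult_powr_self[OF u0, symmetric] mult_powr_self[OF v0, symmetric] mult_ac)
    finally show "?W \<le> ?w" .
  qed
  have P: "\<bar>?P\<bar> \<le> grad1 u x * grad1 v x"
  proof -
    have "\<bar>?P\<bar> \<le> (\<Sum>j\<in>UNIV. \<bar>pd j u x\<bar> * grad1 v x)"
      by (rule order_trans[OF sum_abs]) (auto intro!: sum_mono mult_left_mono partial_le_grad1 simp: abs_mult)
    then show ?thesis by (simp add: grad1_def sum_distrib_right)
  qed
  have X: "\<bar>\<Sum>j\<in>UNIV. x $ j * pd j h x\<bar> \<le> norm x * grad1 h x" for h
  proof -
    have "\<bar>\<Sum>j\<in>UNIV. x $ j * pd j h x\<bar> \<le> (\<Sum>j\<in>UNIV. norm x * \<bar>pd j h x\<bar>)"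
      by (rule order_trans[OF sum_abs]) (auto intro!: sum_mono mult_right_mono component_le_norm_cart simp: abs_mult)
    then show ?thesis by (simp add: grad1_def sum_distrib_left)
  qed
  have 1: "\<bar>x $ i * (?P - ?W)\<bar> \<le> norm x * (grad1 u x * grad1 v x + ?w)"
    unfolding abs_mult using P W by (intro mult_mono component_le_norm_cart) auto
  have 2: "\<bar>(\<Sum>j\<in>UNIV. x $ j * pd j u x) * pd i v x\<bar> \<le> norm x * (grad1 u x * grad1 v x)"
    unfolding abs_mult mult.assoc[symmetric] by (intro mult_mono X partial_le_grad1) (auto simp: grad1_nonneg)
  have 3: "\<bar>(\<Sum>j\<in>UNIV. x $ j * pd j v x) * pd i u x\<bar> \<le> norm x * (grad1 v x * grad1 u x)"
    unfolding abs_mult mult.assoc[symmetric] by (intro mult_mono X partial_le_grad1) (auto simp: grad1_nonneg)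
  have 4: "\<bar>\<alpha>2 * (u x * pd i v x)\<bar> \<le> \<bar>\<alpha>2\<bar> * (u x * grad1 v x)"
    unfolding abs_mult using u0 by (intro mult_left_mono mult_mono partial_le_grad1) auto
  have 5: "\<bar>\<alpha>1 * (v x * pd i u x)\<bar> \<le> \<bar>\<alpha>1\<bar> * (v x * grad1 u x)"
    unfolding abs_mult using v0 by (intro mult_left_mono mult_mono partial_le_grad1) auto
  have eq: "norm x * (?w + 3 * (grad1 u x * grad1 v x))
    = norm x * (grad1 u x * grad1 v x + ?w) + norm x * (grad1 u x * grad1 v x) + norm x * (grad1 v x * grad1 u x)"
    by (simp add: algebra_simps)
  have abs5: "\<bar>A - B - C - D - E\<bar> \<le> A' + B' + C' + D' + E'"
    if "\<bar>A\<bar> \<le> A'" "\<bar>B\<bar> \<le> B'" "\<bar>C\<bar> \<le> C'" "\<bar>D\<bar> \<le> D'" "\<bar>E\<bar> \<le> E'"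
    for A B C D E A' B' C' D' E' :: real
    using that by linarith
  show ?thesis unfolding pohozaev_field_def eq by (rule abs5[OF 1 2 3 4 5])
qed

subsection \<open>Scaling and conclusion\<close>

lemma rescale_partial_deriv:
  fixes u :: "real^'n::finite \<Rightarrow> real"
  assumes u: "C1_on (UNIV - {0}) u" and S: "S > 0"
  shows "C1_on (UNIV - {0}) (\<lambda>y. s * u (S *\<^sub>R y))"
    and "y \<noteq> 0 \<Longrightarrow> pd i (\<lambda>y. s * u (S *\<^sub>R y)) y = s * S * pd i u (S *\<^sub>R y)"
proof -
  have sub: "0 + S *\<^sub>R z \<in> UNIV - {0}" if "z \<in> UNIV - {0}" for z :: "real^'n" using that S by simp
  have C: "C1_on (UNIV - {0}) (\<lambda>y. u (S *\<^sub>R y))" using C1_on_affine(1)[where x=0 and t=S and S="UNIV - {0}", OF u sub] by simp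
  then show "C1_on (UNIV - {0}) (\<lambda>y. s * u (S *\<^sub>R y))" by (rule C1_on_cmult)
  show "pd i (\<lambda>y. s * u (S *\<^sub>R y)) y = s * S * pd i u (S *\<^sub>R y)" if "y \<noteq> 0"
  proof -
    have "pd i (\<lambda>y. u (S *\<^sub>R y)) y = S * pd i u (S *\<^sub>R y)"
      using C1_on_affine(2)[where x=0 and t=S and z=y and S="UNIV - {0}", OF u sub] that by simp
    then show ?thesis using C1_on_differentiable[OF C, of y] that by (simp add: partial_deriv_cmult)
  qed
qed

lemma rescale_C2:
  fixes u :: "real^'n::finite \<Rightarrow> real"
  assumes u: "C2_on (UNIV - {0}) u" and S: "S > 0"
  shows "C2_on (UNIV - {0}) (\<lambda>y. s * u (S *\<^sub>R y))"
    and "y \<noteq> 0 \<Longrightarrow> laplacian (\<lambda>y. s * u (S *\<^sub>R y)) y = s * S\<^sup>2 * laplacian u (S *\<^sub>R y)"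
proof -
  have C1: "C1_on (UNIV - {0}) u" "\<And>i. C1_on (UNIV - {0}) (pd i u)" using u unfolding C2_on_def by blast+
  have op: "open (UNIV - {0 :: real^'n})" by auto
  have eq: "s * S * pd i u (S *\<^sub>R y) = pd i (\<lambda>y. s * u (S *\<^sub>R y)) y" if "y \<in> UNIV - {0}" for i y
    using rescale_partial_deriv(2)[OF C1(1) S] that by simp
  show "C2_on (UNIV - {0}) (\<lambda>y. s * u (S *\<^sub>R y))"
    unfolding C2_on_def using rescale_partial_deriv(1)[OF C1(1) S]
      C1_on_cong_open[OF op eq rescale_partial_deriv(1)[OF C1(2) S]] by blast
  show "laplacian (\<lambda>y. s * u (S *\<^sub>R y)) y = s * S\<^sup>2 * laplacian u (S *\<^sub>R y)" if y: "y \<noteq> 0"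
  proof -
    have "pd i (pd i (\<lambda>y. s * u (S *\<^sub>R y))) y = s * S\<^sup>2 * pd i (pd i u) (S *\<^sub>R y)" for i
    proof -
      have "pd i (pd i (\<lambda>y. s * u (S *\<^sub>R y))) y = pd i (\<lambda>y. (s * S) * pd i u (S *\<^sub>R y)) y"
        by (rule partial_deriv_transform_open[OF op, symmetric]) (use y eq in auto)
      also have "\<dots> = s * S\<^sup>2 * pd i (pd i u) (S *\<^sub>R y)"
        by (simp add: rescale_partial_deriv(2)[OF C1(2) S y] power2_eq_square)
      finally show ?thesis .
    qed
    then show ?thesis unfolding laplacian_def by (simp add: sum_distrib_left)
  qed
qed

text \<open>The amplitudes s and t are kept free to cover two uses: s = S^\<alpha>, t = S^\<beta>
  with the natural exponents make both coefficients 1, whereas s = t = 1 leaves S^(2+a) and S^(2+b),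
  which are small for small S.\<close>

lemma weighted_HLE_rescale:
  fixes u v :: "real^'n::finite \<Rightarrow> real"
  assumes sol: "weighted_HLE 1 1 p q a b u v" and S: "S > 0" "s > 0" "t > 0"
  shows "weighted_HLE (s * S powr (2 + a) * t powr (- p)) (t * S powr (2 + b) * s powr (- q)) p q a b
     (\<lambda>y. s * u (S *\<^sub>R y)) (\<lambda>y. t * v (S *\<^sub>R y))"
proof -
  have C2: "C2_on (UNIV - {0}) u" "C2_on (UNIV - {0}) v" and c: "continuous_on UNIV u" "continuous_on UNIV v"
    and pos: "\<And>x. u x \<ge> 0" "\<And>x. v x \<ge> 0"
    and eq: "\<And>x. x \<noteq> 0 \<Longrightarrow> - laplacian u x = norm x powr a * v x powr p"
       "\<And>x. x \<noteq> 0 \<Longrightarrow> - laplacian v x = norm x powr b * u x powr q"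
    using sol unfolding weighted_HLE_def by auto
  \<comment> \<open>Stated for arbitrary amplitudes and exponents so that it serves both equations,
    with the roles of s and t exchanged.\<close>
  have alg: "s * S\<^sup>2 * (norm (S *\<^sub>R y) powr a * w powr p) = s * S powr (2 + a) * t powr (- p) * norm y powr a * (t * w) powr p"
    if "s > 0" "t > 0" "w \<ge> 0" for s t w p a and y :: "real^'n"
  proof -
    have e1: "(t * w) powr p = t powr p * w powr p" by (rule powr_mult)
    have e2: "norm (S *\<^sub>R y) powr a = S powr a * norm y powr a" using S by (simp add: powr_mult)
    have e3: "S powr (2 + a) = S\<^sup>2 * S powr a" using S by (simp add: powr_add)
    have e4: "t powr (- p) * t powr p = 1" using that by (simp add: powr_add[symmetric])
    have "s * S powr (2 + a) * t powr (- p) * norm y powr a * (t * w) powr p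
       = (t powr (- p) * t powr p) * (s * S\<^sup>2 * (S powr a * norm y powr a * w powr p))"
      unfolding e1 e3 by (simp only: mult_ac)
    then show ?thesis unfolding e2 e4 mult_1_left by (rule sym)
  qed
  have cc: "continuous_on UNIV (\<lambda>y. s * u (S *\<^sub>R y))" "continuous_on UNIV (\<lambda>y. t * v (S *\<^sub>R y))"
    by (intro continuous_intros continuous_on_compose2[OF c(1)] continuous_on_compose2[OF c(2)]; simp)+
  have ne: "S *\<^sub>R y \<noteq> 0" if "y \<noteq> 0" for y :: "real^'n" using that S by simp
  have eqs: "- laplacian (\<lambda>y. s * u (S *\<^sub>R y)) y = s * S powr (2 + a) * t powr (- p) * norm y powr a * (t * v (S *\<^sub>R y)) powr p"
      "- laplacian (\<lambda>y. t * v (S *\<^sub>R y)) y = t * S powr (2 + b) * s powr (- q) * norm y powr b * (s * u (S *\<^sub>R y)) powr q"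
    if "y \<noteq> 0" for y
  proof -
    have "- laplacian (\<lambda>y. s * u (S *\<^sub>R y)) y = s * S\<^sup>2 * (- laplacian u (S *\<^sub>R y))"
      by (simp add: rescale_C2(2)[OF C2(1) S(1) that])
    then show "- laplacian (\<lambda>y. s * u (S *\<^sub>R y)) y = s * S powr (2 + a) * t powr (- p) * norm y powr a * (t * v (S *\<^sub>R y)) powr p"
      unfolding eq(1)[OF ne[OF that]] alg[OF S(2,3) pos(2)] .
    have "- laplacian (\<lambda>y. t * v (S *\<^sub>R y)) y = t * S\<^sup>2 * (- laplacian v (S *\<^sub>R y))"
      by (simp add: rescale_C2(2)[OF C2(2) S(1) that])
    then show "- laplacian (\<lambda>y. t * v (S *\<^sub>R y)) y = t * S powr (2 + b) * s powr (- q) * norm y powr b * (s * u (S *\<^sub>R y)) powr q"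
      unfolding eq(2)[OF ne[OF that]] alg[OF S(3,2) pos(1)] .
  qed
  show ?thesis
    unfolding weighted_HLE_def
    using rescale_C2(1)[OF C2(1) S(1)] rescale_C2(1)[OF C2(2) S(1)] cc pos S eqs by auto
qed

lemma grad1_rescale:
  fixes u :: "real^'n::finite \<Rightarrow> real"
  assumes u: "C1_on (UNIV - {0}) u" and S: "S > 0" "s > 0" and y: "y \<noteq> 0"
  shows "grad1 (\<lambda>y. s * u (S *\<^sub>R y)) y = s * S * grad1 u (S *\<^sub>R y)"
  unfolding grad1_def rescale_partial_deriv(2)[OF u S(1) y] using S by (simp add: abs_mult sum_distrib_left)

text \<open>Substituting x = S y contributes S^N from the volume and 1 / S from the gradient of the
  cut-off, and the field at S y is at most a multiple of the rescaled density divided by s t S.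
  Altogether this is S^(N-2) / (s t).\<close>

lemma scaled_boundary_bound:
  fixes u v \<eta> :: "real^'n::finite \<Rightarrow> real"
  assumes sol: "weighted_HLE 1 1 p q a b u v" and pq: "p > 0" "q > 0" and R: "0 < R1" "0 < \<delta>"
    and \<eta>: "C1_on UNIV \<eta>" "K \<ge> 0" "\<And>i x. \<bar>pd i \<eta> x\<bar> \<le> K"
      "\<And>i x. x \<notin> annulus (R1 + \<delta>) (R4 - \<delta>) \<Longrightarrow> pd i \<eta> x = 0"
    and S: "S > 0" "s > 0" "t > 0"
    and C: "C \<ge> 0"
      "(\<integral>\<^sup>*y. ennreal (boundary_density (s * S powr (2 + a) * t powr (- p)) (t * S powr (2 + b) * s powr (- q)) p q a b
            (\<lambda>y. s * u (S *\<^sub>R y)) (\<lambda>y. t * v (S *\<^sub>R y)) y)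
          * indicator (annulus (R1 + \<delta>) (R4 - \<delta>)) y) \<le> ennreal C"
  shows "(\<integral>\<^sup>*x. ennreal \<bar>\<Sum>i\<in>UNIV. pd i (\<lambda>x. \<eta> ((1 / S) *\<^sub>R x)) x
            * pohozaev_field 1 1 p q a b \<alpha>1 \<alpha>2 u v i x\<bar>)
     \<le> ennreal (real CARD('n) * K * (3 * \<bar>R4\<bar> + \<bar>\<alpha>1\<bar> + \<bar>\<alpha>2\<bar>) * C * (S powr (real CARD('n) - 2) / (s * t)))"
proof -
  let ?Z = "pohozaev_field 1 1 p q a b \<alpha>1 \<alpha>2 u v"
  let ?A = "annulus (R1 + \<delta>) (R4 - \<delta>) :: (real^'n) set"
  let ?U = "\<lambda>y. s * u (S *\<^sub>R y)" and ?V = "\<lambda>y. t * v (S *\<^sub>R y)"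
  let ?\<kappa> = "s * S powr (2 + a) * t powr (- p)" and ?\<mu> = "t * S powr (2 + b) * s powr (- q)"
  define Y where "Y = boundary_density ?\<kappa> ?\<mu> p q a b ?U ?V"
  \<comment> \<open>On the rescaled annulus |y| is at most |R4|, which bounds the factor norm x in
    the field; 3 is the multiplicity of the gradient product.\<close>
  define B where "B = 3 * \<bar>R4\<bar> + \<bar>\<alpha>1\<bar> + \<bar>\<alpha>2\<bar>"
  define c where "c = real CARD('n) * K * B"
  have B: "B \<ge> 0" "3 * \<bar>R4\<bar> \<le> B" "\<bar>R4\<bar> \<le> B" "\<bar>\<alpha>1\<bar> \<le> B" "\<bar>\<alpha>2\<bar> \<le> B" by (auto simp: B_def)
  have c: "c \<ge> 0" unfolding c_def using \<eta>(2) B by simp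
  have C2: "C2_on (UNIV - {0}) u" "C2_on (UNIV - {0}) v" and pos: "\<And>x. u x \<ge> 0" "\<And>x. v x \<ge> 0"
    using sol unfolding weighted_HLE_def by auto
  have C1: "C1_on (UNIV - {0}) u" "C1_on (UNIV - {0}) v" using C2 unfolding C2_on_def by blast+
  have C1\<eta>: "C1_on UNIV (\<lambda>x. \<eta> ((1 / S) *\<^sub>R x))"
    using C1_on_affine(1)[OF \<eta>(1), of UNIV 0 "1 / S"] by simp
  have p\<eta>: "pd i (\<lambda>x. \<eta> ((1 / S) *\<^sub>R x)) x = (1 / S) * pd i \<eta> ((1 / S) *\<^sub>R x)" for i x
    using C1_on_affine(2)[OF \<eta>(1), of UNIV 0 "1 / S" x i] by simp
  let ?F = "\<lambda>x. \<bar>\<Sum>i\<in>UNIV. pd i (\<lambda>x. \<eta> ((1 / S) *\<^sub>R x)) x * ?Z i x\<bar>"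
  have [measurable]: "?Z i \<in> borel_measurable borel" for i
    by (rule borel_measurable_continuous_punctured[OF C1_on_continuous[OF C1_on_pohozaev_field[OF C2 pq]]])
  have [measurable]: "pd i (\<lambda>x. \<eta> ((1 / S) *\<^sub>R x)) \<in> borel_measurable borel" for i
    by (rule borel_measurable_continuous_onI) (use C1\<eta> in \<open>auto simp: C1_on_def\<close>)
  have pw: "?F (S *\<^sub>R y) \<le> c / (s * t * S\<^sup>2) * (Y y * indicator ?A y)" for y
  proof (cases "y \<in> ?A")
    case False
    then show ?thesis using S by (simp add: p\<eta> \<eta>(4))
  next
    case True
    then have y: "y \<noteq> 0" and ny: "norm y \<le> \<bar>R4\<bar>" using R by (auto simp: mem_annulus)
    let ?x = "S *\<^sub>R y"
    let ?ug = "u ?x * (1 * norm ?x powr b * u ?x powr q)" and ?vf = "v ?x * (1 * norm ?x powr a * v ?x powr p)"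
    have "?x \<noteq> 0" using y S by simp
    then have lap: "laplacian u ?x = - (norm ?x powr a * v ?x powr p)" "laplacian v ?x = - (norm ?x powr b * u ?x powr q)"
      using sol unfolding weighted_HLE_def by fastforce+
    \<comment> \<open>The Laplacian of the rescaled functions is computed in two ways, from the
      rescaled system and by the chain rule; comparing them expresses the rescaled f and g through
      the original ones.\<close>
    have "laplacian ?U y = - (?\<kappa> * norm y powr a * ?V y powr p)" "laplacian ?V y = - (?\<mu> * norm y powr b * ?U y powr q)"
      using weighted_HLE_rescale[OF sol S] y unfolding weighted_HLE_def by fastforce+
    then have fg: "?\<kappa> * norm y powr a * ?V y powr p = s * S\<^sup>2 * (norm ?x powr a * v ?x powr p)"
       "?\<mu> * norm y powr b * ?U y powr q = t * S\<^sup>2 * (norm ?x powr b * u ?x powr q)"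
      unfolding rescale_C2(2)[OF C2(1) S(1) y] rescale_C2(2)[OF C2(2) S(1) y] lap
      by (simp_all only: mult_minus_right neg_equal_iff_equal)
    have gr: "grad1 ?U y = s * S * grad1 u ?x" "grad1 ?V y = t * S * grad1 v ?x"
      using grad1_rescale[OF C1(1) S(1,2) y] grad1_rescale[OF C1(2) S(1,3) y] by auto
    have Yeq: "Y y = s * t * S\<^sup>2 * (?ug + ?vf + grad1 u ?x * grad1 v ?x) + s * t * S * (u ?x * grad1 v ?x + v ?x * grad1 u ?x)"
      unfolding Y_def boundary_density_def HLE_density_def fg gr by (simp add: algebra_simps power2_eq_square)
    have Zb: "\<bar>?Z i ?x\<bar> \<le> B * (S * (?ug + ?vf + grad1 u ?x * grad1 v ?x) + (u ?x * grad1 v ?x + v ?x * grad1 u ?x))" for i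
    proof -
      have n: "norm ?x \<le> S * \<bar>R4\<bar>" using S ny by simp
      have g0: "grad1 u ?x * grad1 v ?x \<ge> 0" by (simp add: grad1_nonneg)
      have w0: "?ug + ?vf \<ge> 0" using pos by simp
      have "\<bar>?Z i ?x\<bar> \<le> norm ?x * (?ug + ?vf + 3 * (grad1 u ?x * grad1 v ?x)) + \<bar>\<alpha>2\<bar> * (u ?x * grad1 v ?x) + \<bar>\<alpha>1\<bar> * (v ?x * grad1 u ?x)"
        using pohozaev_field_bound[of u ?x v 1 1 p q a b \<alpha>1 \<alpha>2 i] pos pq by (simp add: HLE_density_def)
      also have "\<dots> \<le> norm ?x * (3 * (?ug + ?vf + grad1 u ?x * grad1 v ?x)) + B * (u ?x * grad1 v ?x) + B * (v ?x * grad1 u ?x)"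
        using g0 w0 pos by (intro add_mono mult_left_mono mult_right_mono B) (auto simp: grad1_nonneg)
      also have "norm ?x * (3 * (?ug + ?vf + grad1 u ?x * grad1 v ?x)) \<le> (S * \<bar>R4\<bar>) * (3 * (?ug + ?vf + grad1 u ?x * grad1 v ?x))"
        using g0 w0 by (intro mult_right_mono n) auto
      also have "\<dots> = (3 * \<bar>R4\<bar>) * (S * (?ug + ?vf + grad1 u ?x * grad1 v ?x))" by simp
      also have "\<dots> \<le> B * (S * (?ug + ?vf + grad1 u ?x * grad1 v ?x))"
        using g0 w0 S by (intro mult_right_mono B) auto
      finally show ?thesis by (simp add: distrib_left)
    qed
    have "?F ?x \<le> (\<Sum>i\<in>UNIV. \<bar>(1 / S) * pd i \<eta> y * ?Z i ?x\<bar>)"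
      unfolding p\<eta> using S by (intro order_trans[OF sum_abs]) simp
    also have "\<dots> \<le> (\<Sum>i\<in>(UNIV :: 'n set). (1 / S) * K * (B * (S * (?ug + ?vf + grad1 u ?x * grad1 v ?x) + (u ?x * grad1 v ?x + v ?x * grad1 u ?x))))"
      unfolding abs_mult using S \<eta>(2) by (intro sum_mono mult_mono \<eta>(3) Zb) auto
    also have "\<dots> = c / (s * t * S\<^sup>2) * Y y"
      unfolding Yeq c_def using S by (simp add: field_simps power2_eq_square)
    finally show ?thesis using True by simp
  qed
  have "(\<integral>\<^sup>*x. ennreal (?F x)) = ennreal (\<bar>S\<bar> ^ CARD('n)) * (\<integral>\<^sup>*y. ennreal (?F (0 + S *\<^sub>R y)))"
  proof (rule nn_integral_affine)
    show "(\<lambda>x. ennreal (?F x)) \<in> borel_measurable borel" by measurable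
    show "S \<noteq> 0" using S by simp
  qed
  also have "\<dots> = ennreal (S ^ CARD('n)) * (\<integral>\<^sup>*y. ennreal (?F (S *\<^sub>R y)))"
    using S by simp
  also have "\<dots> \<le> ennreal (S ^ CARD('n)) * (\<integral>\<^sup>*y. ennreal (c / (s * t * S\<^sup>2)) * (ennreal (Y y) * indicator ?A y))"
  proof (intro mult_left_mono nn_integral_mono)
    fix y :: "real^'n"
    have "ennreal (?F (S *\<^sub>R y)) \<le> ennreal (c / (s * t * S\<^sup>2) * (Y y * indicator ?A y))" by (rule ennreal_leI[OF pw])
    also have "\<dots> = ennreal (c / (s * t * S\<^sup>2)) * ennreal (Y y * indicator ?A y)"
      using c S by (intro ennreal_mult') simp
    also have "ennreal (Y y * indicator ?A y) = ennreal (Y y) * indicator ?A y" by (simp add: indicator_def)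
    finally show "ennreal (?F (S *\<^sub>R y)) \<le> ennreal (c / (s * t * S\<^sup>2)) * (ennreal (Y y) * indicator ?A y)" .
  qed simp
  also have "\<dots> = ennreal (S ^ CARD('n)) * (ennreal (c / (s * t * S\<^sup>2)) * (\<integral>\<^sup>*y. ennreal (Y y) * indicator ?A y))"
  proof -
    have C2': "C2_on (UNIV - {0}) ?U" "C2_on (UNIV - {0}) ?V" "continuous_on UNIV ?U" "continuous_on UNIV ?V"
      using weighted_HLE_rescale[OF sol S] unfolding weighted_HLE_def by auto
    have [measurable]: "pd i ?U \<in> borel_measurable borel" "pd i ?V \<in> borel_measurable borel" for i
      using C2' unfolding C2_on_def C1_on_def by (auto intro!: borel_measurable_continuous_punctured)
    have [measurable]: "?U \<in> borel_measurable borel" "?V \<in> borel_measurable borel"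
      using C2' by (auto intro!: borel_measurable_continuous_onI)
    have [measurable]: "grad1 ?U \<in> borel_measurable borel" "grad1 ?V \<in> borel_measurable borel"
      unfolding grad1_def by measurable
    have [measurable]: "Y \<in> borel_measurable borel"
      unfolding Y_def boundary_density_def[abs_def] HLE_density_def by measurable
    show ?thesis by (subst nn_integral_cmult) measurable
  qed
  also have "\<dots> \<le> ennreal (S ^ CARD('n)) * (ennreal (c / (s * t * S\<^sup>2)) * ennreal C)"
    by (intro mult_left_mono) (use C(2) in \<open>simp_all add: Y_def\<close>)
  also have "\<dots> = ennreal (c * C * (S powr (real CARD('n) - 2) / (s * t)))"
  proof -
    have "S ^ CARD('n) / S\<^sup>2 = S powr (real CARD('n) - 2)"
      using S by (simp add: powr_diff powr_realpow)
    moreover have "S ^ CARD('n) * (c / (s * t * S\<^sup>2) * C) = c * C * ((S ^ CARD('n) / S\<^sup>2) / (s * t))"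
      by (simp add: mult_ac)
    ultimately have "S ^ CARD('n) * (c / (s * t * S\<^sup>2) * C) = c * C * (S powr (real CARD('n) - 2) / (s * t))"
      by simp
    moreover have "ennreal (S ^ CARD('n)) * (ennreal (c / (s * t * S\<^sup>2)) * ennreal C) = ennreal (S ^ CARD('n) * (c / (s * t * S\<^sup>2) * C))"
    proof -
      have 1: "0 \<le> c / (s * t * S\<^sup>2)" using S c by simp
      have 2: "0 \<le> c / (s * t * S\<^sup>2) * C" using 1 C(1) by (rule mult_nonneg_nonneg)
      have 3: "0 \<le> S ^ CARD('n)" using S by simp
      show ?thesis unfolding ennreal_mult[OF 3 2] ennreal_mult[OF 1 C(1)] ..
    qed
    ultimately show ?thesis by simp
  qed
  finally show ?thesis unfolding c_def B_def .
qed

text \<open>These two relations express that the natural scaling leaves both equations of the system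
  unchanged.\<close>

lemma scaling_exponents:
  fixes p q a b :: real
  assumes "p * q > 1"
  shows "beta_tilde p q a b * p - alpha_tilde p q a b = a + 2"
    and "alpha_tilde p q a b * q - beta_tilde p q a b = b + 2"
proof -
  have d: "p * q - 1 \<noteq> 0" using assms by simp
  have "beta_tilde p q a b * p - alpha_tilde p q a b = ((a + 2) * (p * q - 1)) / (p * q - 1)"
    unfolding beta_tilde_def alpha_tilde_def by (simp add: diff_divide_distrib[symmetric] algebra_simps)
  then show "beta_tilde p q a b * p - alpha_tilde p q a b = a + 2" using d by simp
  have "alpha_tilde p q a b * q - beta_tilde p q a b = ((b + 2) * (p * q - 1)) / (p * q - 1)"
    unfolding beta_tilde_def alpha_tilde_def by (simp add: diff_divide_distrib[symmetric] algebra_simps)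
  then show "alpha_tilde p q a b * q - beta_tilde p q a b = b + 2" using d by simp
qed

text \<open>Put \<sigma> = \<alpha> + \<beta> - (N - 2). The scaling relations give N + a = \<beta>
  (p + 1) - \<sigma> and N + b = \<alpha> (q + 1) - \<sigma>, which turns subcriticality into
  positivity of \<sigma> times (p q - 1) / ((p + 1) (q + 1)).\<close>

lemma subcritical_exponent_sum:
  assumes pq: "p > 0" "q > 0" "p * q > 1" and sub: "subcritical N p q a b"
  shows "alpha_tilde p q a b + beta_tilde p q a b > real N - 2"
proof -
  let ?\<alpha> = "alpha_tilde p q a b" and ?\<beta> = "beta_tilde p q a b"
  define \<sigma> where "\<sigma> = ?\<alpha> + ?\<beta> - (real N - 2)"
  have eqs: "real N + a = ?\<beta> * (p + 1) - \<sigma>" "real N + b = ?\<alpha> * (q + 1) - \<sigma>"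
    using scaling_exponents[OF pq(3), of a b] unfolding \<sigma>_def by (simp_all add: algebra_simps)
  have "(real N + a) / (p + 1) = ?\<beta> - \<sigma> / (p + 1)" "(real N + b) / (q + 1) = ?\<alpha> - \<sigma> / (q + 1)"
    unfolding eqs using pq by (simp_all add: diff_divide_distrib)
  then have "?\<beta> - \<sigma> / (p + 1) + (?\<alpha> - \<sigma> / (q + 1)) > real N - 2"
    using sub unfolding subcritical_def by (simp only:)
  then have "0 < \<sigma> * (1 - 1 / (p + 1) - 1 / (q + 1))"
    unfolding right_diff_distrib using \<sigma>_def by simp
  moreover have "1 - 1 / (p + 1) - 1 / (q + 1) = (p * q - 1) / ((p + 1) * (q + 1))"
    using pq by (simp add: field_simps)
  moreover have "(p * q - 1) / ((p + 1) * (q + 1)) > 0" using pq by (intro divide_pos_pos mult_pos_pos) auto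
  ultimately have "\<sigma> > 0" by (metis zero_less_mult_pos2)
  then show ?thesis by (simp add: \<sigma>_def)
qed

text \<open>A bound on a Bochner integral is informative only if the integrand is integrable; here
  continuity on a bounded set ensures this, so the bound passes to the extended nonnegative
  integral.\<close>

lemma annulus_integral_to_nn:
  fixes U V :: "real^'n::finite \<Rightarrow> real"
  assumes c: "continuous_on UNIV U" "continuous_on UNIV V" and pos: "\<And>x. U x \<ge> 0" "\<And>x. V x \<ge> 0"
    and pq: "(p::real) > 0" "(q::real) > 0"
    and le: "(LINT x : ball 0 s - ball 0 r | lborel. U x powr (q + 1) + V x powr (p + 1)) \<le> C"
  shows "(\<integral>\<^sup>*x. ennreal (U x powr (q + 1) + V x powr (p + 1)) * indicator (annulus r s) x) \<le> ennreal C"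
proof -
  let ?h = "\<lambda>x. U x powr (q + 1) + V x powr (p + 1)"
  have ch: "continuous_on UNIV ?h"
    by (intro continuous_on_add continuous_on_powr' c continuous_on_const) (use pos pq in auto)
  have "set_integrable lborel (cball 0 s) ?h"
    unfolding set_integrable_def by (rule borel_integrable_compact) (auto intro: continuous_on_subset[OF ch])
  then have int: "set_integrable lborel (ball 0 s - ball 0 r) ?h"
    by (rule set_integrable_subset) auto
  have "(\<integral>\<^sup>*x. ennreal (?h x) * indicator (annulus r s) x)
      = (\<integral>\<^sup>*x. ennreal (indicator (ball 0 s - ball 0 r) x *\<^sub>R ?h x))"
    by (intro nn_integral_cong) (simp add: annulus_def indicator_def)
  also have "\<dots> = ennreal (LINT x : ball 0 s - ball 0 r | lborel. ?h x)"
    unfolding set_lebesgue_integral_def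
    by (rule nn_integral_eq_integral[OF int[unfolded set_integrable_def]]) simp
  also have "\<dots> \<le> ennreal C" by (rule ennreal_leI[OF le])
  finally show ?thesis .
qed

text \<open>C is fixed before S, s and t, so one constant serves a whole family of radii. It is
  applied once to large radii and once to small ones, with different D.\<close>

lemma boundary_terms_bound:
  fixes u v \<eta> :: "real^'n::finite \<Rightarrow> real"
  assumes sol: "weighted_HLE 1 1 p q a b u v" and pq: "p > 0" "q > 0" and R: "0 < R1" "0 < \<delta>" and D: "0 \<le> D"
    and \<eta>: "C1_on UNIV \<eta>" "K \<ge> 0" "\<And>i x. \<bar>pd i \<eta> x\<bar> \<le> K"
      "\<And>i x. x \<notin> annulus (R1 + \<delta>) (R4 - \<delta>) \<Longrightarrow> pd i \<eta> x = 0"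
  shows "\<exists>C\<ge>0. \<forall>S s t. S > 0 \<longrightarrow> s > 0 \<longrightarrow> t > 0 \<longrightarrow> s * S powr (2 + a) * t powr (- p) \<le> 1 \<longrightarrow>
      t * S powr (2 + b) * s powr (- q) \<le> 1 \<longrightarrow>
      (\<integral>\<^sup>*x. ennreal ((s * u (S *\<^sub>R x)) powr (q + 1) + (t * v (S *\<^sub>R x)) powr (p + 1)) * indicator (annulus R1 R4) x) \<le> ennreal D \<longrightarrow>
      (\<integral>\<^sup>*x. ennreal \<bar>\<Sum>i\<in>UNIV. pd i (\<lambda>x. \<eta> ((1 / S) *\<^sub>R x)) x
            * pohozaev_field 1 1 p q a b \<alpha>1 \<alpha>2 u v i x\<bar>)
     \<le> ennreal (C * (S powr (real CARD('n) - 2) / (s * t)))"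
proof -
  obtain C where C: "C \<ge> 0" "\<And>(u :: real^'n::finite \<Rightarrow> real) v \<kappa> \<mu>. weighted_HLE \<kappa> \<mu> p q a b u v \<Longrightarrow>
      0 \<le> \<kappa> \<Longrightarrow> \<kappa> \<le> 1 \<Longrightarrow> 0 \<le> \<mu> \<Longrightarrow> \<mu> \<le> 1 \<Longrightarrow>
      (\<integral>\<^sup>*x. ennreal (u x powr (q + 1) + v x powr (p + 1)) * indicator (annulus R1 R4) x) \<le> ennreal D \<Longrightarrow>
      (\<integral>\<^sup>*x. ennreal (boundary_density \<kappa> \<mu> p q a b u v x)
          * indicator (annulus (R1 + \<delta>) (R4 - \<delta>)) x) \<le> ennreal C"
    by (rule weighted_energy_bound[OF R pq D, of a b R4]) blast
  show ?thesis
  proof (intro exI[of _ "real CARD('n) * K * (3 * \<bar>R4\<bar> + \<bar>\<alpha>1\<bar> + \<bar>\<alpha>2\<bar>) * C"] conjI allI impI)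
    show "real CARD('n) * K * (3 * \<bar>R4\<bar> + \<bar>\<alpha>1\<bar> + \<bar>\<alpha>2\<bar>) * C \<ge> 0" using C(1) \<eta>(2) by simp
    fix S s t :: real
    assume S: "S > 0" "s > 0" "t > 0" and le: "s * S powr (2 + a) * t powr (- p) \<le> 1" "t * S powr (2 + b) * s powr (- q) \<le> 1"
      and int: "(\<integral>\<^sup>*x. ennreal ((s * u (S *\<^sub>R x)) powr (q + 1) + (t * v (S *\<^sub>R x)) powr (p + 1)) * indicator (annulus R1 R4) x) \<le> ennreal D"
    show "(\<integral>\<^sup>*x. ennreal \<bar>\<Sum>i\<in>UNIV. pd i (\<lambda>x. \<eta> ((1 / S) *\<^sub>R x)) x
            * pohozaev_field 1 1 p q a b \<alpha>1 \<alpha>2 u v i x\<bar>)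
     \<le> ennreal (real CARD('n) * K * (3 * \<bar>R4\<bar> + \<bar>\<alpha>1\<bar> + \<bar>\<alpha>2\<bar>) * C * (S powr (real CARD('n) - 2) / (s * t)))"
      by (rule scaled_boundary_bound[OF sol pq R \<eta> S C(1)], assumption,
          rule C(2)[OF weighted_HLE_rescale[OF sol S] _ le(1) _ le(2) int])
         (use S in auto)
  qed
qed

theorem theorem1p6:
  fixes u v :: "real ^ 'n::finite \<Rightarrow> real" and p q a b R\<^sub>1 R\<^sub>4 C\<^sub>0 :: real
  assumes "CARD('n) \<ge> 3"
    and "p > 0" and "q > 0" and "p * q > 1"
    and "a > -2" and "b > -2"
    and "subcritical CARD('n) p q a b"
    and "nonneg_HLE_solution p q a b u v"
    and "R\<^sub>4 > R\<^sub>1" and "R\<^sub>1 > 0" and "C\<^sub>0 > 0"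
    and "\<forall>\<^sub>F R in at_top.
           (LINT x : ball 0 R\<^sub>4 - ball 0 R\<^sub>1 | lborel.
              rescale (alpha_tilde p q a b) R u x powr (q + 1)
            + rescale (beta_tilde p q a b) R v x powr (p + 1)) \<le> C\<^sub>0"
  shows "(\<forall>x. u x = 0) \<and> (\<forall>x. v x = 0)"
proof -
  note pq = assms(2,3)
  let ?N = "real CARD('n)"
  define \<alpha> where "\<alpha> = alpha_tilde p q a b"
  define \<beta> where "\<beta> = beta_tilde p q a b"
  have ab: "\<beta> * p - \<alpha> = a + 2" "\<alpha> * q - \<beta> = b + 2"
    unfolding \<alpha>_def \<beta>_def by (rule scaling_exponents[OF assms(4)])+
  have \<sigma>: "\<alpha> + \<beta> > ?N - 2"
    unfolding \<alpha>_def \<beta>_def by (rule subcritical_exponent_sum[OF pq assms(4,7)])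
  have sol: "weighted_HLE 1 1 p q a b u v" by (rule weighted_HLE_of_solution[OF assms(8) pq])
  then have cu: "continuous_on UNIV u" "continuous_on UNIV v" and pos: "\<And>x. u x \<ge> 0" "\<And>x. v x \<ge> 0"
    unfolding weighted_HLE_def by auto
  \<comment> \<open>Half of the subcritical excess: \<alpha>1 and \<alpha>2 are then lowered by the
    same amount c, which makes their sum N - 2.\<close>
  define c where "c = ((?N + a) / (p + 1) + (?N + b) / (q + 1) - (?N - 2)) / 2"
  have c: "c > 0" using assms(7) unfolding subcritical_def c_def by simp
  define \<alpha>1 where "\<alpha>1 = (?N + a) / (p + 1) - c"
  define \<alpha>2 where "\<alpha>2 = (?N + b) / (q + 1) - c"
  have \<alpha>s: "\<alpha>1 + \<alpha>2 = ?N - 2" "(?N + a) / (p + 1) - \<alpha>1 = c" "(?N + b) / (q + 1) - \<alpha>2 = c"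
    unfolding \<alpha>1_def \<alpha>2_def by (simp_all add: c_def)
  \<comment> \<open>An eighth leaves room for R1 + \<delta> < r2 = R1 + 2 \<delta> < r3 = R4 - 2
    \<delta> < R4 - \<delta>: the cut-off changes strictly inside the annulus on which the energy is
    bounded.\<close>
  define \<delta> where "\<delta> = (R\<^sub>4 - R\<^sub>1) / 8"
  have \<delta>: "\<delta> > 0" using assms(9) by (simp add: \<delta>_def)
  define r2 where "r2 = R\<^sub>1 + 2 * \<delta>"
  define r3 where "r3 = R\<^sub>4 - 2 * \<delta>"
  have r: "0 < r2" "r2 < r3" "R\<^sub>1 + \<delta> < r2" "r3 < R\<^sub>4 - \<delta>"
  proof -
    have "R\<^sub>4 = R\<^sub>1 + 8 * \<delta>" by (simp add: \<delta>_def field_simps)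
    then show "0 < r2" "r2 < r3" "R\<^sub>1 + \<delta> < r2" "r3 < R\<^sub>4 - \<delta>"
      using assms(10) \<delta> by (simp_all add: r2_def r3_def)
  qed
  obtain \<eta> :: "real^'n \<Rightarrow> real" and K where \<eta>: "C1_on UNIV \<eta>" "\<And>x. 0 \<le> \<eta> x" "\<And>x. \<eta> x \<le> 1"
    "\<And>x. norm x \<le> r2 \<Longrightarrow> \<eta> x = 1" "\<And>x. norm x \<ge> r3 \<Longrightarrow> \<eta> x = 0"
    "K \<ge> 0" "\<And>i x. \<bar>pd i \<eta> x\<bar> \<le> K" "\<And>i x. norm x < r2 \<or> norm x > r3 \<Longrightarrow> pd i \<eta> x = 0"
    by (rule radial_cutoff_exists[OF r(1,2)]) blast
  have \<eta>A: "pd i \<eta> x = 0" if "x \<notin> annulus (R\<^sub>1 + \<delta>) (R\<^sub>4 - \<delta>)" for i x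
    using that r by (intro \<eta>(8)) (auto simp: mem_annulus)
  let ?Z = "pohozaev_field 1 1 p q a b \<alpha>1 \<alpha>2 u v"
  let ?\<eta> = "\<lambda>S x. \<eta> ((1 / S) *\<^sub>R x)"
  let ?E = "\<lambda>S. \<integral>\<^sup>*x. ennreal \<bar>\<Sum>i\<in>UNIV. pd i (?\<eta> S) x * ?Z i x\<bar>"
  let ?bound = "\<lambda>C D. \<forall>S s t. S > 0 \<longrightarrow> s > 0 \<longrightarrow> t > 0 \<longrightarrow> s * S powr (2 + a) * t powr (- p) \<le> 1 \<longrightarrow>
      t * S powr (2 + b) * s powr (- q) \<le> 1 \<longrightarrow>
      (\<integral>\<^sup>*x. ennreal ((s * u (S *\<^sub>R x)) powr (q + 1) + (t * v (S *\<^sub>R x)) powr (p + 1)) * indicator (annulus R\<^sub>1 R\<^sub>4) x) \<le> ennreal D \<longrightarrow>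
      ?E S \<le> ennreal (C * (S powr (?N - 2) / (s * t)))"
  \<comment> \<open>Large radii: s = R^\<alpha> and t = R^\<beta> turn both coefficients into 1, and
    the required energy bound is the hypothesis of the theorem.\<close>
  obtain C1 where C1: "C1 \<ge> 0" "\<forall>\<^sub>F R in at_top. ?E R \<le> ennreal (C1 * R powr (?N - 2 - \<alpha> - \<beta>))"
  proof -
    have "\<exists>C\<ge>0. ?bound C C\<^sub>0"
      by (rule boundary_terms_bound[OF sol pq assms(10) \<delta> less_imp_le[OF assms(11)] \<eta>(1,6,7)]) (rule \<eta>A)
    then obtain C where C: "C \<ge> 0" "?bound C C\<^sub>0"
      by (elim exE conjE)
    have "\<forall>\<^sub>F R in at_top. ?E R \<le> ennreal (C * R powr (?N - 2 - \<alpha> - \<beta>))"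
      using assms(12) eventually_gt_at_top[of 0]
    proof eventually_elim
      case (elim R)
      have 1: "R powr \<alpha> * R powr (2 + a) * (R powr \<beta>) powr (- p) = 1"
        "R powr \<beta> * R powr (2 + b) * (R powr \<alpha>) powr (- q) = 1"
        using elim(2) ab by (simp_all add: powr_powr powr_add[symmetric] algebra_simps)
      have 2: "R powr (?N - 2) / (R powr \<alpha> * R powr \<beta>) = R powr (?N - 2 - \<alpha> - \<beta>)"
        by (simp add: powr_diff)
      have "continuous_on UNIV (\<lambda>x. R powr \<alpha> * u (R *\<^sub>R x))" "continuous_on UNIV (\<lambda>x. R powr \<beta> * v (R *\<^sub>R x))"
        by (intro continuous_intros continuous_on_compose2[OF cu(1)] continuous_on_compose2[OF cu(2)]; simp)+
      then have "(\<integral>\<^sup>*x. ennreal ((R powr \<alpha> * u (R *\<^sub>R x)) powr (q + 1) + (R powr \<beta> * v (R *\<^sub>R x)) powr (p + 1))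
          * indicator (annulus R\<^sub>1 R\<^sub>4) x) \<le> ennreal C\<^sub>0"
        by (rule annulus_integral_to_nn) (use pos pq elim(1) in \<open>auto simp: rescale_def \<alpha>_def \<beta>_def\<close>)
      then show ?case using C(2)[rule_format, of R "R powr \<alpha>" "R powr \<beta>"] elim(2) 1 2 by simp
    qed
    then show ?thesis using that C(1) by blast
  qed
  \<comment> \<open>Small radii: s = t = 1, and continuity of u and v on a closed ball bounds the
    energy over all rescaled annuli at once.\<close>
  obtain C2 where C2: "C2 \<ge> 0" "\<And>\<epsilon>. 0 < \<epsilon> \<Longrightarrow> \<epsilon> \<le> 1 \<Longrightarrow> ?E \<epsilon> \<le> ennreal (C2 * \<epsilon> powr (?N - 2))"
  proof -
    have "\<exists>M. \<forall>x\<in>cball 0 R\<^sub>4. h x \<le> M" if "continuous_on UNIV h" for h :: "real^'n \<Rightarrow> real"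
    proof -
      have "compact (h ` cball 0 R\<^sub>4)" by (intro compact_continuous_image continuous_on_subset[OF that]) auto
      then have "bounded (h ` cball 0 R\<^sub>4)" by (rule compact_imp_bounded)
      then obtain M where "\<forall>y\<in>h ` cball 0 R\<^sub>4. norm y \<le> M" unfolding bounded_iff by blast
      then have "\<forall>x\<in>cball 0 R\<^sub>4. h x \<le> M" by (auto simp: abs_le_iff)
      then show ?thesis by blast
    qed
    then obtain M1 M2 where M: "\<And>x. x \<in> cball 0 R\<^sub>4 \<Longrightarrow> u x \<le> M1" "\<And>x. x \<in> cball 0 R\<^sub>4 \<Longrightarrow> v x \<le> M2"
      using cu by metis
    let ?A = "annulus R\<^sub>1 R\<^sub>4 :: (real^'n) set"
    define m where "m = M1 powr (q + 1) + M2 powr (p + 1)"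
    define D where "D = enn2real (ennreal m * emeasure lborel ?A)"
    have fin: "ennreal m * emeasure lborel ?A < \<infinity>"
      using emeasure_annulus_finite[of R\<^sub>1 R\<^sub>4, where 'n='n] by (simp add: ennreal_mult_less_top)
    have int: "(\<integral>\<^sup>*x. ennreal ((1 * u (\<epsilon> *\<^sub>R x)) powr (q + 1) + (1 * v (\<epsilon> *\<^sub>R x)) powr (p + 1)) * indicator ?A x) \<le> ennreal D"
      if \<epsilon>: "0 < \<epsilon>" "\<epsilon> \<le> 1" for \<epsilon>
    proof -
      have "(\<integral>\<^sup>*x. ennreal ((1 * u (\<epsilon> *\<^sub>R x)) powr (q + 1) + (1 * v (\<epsilon> *\<^sub>R x)) powr (p + 1)) * indicator ?A x)
        \<le> (\<integral>\<^sup>*x. ennreal m * indicator ?A x)"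
      proof (rule nn_integral_mono)
        fix x :: "real^'n"
        show "ennreal ((1 * u (\<epsilon> *\<^sub>R x)) powr (q + 1) + (1 * v (\<epsilon> *\<^sub>R x)) powr (p + 1)) * indicator ?A x \<le> ennreal m * indicator ?A x"
        proof (cases "x \<in> ?A")
          case True
          then have "norm x \<le> R\<^sub>4" by (simp add: mem_annulus)
          then have "\<epsilon> * norm x \<le> 1 * R\<^sub>4" using \<epsilon> by (intro mult_mono) auto
          then have B: "\<epsilon> *\<^sub>R x \<in> cball 0 R\<^sub>4" using \<epsilon> by simp
          have "u (\<epsilon> *\<^sub>R x) powr (q + 1) \<le> M1 powr (q + 1)" "v (\<epsilon> *\<^sub>R x) powr (p + 1) \<le> M2 powr (p + 1)"
            using M[OF B] pos pq by (auto intro!: powr_mono2)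
          then have "ennreal ((1 * u (\<epsilon> *\<^sub>R x)) powr (q + 1) + (1 * v (\<epsilon> *\<^sub>R x)) powr (p + 1)) \<le> ennreal m"
            unfolding m_def mult_1_left by (intro ennreal_leI add_mono)
          then show ?thesis by (rule mult_right_mono) simp
        qed simp
      qed
      also have "\<dots> = ennreal m * emeasure lborel ?A" by (rule nn_integral_cmult_indicator) simp
      also have "\<dots> = ennreal D" unfolding D_def using fin by simp
      finally show ?thesis .
    qed
    have D: "D \<ge> 0" by (simp add: D_def)
    have "\<exists>C\<ge>0. ?bound C D"
      by (rule boundary_terms_bound[OF sol pq assms(10) \<delta> D \<eta>(1,6,7)]) (rule \<eta>A)
    then obtain C where C: "C \<ge> 0" "?bound C D"
      by (elim exE conjE)
    have "?E \<epsilon> \<le> ennreal (C * \<epsilon> powr (?N - 2))" if \<epsilon>: "0 < \<epsilon>" "\<epsilon> \<le> 1" for \<epsilon>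
    proof -
      \<comment> \<open>This is where a, b > -2 enters: the coefficients of the system scaled up
        from the origin stay at most 1.\<close>
      have "\<epsilon> powr (2 + a) \<le> 1" "\<epsilon> powr (2 + b) \<le> 1" using \<epsilon> assms(5,6) by (auto intro!: powr_le1)
      then show ?thesis using C(2)[rule_format, of \<epsilon> 1 1] int[OF \<epsilon>] \<epsilon> by simp
    qed
    then show ?thesis using that C(1) by blast
  qed
  define w where "w = HLE_density 1 1 p q a b u v"
  have w0: "w x \<ge> 0" for x unfolding w_def HLE_density_def using pos by simp
  have cw: "continuous_on (UNIV - {0}) w" unfolding w_def by (rule continuous_on_HLE_density[OF sol pq])
  have key: "(\<integral>\<^sup>*x. ennreal (c * (?\<eta> R x * (1 - ?\<eta> \<epsilon> x) * w x))) \<le> ?E R + ?E \<epsilon>"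
    if R: "R > 0" and \<epsilon>: "\<epsilon> > 0" for R \<epsilon>
  proof -
    have C1\<eta>: "C1_on UNIV (?\<eta> S)" for S
      using C1_on_affine(1)[OF \<eta>(1), of UNIV 0 "1 / S"] by simp
    define \<zeta> where "\<zeta> x = ?\<eta> R x * (1 - ?\<eta> \<epsilon> x)" for x
    have d\<eta>: "?\<eta> S differentiable (at x)" for S x using C1_on_differentiable[OF C1\<eta>] by simp
    have p\<zeta>: "pd i \<zeta> x = (1 - ?\<eta> \<epsilon> x) * pd i (?\<eta> R) x - ?\<eta> R x * pd i (?\<eta> \<epsilon>) x" for i x
    proof -
      have "pd i \<zeta> x = ?\<eta> R x * pd i (\<lambda>x. 1 - ?\<eta> \<epsilon> x) x + pd i (?\<eta> R) x * (1 - ?\<eta> \<epsilon> x)"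
        unfolding \<zeta>_def by (rule partial_deriv_mult[OF d\<eta>]) (intro differentiable_diff differentiable_const d\<eta>)
      also have "pd i (\<lambda>x. 1 - ?\<eta> \<epsilon> x) x = - pd i (?\<eta> \<epsilon>) x"
        by (subst partial_deriv_diff[OF differentiable_const d\<eta>]) simp
      finally show ?thesis by (simp add: mult.commute)
    qed
    have C1\<zeta>: "C1_on UNIV \<zeta>" unfolding \<zeta>_def by (intro C1_on_mult C1_on_diff C1_on_const C1\<eta>)
    have near: "\<zeta> x = 0" if "norm x < \<epsilon> * r2" for x
    proof -
      have "norm ((1 / \<epsilon>) *\<^sub>R x) \<le> r2" using that \<epsilon> by (simp add: field_simps)
      from \<eta>(4)[OF this] show ?thesis by (simp add: \<zeta>_def)
    qed
    have far: "\<zeta> x = 0" if "norm x > R * r3" for x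
    proof -
      have "norm ((1 / R) *\<^sub>R x) \<ge> r3" using that R by (simp add: field_simps)
      from \<eta>(5)[OF this] show ?thesis by (simp add: \<zeta>_def)
    qed
    have [measurable]: "?Z i \<in> borel_measurable borel" for i
      using sol unfolding weighted_HLE_def
      by (intro borel_measurable_continuous_punctured C1_on_continuous C1_on_pohozaev_field pq) auto
    have [measurable]: "pd i (?\<eta> S) \<in> borel_measurable borel" for i S
      by (rule borel_measurable_continuous_onI) (use C1\<eta> in \<open>auto simp: C1_on_def\<close>)
    have "(\<integral>\<^sup>*x. ennreal (c * (\<zeta> x * w x))) \<le> (\<integral>\<^sup>*x. ennreal \<bar>\<Sum>i\<in>UNIV. pd i \<zeta> x * ?Z i x\<bar>)"
      unfolding w_def
      by (rule pohozaev_inequality[where \<rho>="\<epsilon> * r2" and r="R * r3", OF sol _ _ pq _ \<alpha>s C1\<zeta> _ near far])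
         (use c \<epsilon> r \<eta>(2,3) in \<open>auto simp: \<zeta>_def\<close>)
    also have "\<dots> \<le> (\<integral>\<^sup>*x. ennreal \<bar>\<Sum>i\<in>UNIV. pd i (?\<eta> R) x * ?Z i x\<bar> + ennreal \<bar>\<Sum>i\<in>UNIV. pd i (?\<eta> \<epsilon>) x * ?Z i x\<bar>)"
    proof (rule nn_integral_mono)
      fix x
      let ?a = "\<Sum>i\<in>UNIV. pd i (?\<eta> R) x * ?Z i x" and ?b = "\<Sum>i\<in>UNIV. pd i (?\<eta> \<epsilon>) x * ?Z i x"
      have lin: "(\<Sum>i\<in>UNIV. (k * A i - l * B i) * W i) = k * (\<Sum>i\<in>UNIV. A i * W i) - l * (\<Sum>i\<in>UNIV. B i * W i)"
        for k l :: real and A B W :: "'n \<Rightarrow> real"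
        by (simp add: sum_distrib_left sum_subtractf algebra_simps)
      have eq: "(\<Sum>i\<in>UNIV. pd i \<zeta> x * ?Z i x) = (1 - ?\<eta> \<epsilon> x) * ?a - ?\<eta> R x * ?b"
        unfolding p\<zeta> by (rule lin)
      \<comment> \<open>The transition zones at R and at \<epsilon> may overlap; the bound uses only
        that both cut-offs take values in [0, 1].\<close>
      have conv: "\<bar>(1 - k) * A - l * B\<bar> \<le> \<bar>A\<bar> + \<bar>B\<bar>" if "0 \<le> k" "k \<le> 1" "0 \<le> l" "l \<le> 1" for k l A B :: real
      proof -
        have "\<bar>(1 - k) * A\<bar> \<le> \<bar>A\<bar>" "\<bar>l * B\<bar> \<le> \<bar>B\<bar>"
          unfolding abs_mult using that by (intro mult_left_le_one_le; simp)+
        then show ?thesis by linarith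
      qed
      show "ennreal \<bar>\<Sum>i\<in>UNIV. pd i \<zeta> x * ?Z i x\<bar> \<le> ennreal \<bar>?a\<bar> + ennreal \<bar>?b\<bar>"
        unfolding eq ennreal_plus[OF abs_ge_zero abs_ge_zero, symmetric]
        by (intro ennreal_leI conv \<eta>(2,3))
    qed
    also have "\<dots> = ?E R + ?E \<epsilon>" by (rule nn_integral_add) measurable
    finally show ?thesis unfolding \<zeta>_def .
  qed
  \<comment> \<open>Were w positive at x0, its integral over a small ball would give a fixed lower
    bound m for the boundary terms, which tend to 0.\<close>
  have wz: "w x0 = 0" if x0: "x0 \<noteq> 0" for x0
  proof (rule ccontr)
    assume "w x0 \<noteq> 0"
    then have wp: "w x0 > 0" using w0[of x0] by simp
    have "isCont w x0" using cw x0 by (simp add: continuous_on_eq_continuous_at open_delete)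
    then obtain d where d: "d > 0" "\<And>x. dist x x0 < d \<Longrightarrow> dist (w x) (w x0) < w x0 / 2"
      using wp unfolding continuous_at_eps_delta by (meson half_gt_zero)
    \<comment> \<open>Half the norm of x0 keeps the ball between the radii
      \<open>norm x0 / 2\<close> and \<open>2 * norm x0\<close>, away from both cut-off zones once R
      is large.\<close>
    define \<rho> where "\<rho> = min d (norm x0 / 2)"
    have \<rho>: "\<rho> > 0" "\<rho> \<le> d" "\<rho> \<le> norm x0 / 2" using d x0 by (auto simp: \<rho>_def)
    have wb: "w x \<ge> w x0 / 2" and nb: "norm x0 / 2 \<le> norm x" "norm x \<le> 2 * norm x0" if "x \<in> ball x0 \<rho>" for x
    proof -
      have "dist x x0 < d" "dist x x0 < norm x0 / 2" using that \<rho> by (auto simp: dist_commute)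
      then have "\<bar>w x - w x0\<bar> < w x0 / 2" "norm (x - x0) < norm x0 / 2"
        using d(2)[of x] by (auto simp: dist_norm)
      moreover have "norm x0 - norm x \<le> norm (x - x0)" "norm x - norm x0 \<le> norm (x - x0)"
        using norm_triangle_ineq2[of x0 x] norm_triangle_ineq2[of x x0] by (simp_all add: norm_minus_commute)
      ultimately show "w x \<ge> w x0 / 2" "norm x0 / 2 \<le> norm x" "norm x \<le> 2 * norm x0"
        using norm_ge_zero[of x0] by linarith+
    qed
    define m where "m = c * (w x0 / 2) * measure lborel (ball x0 \<rho>)"
    have m: "m > 0" unfolding m_def using c wp content_ball_pos[OF \<rho>(1), of x0] by simp
    \<comment> \<open>The inner radius is tied to the outer one by \<epsilon> = 1 / R, so a single
      limit removes both boundary terms. The lower bounds on R ensure \<epsilon> at most 1 and put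
      the ball where the outer cut-off is 1 and the inner one 0.\<close>
    have "\<forall>\<^sub>F R in at_top. m \<le> C1 * R powr (?N - 2 - \<alpha> - \<beta>) + C2 * (1 / R) powr (?N - 2)"
      using C1(2) eventually_ge_at_top[of 1] eventually_ge_at_top[of "2 * norm x0 / r2"] eventually_ge_at_top[of "2 * r3 / norm x0"]
    proof eventually_elim
      case (elim R)
      have R: "R > 0" "1 / R > 0" "1 / R \<le> 1" using elim(2) by auto
      have "ennreal m = ennreal (c * (w x0 / 2)) * emeasure lborel (ball x0 \<rho>)"
      proof -
        have "emeasure lborel (ball x0 \<rho>) = ennreal (measure lborel (ball x0 \<rho>))"
          by (rule emeasure_eq_ennreal_measure) (use emeasure_bounded_finite[OF bounded_ball, of x0 \<rho>] in auto)
        moreover have "0 \<le> c * (w x0 / 2)" using c wp by simp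
        ultimately show ?thesis unfolding m_def by (simp only: ennreal_mult[OF _ measure_nonneg])
      qed
      also have "\<dots> = (\<integral>\<^sup>*x. ennreal (c * (w x0 / 2)) * indicator (ball x0 \<rho>) x)"
        by (rule nn_integral_cmult_indicator[symmetric]) simp
      also have "\<dots> \<le> (\<integral>\<^sup>*x. ennreal (c * (?\<eta> R x * (1 - ?\<eta> (1 / R) x) * w x)))"
      proof (rule nn_integral_mono)
        fix x
        show "ennreal (c * (w x0 / 2)) * indicator (ball x0 \<rho>) x \<le> ennreal (c * (?\<eta> R x * (1 - ?\<eta> (1 / R) x) * w x))"
        proof (cases "x \<in> ball x0 \<rho>")
          case True
          have "2 * norm x0 \<le> R * r2" using elim(3) r by (simp add: field_simps)
          then have "norm ((1 / R) *\<^sub>R x) \<le> r2" using nb(2)[OF True] R by (simp add: field_simps)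
          then have 1: "?\<eta> R x = 1" by (rule \<eta>(4))
          have "2 * r3 \<le> R * norm x0" using elim(4) x0 by (simp add: field_simps)
          moreover have "R * (norm x0 / 2) \<le> R * norm x" using nb(1)[OF True] R by (intro mult_left_mono) auto
          ultimately have "r3 \<le> R * norm x" by linarith
          then have "norm ((1 / (1 / R)) *\<^sub>R x) \<ge> r3" using R by simp
          then have 2: "?\<eta> (1 / R) x = 0" by (rule \<eta>(5))
          show ?thesis using True wb[OF True] c unfolding 1 2 by (auto intro!: ennreal_leI)
        qed simp
      qed
      also have "\<dots> \<le> ?E R + ?E (1 / R)" by (rule key[OF R(1,2)])
      also have "\<dots> \<le> ennreal (C1 * R powr (?N - 2 - \<alpha> - \<beta>)) + ennreal (C2 * (1 / R) powr (?N - 2))"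
        by (intro add_mono elim(1) C2(2) R)
      also have "\<dots> = ennreal (C1 * R powr (?N - 2 - \<alpha> - \<beta>) + C2 * (1 / R) powr (?N - 2))"
        using C1(1) C2(1) by simp
      finally have "ennreal m \<le> \<dots>" .
      moreover have "0 \<le> C1 * R powr (?N - 2 - \<alpha> - \<beta>) + C2 * (1 / R) powr (?N - 2)"
        using C1(1) C2(1) by simp
      ultimately show ?case by (simp only: ennreal_le_iff)
    qed
    moreover have "((\<lambda>R. C1 * R powr (?N - 2 - \<alpha> - \<beta>) + C2 * (1 / R) powr (?N - 2)) \<longlongrightarrow> C1 * 0 + C2 * 0) at_top"
    proof (intro tendsto_add tendsto_mult tendsto_const)
      show "((\<lambda>R. R powr (?N - 2 - \<alpha> - \<beta>)) \<longlongrightarrow> 0) at_top"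
        by (rule tendsto_neg_powr) (use \<sigma> in \<open>auto simp: filterlim_ident\<close>)
      \<comment> \<open>Here the dimension must exceed 2.\<close>
      have "((\<lambda>R. R powr (- (?N - 2))) \<longlongrightarrow> 0) at_top"
        by (rule tendsto_neg_powr) (use assms(1) in \<open>auto simp: filterlim_ident\<close>)
      moreover have "\<forall>\<^sub>F R in at_top. R powr (- (?N - 2)) = (1 / R) powr (?N - 2)"
        using eventually_gt_at_top[of 0] by eventually_elim (simp add: powr_minus powr_divide inverse_eq_divide del: minus_diff_eq)
      ultimately show "((\<lambda>R. (1 / R) powr (?N - 2)) \<longlongrightarrow> 0) at_top" by (rule Lim_transform_eventually)
    qed
    ultimately have "m \<le> C1 * 0 + C2 * 0" by (intro tendsto_lowerbound) auto
    then show False using m by simp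
  qed
  have uv: "u x = 0 \<and> v x = 0" if "x \<noteq> 0" for x
  proof -
    have "u x * (1 * norm x powr b * u x powr q) \<ge> 0" "v x * (1 * norm x powr a * v x powr p) \<ge> 0" using pos by auto
    then have "u x * (1 * norm x powr b * u x powr q) = 0" "v x * (1 * norm x powr a * v x powr p) = 0"
      using wz[OF that] unfolding w_def HLE_density_def by linarith+
    then show ?thesis using that by auto
  qed
  \<comment> \<open>Only points off the origin have been treated; continuity supplies the value
    there.\<close>
  have at0: "h 0 = 0" if "continuous_on UNIV h" "\<And>x. x \<noteq> 0 \<Longrightarrow> h x = 0" for h :: "real^'n \<Rightarrow> real"
  proof -
    have "(h \<longlongrightarrow> h 0) (at 0)" using that(1) by (simp add: continuous_on_eq_continuous_at isCont_def)
    moreover have "((\<lambda>_. 0) \<longlongrightarrow> (0::real)) (at (0 :: real^'n))" by simp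
    moreover have "\<forall>\<^sub>F x in at 0. h x = 0" using that(2) by (simp add: eventually_at_filter)
    ultimately show ?thesis
      using tendsto_cong[of h "\<lambda>_. 0" "at 0" "h 0"] tendsto_const_iff[of "at (0::real^'n)" 0 "h 0"] by simp
  qed
  show ?thesis using uv at0[OF cu(1)] at0[OF cu(2)] by metis
qed

end
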